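(* Let $G$ be a torus acting smoothly on a manifold $M$. An abstract moment map on $M$ whose assignment is identically zero is exact. More explicitly, suppose that $\Psi\colon M\to\mathfrak g^*$ is an abstract moment map such that for each (Lie) subgroup $H\subseteq G$ the function $\Psi^H\colon M\to\mathfrak h^*$ vanishes on the $H$-fixed point set $M^H$. Then there exists a $G$-invariant one-form $\mu$ on $M$ such that $\Psi^\xi=\mu(\xi_M)$ for all $\xi\in\mathfrak g$.
   Context: $\mathfrak g$ is the Lie algebra of $G$, and $\xi_M$ is the vector field on $M$ generated by $\xi\in\mathfrak g$. For a subgroup $H\subseteq G$ with Lie algebra $\mathfrak h$ and a map $\Psi\colon M\to\mathfrak g^*$, both $\Psi^H$ and $\Psi^{\mathfrak h}$ denote the composition of $\Psi$ with the restriction map $\mathfrak g^*\to\mathfrak h^*$, and $\Psi^\xi=\langle\Psi,\xi\rangle$. An abstract moment map on $M$ is a smooth $G$-equivariant map $\Psi\colon M\to\mathfrak g^*$ such that for every (Lie) subgroup $H\subseteq G$ the map $\Psi^H$ is locally constant on $M^H$. It is called exact if there is a $G$-invariant one-form $\mu$ with $\Psi^\xi=\mu(\xi_M)$ for all $\xi\in\mathfrak g$. The infinitesimal stabilizer of $m\in M$ is $\mathfrak g_m=\{\xi\in\mathfrak g:\xi_M|_m=0\}$. The infinitesimal orbit type strata are the connected components of the sets $\{m:\mathfrak g_m=\mathfrak h\}$, for subalgebras $\mathfrak h\subseteq\mathfrak g$, and $\mathfrak g_X$ is the common infinitesimal stabilizer of the points of a stratum $X$. The assignment of $\Psi$ is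 the function sending each stratum $X$ to the constant value $\Psi^{\mathfrak g_X}(X)\in\mathfrak g_X^*$ of $\Psi^{\mathfrak g_X}$ on $X$. *)

theory Defs
  imports "HOL-Analysis.Analysis" "HOL-Algebra.Group_Action"
begin

section \<open>Smooth functions on relatively open subsets of a linear subspace\<close>

text \<open>
  \<open>W\<close> is meant to be relatively open in the linear subspace \<open>E\<close>. Derivatives are taken within
  \<open>W\<close> and evaluated only in directions belonging to \<open>E\<close>, where they are uniquely determined; for
  \<open>E = UNIV\<close> and \<open>W\<close> open these are the usual classes \<open>C\<^sup>k\<close>.
\<close>

primrec Ck_on ::
  "nat \<Rightarrow> 'a::real_normed_vector set \<Rightarrow> 'a set \<Rightarrow> ('a \<Rightarrow> 'b::real_normed_vector) \<Rightarrow> bool" where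
  "Ck_on 0 E W f \<longleftrightarrow> continuous_on W f"
| "Ck_on (Suc k) E W f \<longleftrightarrow>
     (\<forall>x\<in>W. f differentiable (at x within W)) \<and>
     (\<forall>v\<in>E. Ck_on k E W (\<lambda>x. frechet_derivative f (at x within W) v))"

definition smooth_on ::
  "'a::real_normed_vector set \<Rightarrow> 'a set \<Rightarrow> ('a \<Rightarrow> 'b::real_normed_vector) \<Rightarrow> bool" where
  "smooth_on E W f \<longleftrightarrow> (\<forall>k. Ck_on k E W f)"

text \<open>
  A type of class \<open>euclidean_space\<close> has positive dimension. Admitting \<open>{0}\<close> as a model space besides
  the whole type includes the zero-dimensional manifolds and the trivial torus.
\<close>

definition model_space :: "'a::euclidean_space set \<Rightarrow> bool" where
  "model_space E \<longleftrightarrow> E = UNIV \<or> E = {0}"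


section \<open>Smooth manifolds\<close>

text \<open>
  The underlying space of a manifold is the whole type \<open>'m\<close> with its topology; a chart is a pair
  of its domain and its coordinate map (whose values off the domain are irrelevant).
\<close>

record ('m, 'e) manifold =
  model :: "'e set"
  atlas :: "('m set \<times> ('m \<Rightarrow> 'e)) set"

definition chart :: "'e::euclidean_space set \<Rightarrow> 'm::topological_space set \<times> ('m \<Rightarrow> 'e) \<Rightarrow> bool" where
  "chart E = (\<lambda>(U, \<phi>). open U \<and> openin (top_of_set E) (\<phi> ` U) \<and>
     homeomorphism U (\<phi> ` U) \<phi> (inv_into U \<phi>))"

definition smooth_manifold ::
  "('m::{t2_space, second_countable_topology}, 'e::euclidean_space) manifold \<Rightarrow> bool" where
  "smooth_manifold M \<longleftrightarrow>
     model_space (model M) \<and>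
     (\<forall>c\<in>atlas M. chart (model M) c) \<and>
     (\<Union>c\<in>atlas M. fst c) = UNIV \<and>
     (\<forall>(U, \<phi>)\<in>atlas M. \<forall>(V, \<psi>)\<in>atlas M.
        smooth_on (model M) (\<phi> ` (U \<inter> V)) (\<psi> \<circ> inv_into U \<phi>))"

definition smooth_function ::
  "('m::topological_space, 'e::euclidean_space) manifold \<Rightarrow> ('m \<Rightarrow> real) \<Rightarrow> bool" where
  "smooth_function M f \<longleftrightarrow>
     (\<forall>(U, \<phi>)\<in>atlas M. smooth_on (model M) (\<phi> ` U) (f \<circ> inv_into U \<phi>))"

text \<open>
  Tangent vectors at \<open>m\<close> are the derivations at \<open>m\<close> of the algebra of smooth functions. They are
  extended by \<open>0\<close> to non-smooth functions, so that equality of tangent vectors is equality in HOL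
  and the vector space operations are pointwise.
\<close>

definition tangent_space ::
  "('m::topological_space, 'e::euclidean_space) manifold \<Rightarrow> 'm \<Rightarrow> (('m \<Rightarrow> real) \<Rightarrow> real) set" where
  "tangent_space M m = {v.
     (\<forall>f. \<not> smooth_function M f \<longrightarrow> v f = 0) \<and>
     (\<forall>f g a b. smooth_function M f \<longrightarrow> smooth_function M g \<longrightarrow>
        v (\<lambda>x. a * f x + b * g x) = a * v f + b * v g) \<and>
     (\<forall>f g. smooth_function M f \<longrightarrow> smooth_function M g \<longrightarrow>
        v (\<lambda>x. f x * g x) = f m * v g + g m * v f)}"

definition pushforward ::
  "('m::topological_space, 'e::euclidean_space) manifold \<Rightarrow> ('m \<Rightarrow> 'm)
     \<Rightarrow> (('m \<Rightarrow> real) \<Rightarrow> real) \<Rightarrow> ('m \<Rightarrow> real) \<Rightarrow> real" where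
  "pushforward M F v = (\<lambda>f. if smooth_function M f then v (f \<circ> F) else 0)"

definition smooth_vector_field ::
  "('m::topological_space, 'e::euclidean_space) manifold
     \<Rightarrow> ('m \<Rightarrow> ('m \<Rightarrow> real) \<Rightarrow> real) \<Rightarrow> bool" where
  "smooth_vector_field M X \<longleftrightarrow>
     (\<forall>m. X m \<in> tangent_space M m) \<and>
     (\<forall>f. smooth_function M f \<longrightarrow> smooth_function M (\<lambda>m. X m f))"

definition one_form ::
  "('m::topological_space, 'e::euclidean_space) manifold
     \<Rightarrow> ('m \<Rightarrow> (('m \<Rightarrow> real) \<Rightarrow> real) \<Rightarrow> real) \<Rightarrow> bool" where
  "one_form M \<mu> \<longleftrightarrow>
     (\<forall>m. \<forall>v\<in>tangent_space M m. \<forall>w\<in>tangent_space M m. \<forall>a b.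
        \<mu> m (\<lambda>f. a * v f + b * w f) = a * \<mu> m v + b * \<mu> m w) \<and>
     (\<forall>X. smooth_vector_field M X \<longrightarrow> smooth_function M (\<lambda>m. \<mu> m (X m)))"


section \<open>Tori and their smooth actions\<close>

text \<open>
  The torus \<open>(S\<^sup>1)\<^sup>k\<close>, \<open>k = CARD('k)\<close>, with Lie algebra \<open>\<gg> = \<real>\<^sup>k\<close> and exponential map
  \<open>torus_exp\<close>; for \<open>\<gg> = {0}\<close> it is the trivial group.
\<close>

definition torus_exp :: "real ^ 'k::finite \<Rightarrow> complex ^ 'k" where
  "torus_exp \<xi> = (\<chi> j. cis (2 * pi * \<xi> $ j))"

definition torus :: "(real ^ 'k::finite) set \<Rightarrow> (complex ^ 'k) monoid" where
  "torus \<gg> = \<lparr>carrier = torus_exp ` \<gg>, mult = (\<lambda>x y. \<chi> j. x $ j * y $ j), one = (\<chi> j. 1)\<rparr>"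

lemma carrier_torus_UNIV: "carrier (torus UNIV) = {z. \<forall>j. cmod (z $ j) = 1}"
proof -
  have "z \<in> range torus_exp" if z: "\<forall>j. cmod (z $ j) = 1" for z :: "complex ^ 'k"
  proof -
    have "z = torus_exp (\<chi> j. Arg (z $ j) / (2 * pi))"
      using z by (simp add: torus_exp_def vec_eq_iff cis_Arg_unique flip: cis_Arg)
        (metis cis_Arg complex_sgn_def div_by_1 norm_zero of_real_1 scaleR_one sgn_div_norm
          inverse_1 zero_neq_one)
    then show ?thesis by blast
  qed
  then show ?thesis
    by (auto simp: torus_def torus_exp_def)
qed

lemma group_torus:
  assumes "model_space \<gg>"
  shows "group (torus \<gg>)"
proof (rule groupI)
  have sub: "subspace \<gg>"
    using assms by (auto simp: model_space_def subspace_def)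
  have add: "torus_exp (\<xi> + \<eta>) = (\<chi> j. torus_exp \<xi> $ j * torus_exp \<eta> $ j)" for \<xi> \<eta> :: "real ^ 'a"
    by (simp add: torus_exp_def vec_eq_iff cis_mult algebra_simps)
  have zero: "torus_exp (0 :: real ^ 'a) = (\<chi> j. 1)"
    by (simp add: torus_exp_def vec_eq_iff)
  show "x \<otimes>\<^bsub>torus \<gg>\<^esub> y \<in> carrier (torus \<gg>)"
    if "x \<in> carrier (torus \<gg>)" "y \<in> carrier (torus \<gg>)" for x y
    using that sub by (auto simp: torus_def subspace_add simp flip: add)
  show "\<one>\<^bsub>torus \<gg>\<^esub> \<in> carrier (torus \<gg>)"
    using sub by (auto simp: torus_def subspace_0 simp flip: zero)
  show "\<exists>y\<in>carrier (torus \<gg>). y \<otimes>\<^bsub>torus \<gg>\<^esub> x = \<one>\<^bsub>torus \<gg>\<^esub>"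
    if x: "x \<in> carrier (torus \<gg>)" for x
  proof -
    obtain \<xi> where \<xi>: "\<xi> \<in> \<gg>" "x = torus_exp \<xi>"
      using x by (auto simp: torus_def)
    have "torus_exp (- \<xi>) \<otimes>\<^bsub>torus \<gg>\<^esub> x = \<one>\<^bsub>torus \<gg>\<^esub>"
      using add[of "- \<xi>" \<xi>] zero \<xi> by (simp add: torus_def)
    moreover have "torus_exp (- \<xi>) \<in> carrier (torus \<gg>)"
      using \<xi> sub by (auto simp: torus_def subspace_neg)
    ultimately show ?thesis by blast
  qed
qed (auto simp: torus_def vec_eq_iff algebra_simps)

text \<open>
  Since \<open>torus_exp\<close> is a surjective local diffeomorphism, whose local inverses are the charts of
  the torus, smoothness of the action map on \<open>G \<times> M\<close> is smoothness of its lift to \<open>\<gg> \<times> M\<close>.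
\<close>

definition smooth_torus_action ::
  "('m::topological_space, 'e::euclidean_space) manifold \<Rightarrow> (real ^ 'k::finite) set
     \<Rightarrow> (complex ^ 'k \<Rightarrow> 'm \<Rightarrow> 'm) \<Rightarrow> bool" where
  "smooth_torus_action M \<gg> \<rho> \<longleftrightarrow>
     group_action (torus \<gg>) UNIV \<rho> \<and>
     continuous_on (\<gg> \<times> UNIV) (\<lambda>(\<xi>, m). \<rho> (torus_exp \<xi>) m) \<and>
     (\<forall>(U, \<phi>)\<in>atlas M. \<forall>(V, \<psi>)\<in>atlas M.
        smooth_on (\<gg> \<times> model M)
          {(\<xi>, x). \<xi> \<in> \<gg> \<and> x \<in> \<phi> ` U \<and> \<rho> (torus_exp \<xi>) (inv_into U \<phi> x) \<in> V}
          (\<lambda>(\<xi>, x). \<psi> (\<rho> (torus_exp \<xi>) (inv_into U \<phi> x))))"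

text \<open>Lie subgroups of a torus are understood to be closed (hence embedded).\<close>

definition lie_subgroup :: "(real ^ 'k::finite) set \<Rightarrow> (complex ^ 'k) set \<Rightarrow> bool" where
  "lie_subgroup \<gg> H \<longleftrightarrow> subgroup H (torus \<gg>) \<and> closed H"

definition lie_algebra :: "(real ^ 'k::finite) set \<Rightarrow> (complex ^ 'k) set \<Rightarrow> (real ^ 'k) set" where
  "lie_algebra \<gg> H = {\<xi>\<in>\<gg>. \<forall>t. torus_exp (t *\<^sub>R \<xi>) \<in> H}"

definition fixed_points :: "('g \<Rightarrow> 'm \<Rightarrow> 'm) \<Rightarrow> 'g set \<Rightarrow> 'm set" where
  "fixed_points \<rho> H = {m. \<forall>h\<in>H. \<rho> h m = m}"

text \<open>The value at \<open>m\<close> of the vector field \<open>\<xi>\<^sub>M\<close>.\<close>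

definition generating_field ::
  "('m::topological_space, 'e::euclidean_space) manifold \<Rightarrow> (complex ^ 'k::finite \<Rightarrow> 'm \<Rightarrow> 'm)
     \<Rightarrow> real ^ 'k \<Rightarrow> 'm \<Rightarrow> ('m \<Rightarrow> real) \<Rightarrow> real" where
  "generating_field M \<rho> \<xi> m =
     (\<lambda>f. if smooth_function M f then deriv (\<lambda>t. f (\<rho> (torus_exp (t *\<^sub>R \<xi>)) m)) 0 else 0)"

definition invariant_form ::
  "('m::topological_space, 'e::euclidean_space) manifold \<Rightarrow> (real ^ 'k::finite) set
     \<Rightarrow> (complex ^ 'k \<Rightarrow> 'm \<Rightarrow> 'm) \<Rightarrow> ('m \<Rightarrow> (('m \<Rightarrow> real) \<Rightarrow> real) \<Rightarrow> real) \<Rightarrow> bool" where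
  "invariant_form M \<gg> \<rho> \<mu> \<longleftrightarrow>
     (\<forall>g\<in>carrier (torus \<gg>). \<forall>m. \<forall>v\<in>tangent_space M m.
        \<mu> (\<rho> g m) (pushforward M (\<rho> g) v) = \<mu> m v)"


section \<open>Abstract moment maps and assignments\<close>

text \<open>
  The dual of a linear subspace \<open>\<hh>\<close>, as functions on \<open>\<hh>\<close> (extensional in the sense of
  \<open>HOL-Library.FuncSet\<close>). Thus \<open>restrict \<alpha> \<hh>\<close> is the image of \<open>\<alpha>\<close> under
  \<open>\<gg>\<^sup>* \<rightarrow> \<hh>\<^sup>*\<close>.
\<close>

definition dual_space :: "'a::real_vector set \<Rightarrow> ('a \<Rightarrow> real) set" where
  "dual_space \<hh> = {restrict f \<hh> | f. linear f}"

text \<open>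
  A map to the finite-dimensional space \<open>\<gg>\<^sup>*\<close> is smooth when its components \<open>\<Psi>\<^sup>\<xi>\<close> are.
  The coadjoint action of a torus is trivial, so equivariance amounts to invariance.
\<close>

definition abstract_moment_map ::
  "('m::topological_space, 'e::euclidean_space) manifold \<Rightarrow> (real ^ 'k::finite) set
     \<Rightarrow> (complex ^ 'k \<Rightarrow> 'm \<Rightarrow> 'm) \<Rightarrow> ('m \<Rightarrow> real ^ 'k \<Rightarrow> real) \<Rightarrow> bool" where
  "abstract_moment_map M \<gg> \<rho> \<Psi> \<longleftrightarrow>
     (\<forall>m. \<Psi> m \<in> dual_space \<gg>) \<and>
     (\<forall>\<xi>\<in>\<gg>. smooth_function M (\<lambda>m. \<Psi> m \<xi>)) \<and>
     (\<forall>g\<in>carrier (torus \<gg>). \<forall>m. \<Psi> (\<rho> g m) = \<Psi> m) \<and>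
     (\<forall>H. lie_subgroup \<gg> H \<longrightarrow>
        locally (\<lambda>U. (\<lambda>m. restrict (\<Psi> m) (lie_algebra \<gg> H)) constant_on U) (fixed_points \<rho> H))"

definition exact_moment_map ::
  "('m::topological_space, 'e::euclidean_space) manifold \<Rightarrow> (real ^ 'k::finite) set
     \<Rightarrow> (complex ^ 'k \<Rightarrow> 'm \<Rightarrow> 'm) \<Rightarrow> ('m \<Rightarrow> real ^ 'k \<Rightarrow> real) \<Rightarrow> bool" where
  "exact_moment_map M \<gg> \<rho> \<Psi> \<longleftrightarrow>
     (\<exists>\<mu>. one_form M \<mu> \<and> invariant_form M \<gg> \<rho> \<mu> \<and>
        (\<forall>\<xi>\<in>\<gg>. \<forall>m. \<Psi> m \<xi> = \<mu> m (generating_field M \<rho> \<xi> m)))"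

definition inf_stabilizer ::
  "('m::topological_space, 'e::euclidean_space) manifold \<Rightarrow> (real ^ 'k::finite) set
     \<Rightarrow> (complex ^ 'k \<Rightarrow> 'm \<Rightarrow> 'm) \<Rightarrow> 'm \<Rightarrow> (real ^ 'k) set" where
  "inf_stabilizer M \<gg> \<rho> m = {\<xi>\<in>\<gg>. generating_field M \<rho> \<xi> m = (\<lambda>f. 0)}"

text \<open>The subalgebras of the abelian Lie algebra \<open>\<gg>\<close> are its linear subspaces.\<close>

definition inf_orbit_type_strata ::
  "('m::topological_space, 'e::euclidean_space) manifold \<Rightarrow> (real ^ 'k::finite) set
     \<Rightarrow> (complex ^ 'k \<Rightarrow> 'm \<Rightarrow> 'm) \<Rightarrow> 'm set set" where
  "inf_orbit_type_strata M \<gg> \<rho> =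
     (\<Union>\<hh>\<in>{\<hh>. subspace \<hh> \<and> \<hh> \<subseteq> \<gg>}. components {m. inf_stabilizer M \<gg> \<rho> m = \<hh>})"

definition stratum_stabilizer ::
  "('m::topological_space, 'e::euclidean_space) manifold \<Rightarrow> (real ^ 'k::finite) set
     \<Rightarrow> (complex ^ 'k \<Rightarrow> 'm \<Rightarrow> 'm) \<Rightarrow> 'm set \<Rightarrow> (real ^ 'k) set" where
  "stratum_stabilizer M \<gg> \<rho> X = (THE \<hh>. \<forall>m\<in>X. inf_stabilizer M \<gg> \<rho> m = \<hh>)"

definition assignment ::
  "('m::topological_space, 'e::euclidean_space) manifold \<Rightarrow> (real ^ 'k::finite) set
     \<Rightarrow> (complex ^ 'k \<Rightarrow> 'm \<Rightarrow> 'm) \<Rightarrow> ('m \<Rightarrow> real ^ 'k \<Rightarrow> real)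
     \<Rightarrow> 'm set \<Rightarrow> real ^ 'k \<Rightarrow> real" where
  "assignment M \<gg> \<rho> \<Psi> X =
     (THE \<alpha>. \<forall>m\<in>X. restrict (\<Psi> m) (stratum_stabilizer M \<gg> \<rho> X) = \<alpha>)"

end

theory Submission
  imports Defs
begin

text \<open>
  Write \<open>V m\<close> for the vector that represents \<open>\<Psi> m\<close>, so that \<open>\<Psi>\<^sup>\<xi> = V \<bullet> \<xi>\<close>. Both forms of the
  hypothesis amount to the pointwise condition that \<open>V m \<bullet> \<xi> = 0\<close> whenever \<open>\<xi>\<^sub>M\<close> vanishes at \<open>m\<close>:
  apply them to the stabilizer of \<open>m\<close>, or to the common stabilizer of the points of the stratum of \<open>m\<close>
  (\<open>vanishes_if_restrictions_vanish\<close>, \<open>vanishes_if_assignment_vanishes\<close>).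

  The forms are built from eigenfunctions of the action. If \<open>z (exp \<xi> \<cdot> m) = exp (2\<pi>i \<alpha> \<bullet> \<xi>) z m\<close>, and if \<open>w\<close> is an
  eigenfunction for the opposite weight \<open>- \<alpha>\<close>, then \<open>Re (w dz / 2\<pi>i)\<close> is invariant and has the value
  \<open>(\<alpha> \<bullet> \<xi>) Re (w z)\<close> on \<open>\<xi>\<^sub>M\<close>. Hence it suffices to write \<open>V\<close>, up to an invariant positive factor, as a
  sum of terms \<open>Re (w z) \<alpha>\<close>, and to do so near each point: the local forms are glued by invariant functions
  with locally finite supports (\<open>invariant_form_exists\<close>).

  Near a point \<open>m\<^sub>0\<close>, coordinates can be chosen among the real and imaginary parts of eigenfunctions. Indeed
  the Fourier components of a smooth function along the orbits are eigenfunctions, and a tangent vector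
  that annihilates all of them annihilates the function (\<open>span_grad_equivariant\<close>). The coordinates can be
  arranged so that they contain eigenfunctions \<open>z\<^sub>j\<close>, \<open>j \<in> J\<close>, with both of their parts, while the Lie algebra
  of the stabilizer of \<open>m\<^sub>0\<close> acts trivially on all others (\<open>coordinates_at\<close>). Together with finitely many
  eigenfunctions \<open>z\<^sub>j\<close>, \<open>j \<in> A\<close>, that have no zeros near \<open>m\<^sub>0\<close>, they detect the stabilizers: an element \<open>\<xi>\<close>
  orthogonal to the weights \<open>\<alpha>\<^sub>j\<close> of all \<open>z\<^sub>j\<close> with \<open>z\<^sub>j m \<noteq> 0\<close> satisfies \<open>\<xi>\<^sub>M = 0\<close> at \<open>m\<close>. The condition on
  \<open>V\<close> therefore says that \<open>V m\<close> lies in the span of these \<open>\<alpha>\<^sub>j\<close>.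

  Setting some of the coordinates \<open>z\<^sub>j\<close> to zero splits \<open>V\<close>, by inclusion and exclusion, into a sum
  \<open>\<Sum> c\<^sub>j \<alpha>\<^sub>j\<close> with smooth \<open>c\<^sub>j\<close> such that \<open>c\<^sub>j\<close> vanishes where \<open>z\<^sub>j\<close> does (\<open>coordinate_decomposition\<close>).
  Then \<open>c\<^sub>j = Re (w\<^sub>j z\<^sub>j)\<close> by Hadamard's lemma (\<open>local_decomposition\<close>). Finally, since \<open>V\<close> is invariant,
  averaging this equation over the torus replaces \<open>w\<^sub>j\<close> by its Fourier component of weight \<open>- \<alpha>\<^sub>j\<close>
  (\<open>invariant_local_decomposition\<close>).
\<close>

section \<open>Calculus of smooth maps\<close>

abbreviation Ck ::
  "nat \<Rightarrow> 'a::real_normed_vector set \<Rightarrow> ('a \<Rightarrow> 'b::real_normed_vector) \<Rightarrow> bool"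
  where "Ck k \<equiv> Ck_on k UNIV"

abbreviation smooth ::
  "'a::real_normed_vector set \<Rightarrow> ('a \<Rightarrow> 'b::real_normed_vector) \<Rightarrow> bool"
  where "smooth \<equiv> smooth_on UNIV"

lemma Ck_cong:
  assumes "\<And>x. x \<in> W \<Longrightarrow> f x = g x"
  shows "Ck_on k E W f \<longleftrightarrow> Ck_on k E W g"
  using assms
proof (induction k arbitrary: f g)
  case 0
  then show ?case by (simp cong: continuous_on_cong)
next
  case (Suc k)
  have D: "(f has_derivative D) (at x within W) \<longleftrightarrow> (g has_derivative D) (at x within W)"
    if "x \<in> W" for x D
    using has_derivative_transform[of x W] Suc.prems that by metis
  have F: "frechet_derivative f (at x within W) = frechet_derivative g (at x within W)"
    if "x \<in> W" for x
    using D[OF that] by (simp add: frechet_derivative_def)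
  have "f differentiable (at x within W) \<longleftrightarrow> g differentiable (at x within W)" if "x \<in> W" for x
    using D[OF that] by (simp add: differentiable_def)
  moreover have "Ck_on k E W (\<lambda>x. frechet_derivative f (at x within W) v) \<longleftrightarrow>
      Ck_on k E W (\<lambda>x. frechet_derivative g (at x within W) v)" for v
    by (rule Suc.IH) (simp add: F)
  ultimately show ?case by simp
qed

lemma Ck_SucI:
  assumes W: "open W" and D: "\<And>x. x \<in> W \<Longrightarrow> (f has_derivative D x) (at x)"
    and C: "\<And>v. Ck k W (\<lambda>x. D x v)"
  shows "Ck (Suc k) W f"
proof -
  have "f differentiable (at x within W)" if "x \<in> W" for x
    using D[OF that] by (auto simp: differentiable_def at_within_open[OF that W])
  moreover have "Ck k W (\<lambda>x. frechet_derivative f (at x within W) v)" for v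
  proof -
    have "frechet_derivative f (at x within W) v = D x v" if "x \<in> W" for x
      using frechet_derivative_at[OF D[OF that]] at_within_open[OF that W] by simp
    then show ?thesis by (intro Ck_cong[THEN iffD2, OF _ C[of v]])
  qed
  ultimately show ?thesis by simp
qed

lemma Ck_SucE:
  assumes C: "Ck (Suc k) W f" and W: "open W"
  obtains D where "\<And>x. x \<in> W \<Longrightarrow> (f has_derivative D x) (at x)" "\<And>v. Ck k W (\<lambda>x. D x v)"
proof
  show "(f has_derivative frechet_derivative f (at x within W)) (at x)" if "x \<in> W" for x
  proof -
    have "f differentiable (at x within W)" using C that by simp
    then show ?thesis
      using frechet_derivative_works at_within_open[OF that W] by metis
  qed
  show "Ck k W (\<lambda>x. frechet_derivative f (at x within W) v)" for v
    using C by simp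
qed

lemma Ck_continuous_on:
  assumes "Ck k W f" "open W"
  shows "continuous_on W f"
proof (cases k)
  case (Suc j)
  then obtain D where "\<And>x. x \<in> W \<Longrightarrow> (f has_derivative D x) (at x)"
    using Ck_SucE[of j W f] assms by metis
  then show ?thesis
    by (meson continuous_at_imp_continuous_on has_derivative_continuous)
qed (use assms in auto)

lemma Ck_pred:
  assumes "Ck (Suc k) W f" "open W"
  shows "Ck k W f"
  using assms
proof (induction k arbitrary: f)
  case 0
  then show ?case using Ck_continuous_on[OF 0] by simp
next
  case (Suc k)
  obtain D where D: "\<And>x. x \<in> W \<Longrightarrow> (f has_derivative D x) (at x)" "\<And>v. Ck (Suc k) W (\<lambda>x. D x v)"
    by (rule Ck_SucE[OF Suc.prems]; blast)
  show ?case
    by (rule Ck_SucI[OF Suc.prems(2) D(1)]) (assumption, rule Suc.IH[OF D(2) Suc.prems(2)])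
qed

lemma Ck_subset:
  assumes "Ck k W f" "open W" "open V" "V \<subseteq> W"
  shows "Ck k V f"
  using assms
proof (induction k arbitrary: f)
  case 0
  then show ?case using continuous_on_subset by auto
next
  case (Suc k)
  obtain D where D: "\<And>x. x \<in> W \<Longrightarrow> (f has_derivative D x) (at x)" "\<And>v. Ck k W (\<lambda>x. D x v)"
    by (rule Ck_SucE[OF Suc.prems(1,2)]; blast)
  show ?case
    by (rule Ck_SucI[OF Suc.prems(3) D(1)]) (use Suc D(2) in auto)
qed

lemma Ck_local:
  assumes W: "open W" and L: "\<And>x. x \<in> W \<Longrightarrow> \<exists>V. open V \<and> x \<in> V \<and> V \<subseteq> W \<and> Ck k V f"
  shows "Ck k W f"
  using L
proof (induction k arbitrary: f)
  case 0
  have "isCont f x" if x: "x \<in> W" for x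
  proof -
    from 0[OF x] obtain V where "open V" "x \<in> V" "continuous_on V f" by auto
    then show ?thesis by (simp add: continuous_on_eq_continuous_at)
  qed
  then show ?case by (simp add: continuous_at_imp_continuous_on)
next
  case (Suc k)
  have D: "(f has_derivative frechet_derivative f (at x)) (at x)" if x: "x \<in> W" for x
  proof -
    from Suc.prems[OF x] obtain V where "open V" "x \<in> V" "Ck (Suc k) V f" by auto
    then have "f differentiable at x"
      using at_within_open by (metis Ck_on.simps(2))
    then show ?thesis by (simp add: frechet_derivative_works)
  qed
  have "Ck k W (\<lambda>x. frechet_derivative f (at x) v)" for v
  proof (rule Suc.IH)
    fix x assume x: "x \<in> W"
    from Suc.prems[OF x] obtain V where V: "open V" "x \<in> V" "V \<subseteq> W" "Ck (Suc k) V f" by auto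
    obtain E where E: "\<And>x. x \<in> V \<Longrightarrow> (f has_derivative E x) (at x)" "\<And>v. Ck k V (\<lambda>x. E x v)"
      by (rule Ck_SucE[OF V(4,1)]; blast)
    have "frechet_derivative f (at y) v = E y v" if "y \<in> V" for y
      using frechet_derivative_at[OF E(1)[OF that]] by simp
    then have "Ck k V (\<lambda>x. frechet_derivative f (at x) v)"
      by (intro Ck_cong[THEN iffD2, OF _ E(2)[of v]])
    with V show "\<exists>V. open V \<and> x \<in> V \<and> V \<subseteq> W \<and> Ck k V (\<lambda>x. frechet_derivative f (at x) v)"
      by auto
  qed
  then show ?case by (intro Ck_SucI[OF W D])
qed

lemma Ck_const: "open W \<Longrightarrow> Ck k W (\<lambda>x. c)"
proof (induction k arbitrary: c)
  case (Suc k)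
  show ?case
    by (rule Ck_SucI[OF Suc.prems, of _ "\<lambda>x v. 0"]) (use Suc in auto)
qed simp

lemma Ck_linear:
  assumes L: "bounded_linear L" and f: "Ck k W f" and W: "open W"
  shows "Ck k W (\<lambda>x. L (f x))"
  using f
proof (induction k arbitrary: f)
  case 0
  then show ?case using L by (auto intro: bounded_linear.continuous_on)
next
  case (Suc k)
  obtain D where D: "\<And>x. x \<in> W \<Longrightarrow> (f has_derivative D x) (at x)" "\<And>v. Ck k W (\<lambda>x. D x v)"
    by (rule Ck_SucE[OF Suc.prems W]; blast)
  show ?case
    by (rule Ck_SucI[OF W bounded_linear.has_derivative[OF L D(1)]])
      (assumption, rule Suc.IH[OF D(2)])
qed

lemma Ck_id: "open W \<Longrightarrow> Ck k W (\<lambda>x. x)"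
proof (cases k)
  case (Suc j)
  assume W: "open W"
  show ?thesis unfolding Suc
    by (rule Ck_SucI[OF W, of _ "\<lambda>x v. v"]) (use W Ck_const in auto)
qed simp

lemma Ck_add:
  assumes "Ck k W f" "Ck k W g" and W: "open W"
  shows "Ck k W (\<lambda>x. f x + g x)"
  using assms(1,2)
proof (induction k arbitrary: f g)
  case 0
  then show ?case by (auto intro: continuous_intros)
next
  case (Suc k)
  obtain D where D: "\<And>x. x \<in> W \<Longrightarrow> (f has_derivative D x) (at x)" "\<And>v. Ck k W (\<lambda>x. D x v)"
    by (rule Ck_SucE[OF Suc.prems(1) W]; blast)
  obtain E where E: "\<And>x. x \<in> W \<Longrightarrow> (g has_derivative E x) (at x)" "\<And>v. Ck k W (\<lambda>x. E x v)"
    by (rule Ck_SucE[OF Suc.prems(2) W]; blast)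
  show ?case
    by (rule Ck_SucI[OF W has_derivative_add[OF D(1) E(1)]])
      (assumption, assumption, rule Suc.IH[OF D(2) E(2)])
qed

lemma Ck_bilinear:
  assumes B: "bounded_bilinear B" and "Ck k W f" "Ck k W g" and W: "open W"
  shows "Ck k W (\<lambda>x. B (f x) (g x))"
  using assms(2,3)
proof (induction k arbitrary: f g)
  case 0
  then show ?case using bounded_bilinear.continuous_on[OF B] by auto
next
  case (Suc k)
  obtain D where D: "\<And>x. x \<in> W \<Longrightarrow> (f has_derivative D x) (at x)" "\<And>v. Ck k W (\<lambda>x. D x v)"
    by (rule Ck_SucE[OF Suc.prems(1) W]; blast)
  obtain E where E: "\<And>x. x \<in> W \<Longrightarrow> (g has_derivative E x) (at x)" "\<And>v. Ck k W (\<lambda>x. E x v)"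
    by (rule Ck_SucE[OF Suc.prems(2) W]; blast)
  show ?case
  proof (rule Ck_SucI[OF W bounded_bilinear.FDERIV[OF B D(1) E(1)]])
    show "Ck k W (\<lambda>x. B (f x) (E x v) + B (D x v) (g x))" for v
      by (intro Ck_add Suc.IH Ck_pred[OF Suc.prems(1)] Ck_pred[OF Suc.prems(2)] D(2) E(2) W)
  qed
qed

lemma Ck_sum:
  assumes "\<And>i. i \<in> I \<Longrightarrow> Ck k W (f i)" and W: "open W"
  shows "Ck k W (\<lambda>x. \<Sum>i\<in>I. f i x)"
  using assms(1)
  by (induction I rule: infinite_finite_induct) (auto intro!: Ck_add Ck_const W)

lemma linear_eq_sum_Basis:
  fixes L :: "'a::euclidean_space \<Rightarrow> 'b::real_vector"
  assumes "linear L"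
  shows "L v = (\<Sum>b\<in>Basis. (v \<bullet> b) *\<^sub>R L b)"
proof -
  have "L (\<Sum>b\<in>Basis. (v \<bullet> b) *\<^sub>R b) = (\<Sum>b\<in>Basis. (v \<bullet> b) *\<^sub>R L b)"
    using assms by (simp add: linear_sum linear_scale)
  then show ?thesis by (simp add: euclidean_representation)
qed

text \<open>
  By the chain rule the derivative of the composition is a combination of products whose factors
  have one order of differentiability less. The derivative of \<open>f\<close> is expanded in the basis so that
  these factors are again compositions with \<open>f\<close> and the induction hypothesis applies.
\<close>

lemma Ck_compose:
  fixes f :: "'a::real_normed_vector \<Rightarrow> 'b::euclidean_space"
  assumes "Ck k V g" "Ck k W f" and W: "open W" and V: "open V" and sub: "f ` W \<subseteq> V"
  shows "Ck k W (\<lambda>x. g (f x))"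
  using assms(1,2)
proof (induction k arbitrary: g)
  case 0
  then show ?case using sub by (auto intro: continuous_on_compose2)
next
  case (Suc k)
  obtain D where D: "\<And>x. x \<in> V \<Longrightarrow> (g has_derivative D x) (at x)" "\<And>v. Ck k V (\<lambda>x. D x v)"
    by (rule Ck_SucE[OF Suc.prems(1) V]; blast)
  obtain E where E: "\<And>x. x \<in> W \<Longrightarrow> (f has_derivative E x) (at x)" "\<And>v. Ck k W (\<lambda>x. E x v)"
    by (rule Ck_SucE[OF Suc.prems(2) W]; blast)
  have 1: "((\<lambda>x. g (f x)) has_derivative (\<lambda>v. \<Sum>b\<in>Basis. (E x v \<bullet> b) *\<^sub>R D (f x) b)) (at x)"
    if "x \<in> W" for x
  proof -
    have Df: "(g has_derivative D (f x)) (at (f x))" using D(1) sub that by auto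
    have "linear (D (f x))" using Df has_derivative_linear by blast
    then have "(\<lambda>v. \<Sum>b\<in>Basis. (E x v \<bullet> b) *\<^sub>R D (f x) b) = (\<lambda>v. D (f x) (E x v))"
      by (intro ext linear_eq_sum_Basis[symmetric])
    with has_derivative_compose[OF E(1)[OF that] Df] show ?thesis by (simp add: o_def)
  qed
  show ?case
  proof (rule Ck_SucI[OF W 1])
    fix v
    have "Ck k W (\<lambda>x. D (f x) b)" for b
      by (rule Suc.IH) (use D(2) Suc.prems(2) W in \<open>auto intro: Ck_pred\<close>)
    moreover have "Ck k W (\<lambda>x. E x v \<bullet> b)" for b
      by (rule Ck_linear[OF bounded_linear_inner_left E(2) W])
    ultimately show "Ck k W (\<lambda>x. \<Sum>b\<in>Basis. (E x v \<bullet> b) *\<^sub>R D (f x) b)"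
      by (auto intro!: Ck_sum Ck_bilinear[OF bounded_bilinear_scaleR] W)
  qed
qed

lemma Ck_inverse_real: "Ck k (- {0::real}) inverse"
proof (induction k)
  case 0
  show ?case by (auto intro: continuous_intros)
next
  case (Suc k)
  have W: "open (- {0::real})" by auto
  show ?case
  proof (rule Ck_SucI[OF W])
    show "(inverse has_derivative (\<lambda>h. - (inverse x * h * inverse x))) (at x)"
      if "x \<in> - {0}" for x :: real
      using that by (auto intro!: derivative_eq_intros)
    have "Ck k (-{0}) (\<lambda>x::real. (-v) * (inverse x * inverse x))" for v
      by (intro Ck_bilinear[OF bounded_bilinear_mult] Suc W Ck_const)
    then show "Ck k (-{0}) (\<lambda>x::real. - (inverse x * v * inverse x))" for v
      by (simp add: algebra_simps)
  qed
qed

subsection \<open>Smooth versions\<close>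

named_theorems smooth_rules

lemma smoothD: "smooth_on E W f \<Longrightarrow> Ck_on k E W f"
  by (simp add: smooth_on_def)

lemma smooth_cong: "(\<And>x. x \<in> W \<Longrightarrow> f x = g x) \<Longrightarrow> smooth_on E W f \<longleftrightarrow> smooth_on E W g"
  by (simp add: smooth_on_def Ck_cong[of W f g])

lemma smooth_continuous_on: "smooth W f \<Longrightarrow> open W \<Longrightarrow> continuous_on W f"
  using Ck_continuous_on[OF smoothD] .

lemma smooth_has_derivative:
  assumes "smooth W f" "open W" "x \<in> W"
  shows "(f has_derivative frechet_derivative f (at x)) (at x)"
proof -
  have "f differentiable (at x within W)" using smoothD[OF assms(1), of 1] assms(3) by simp
  then show ?thesis
    by (simp add: at_within_open[OF assms(3,2)] frechet_derivative_works)
qed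

lemma smooth_frechet_derivative:
  assumes "smooth W f" "open W"
  shows "smooth W (\<lambda>x. frechet_derivative f (at x) v)"
proof -
  have "smooth W (\<lambda>x. frechet_derivative f (at x within W) v)"
    unfolding smooth_on_def
    using smoothD[OF assms(1), of "Suc k" for k, unfolded Ck_on.simps, THEN conjunct2] UNIV_I
    by (blast intro: bspec)
  moreover have "frechet_derivative f (at x within W) v = frechet_derivative f (at x) v" if "x \<in> W" for x
    using at_within_open[OF that assms(2)] by simp
  ultimately show ?thesis by (simp cong: smooth_cong)
qed

lemma smooth_derivE:
  assumes "smooth W f" "open W"
  obtains D where "\<And>x. x \<in> W \<Longrightarrow> (f has_derivative D x) (at x)" "\<And>v. smooth W (\<lambda>x. D x v)"
  by (rule that[OF smooth_has_derivative smooth_frechet_derivative]) (use assms in blast)+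

lemma smooth_subset: "smooth W f \<Longrightarrow> open W \<Longrightarrow> open V \<Longrightarrow> V \<subseteq> W \<Longrightarrow> smooth V f"
  by (auto simp: smooth_on_def intro: Ck_subset)

lemma smooth_local:
  assumes W: "open W" and L: "\<And>x. x \<in> W \<Longrightarrow> \<exists>V. open V \<and> x \<in> V \<and> V \<subseteq> W \<and> smooth V f"
  shows "smooth W f"
  unfolding smooth_on_def
proof
  fix k
  show "Ck k W f"
  proof (rule Ck_local[OF W])
    fix x assume "x \<in> W"
    with L obtain V where "open V" "x \<in> V" "V \<subseteq> W" "smooth V f" by metis
    then show "\<exists>V. open V \<and> x \<in> V \<and> V \<subseteq> W \<and> Ck k V f"
      by (intro exI[of _ V]) (simp add: smooth_on_def)
  qed
qed

lemma smooth_const [smooth_rules]: "open W \<Longrightarrow> smooth W (\<lambda>x. c)"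
  by (simp add: smooth_on_def Ck_const)

lemma smooth_id [smooth_rules]: "open W \<Longrightarrow> smooth W (\<lambda>x. x)"
  by (simp add: smooth_on_def Ck_id)

lemma smooth_linear:
  "bounded_linear L \<Longrightarrow> smooth W f \<Longrightarrow> open W \<Longrightarrow> smooth W (\<lambda>x. L (f x))"
  by (simp add: smooth_on_def Ck_linear)

lemma smooth_add [smooth_rules]:
  "smooth W f \<Longrightarrow> smooth W g \<Longrightarrow> open W \<Longrightarrow> smooth W (\<lambda>x. f x + g x)"
  by (simp add: smooth_on_def Ck_add)

lemma smooth_minus [smooth_rules]: "smooth W f \<Longrightarrow> open W \<Longrightarrow> smooth W (\<lambda>x. - f x)"
  by (rule smooth_linear[OF bounded_linear_minus[OF bounded_linear_ident]])

lemma smooth_diff [smooth_rules]: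
  "smooth W f \<Longrightarrow> smooth W g \<Longrightarrow> open W \<Longrightarrow> smooth W (\<lambda>x. f x - g x)"
  using smooth_add[of W f "\<lambda>x. - g x"] smooth_minus[of W g] by simp

lemma smooth_bilinear:
  "bounded_bilinear B \<Longrightarrow> smooth W f \<Longrightarrow> smooth W g \<Longrightarrow> open W \<Longrightarrow> smooth W (\<lambda>x. B (f x) (g x))"
  by (simp add: smooth_on_def Ck_bilinear)

lemmas smooth_mult [smooth_rules] =
  smooth_bilinear[OF bounded_bilinear_mult[where ?'a = real]]
lemmas smooth_scaleR [smooth_rules] = smooth_bilinear[OF bounded_bilinear_scaleR]
lemmas smooth_inner [smooth_rules] = smooth_bilinear[OF bounded_bilinear_inner]

lemma smooth_compose:
  fixes f :: "'a::real_normed_vector \<Rightarrow> 'b::euclidean_space"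
  shows "smooth V g \<Longrightarrow> smooth W f \<Longrightarrow> open W \<Longrightarrow> open V \<Longrightarrow> f ` W \<subseteq> V \<Longrightarrow> smooth W (\<lambda>x. g (f x))"
  unfolding smooth_on_def by (blast intro: Ck_compose)

lemma smooth_Pair [smooth_rules]:
  fixes f :: "'a::real_normed_vector \<Rightarrow> 'b::real_normed_vector"
    and g :: "'a \<Rightarrow> 'c::real_normed_vector"
  assumes "smooth W f" "smooth W g" "open W"
  shows "smooth W (\<lambda>x. (f x, g x))"
proof -
  have "bounded_linear (\<lambda>y::'b. (y, 0::'c))" "bounded_linear (\<lambda>y::'c. (0::'b, y))"
    by (auto intro!: bounded_linear_intros)
  from smooth_add[OF smooth_linear[OF this(1) assms(1,3)] smooth_linear[OF this(2) assms(2,3)] assms(3)]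
  show ?thesis by simp
qed

lemma smooth_inverse_real:
  fixes f :: "'a::real_normed_vector \<Rightarrow> real"
  assumes "smooth W f" "open W" "\<And>x. x \<in> W \<Longrightarrow> f x \<noteq> 0"
  shows "smooth W (\<lambda>x. inverse (f x))"
  by (rule smooth_compose[of "-{0}" inverse])
    (use assms Ck_inverse_real in \<open>auto simp: smooth_on_def\<close>)

lemma smooth_fst [smooth_rules]: "open W \<Longrightarrow> smooth W fst"
  using smooth_linear[OF bounded_linear_fst smooth_id] by auto

lemma smooth_snd [smooth_rules]: "open W \<Longrightarrow> smooth W snd"
  using smooth_linear[OF bounded_linear_snd smooth_id] by auto

subsection \<open>Integrals depending on a parameter\<close>

text \<open>
  The Leibniz rule requires a convex set of parameters. Differentiability at a point concerns only a
  ball, so the open set \<open>W\<close> itself is arbitrary.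
\<close>

lemma has_derivative_integral_param:
  fixes F :: "'a::euclidean_space \<times> 'e::euclidean_space \<Rightarrow> 'b::euclidean_space"
  assumes W: "open W" and sub: "cbox a b \<times> W \<subseteq> \<Omega>"
    and D: "\<And>p. p \<in> \<Omega> \<Longrightarrow> (F has_derivative D p) (at p)"
    and D2: "\<And>v. continuous_on \<Omega> (\<lambda>p. D p v)" and x0: "x0 \<in> W"
  shows "((\<lambda>x. integral (cbox a b) (\<lambda>t. F (t, x))) has_derivative
      (\<lambda>v. integral (cbox a b) (\<lambda>t. D (t, x0) (0, v)))) (at x0)"
proof -
  have F: "continuous_on \<Omega> F"
    by (meson D continuous_at_imp_continuous_on has_derivative_continuous)
  have cont: "continuous_on (cbox a b) (\<lambda>t. G (t, x))"
    if "continuous_on \<Omega> G" "x \<in> W" for G :: "'a \<times> 'e \<Rightarrow> 'b" and x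
  proof (rule continuous_on_compose2[OF that(1)])
    show "continuous_on (cbox a b) (\<lambda>t. (t, x))" by (intro continuous_intros)
    show "(\<lambda>t. (t, x)) ` cbox a b \<subseteq> \<Omega>" using sub that(2) by blast
  qed
  define fx where "fx x t = Blinfun (\<lambda>v. D (t, x) (0, v))" for x t
  have bl: "bounded_linear (\<lambda>v. D p (0, v))" if "p \<in> \<Omega>" for p
    by (rule bounded_linear_compose[OF has_derivative_bounded_linear[OF D[OF that]]])
      (intro bounded_linear_intros)
  have fx: "blinfun_apply (fx x t) = (\<lambda>v. D (t, x) (0, v))" if "(t, x) \<in> \<Omega>" for x t
    using bounded_linear_Blinfun_apply[OF bl[OF that]] by (simp add: fx_def)
  have cfx: "continuous_on (W \<times> cbox a b) (\<lambda>(x, t). fx x t)"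
  proof (rule continuous_on_blinfun_componentwise)
    fix i :: 'e
    have "continuous_on (W \<times> cbox a b) (\<lambda>p. D (snd p, fst p) (0, i))"
    proof (rule continuous_on_compose2[OF D2])
      show "continuous_on (W \<times> cbox a b) (\<lambda>p. (snd p, fst p))" by (intro continuous_intros)
      show "(\<lambda>p. (snd p, fst p)) ` (W \<times> cbox a b) \<subseteq> \<Omega>" using sub by force
    qed
    moreover have "blinfun_apply (case p of (x, t) \<Rightarrow> fx x t) i = D (snd p, fst p) (0, i)"
      if "p \<in> W \<times> cbox a b" for p
      using that sub fx by auto
    ultimately show "continuous_on (W \<times> cbox a b) (\<lambda>p. blinfun_apply (case p of (x, t) \<Rightarrow> fx x t) i)"
      by (simp cong: continuous_on_cong)
  qed
  obtain r where r: "r > 0" "ball x0 r \<subseteq> W"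
    using W x0 open_contains_ball by blast
  have "((\<lambda>x. integral (cbox a b) (\<lambda>t. F (t, x))) has_derivative
      blinfun_apply (integral (cbox a b) (fx x0))) (at x0 within ball x0 r)"
  proof (rule leibniz_rule)
    fix x t assume x: "x \<in> ball x0 r" and t: "t \<in> cbox a b"
    then have p: "(t, x) \<in> \<Omega>" using r sub by auto
    have "((\<lambda>x. (t, x)) has_derivative (\<lambda>v. (0, v))) (at x within ball x0 r)"
      by (auto intro!: derivative_eq_intros)
    from has_derivative_compose[OF this D[OF p]]
    show "((\<lambda>x. F (t, x)) has_derivative blinfun_apply (fx x t)) (at x within ball x0 r)"
      by (simp add: fx[OF p])
  next
    show "(\<lambda>t. F (t, x)) integrable_on cbox a b" if "x \<in> ball x0 r" for x
      using r that by (intro integrable_continuous cont[OF F]) auto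
    show "continuous_on (ball x0 r \<times> cbox a b) (\<lambda>(x, t). fx x t)"
      by (rule continuous_on_subset[OF cfx]) (use r in auto)
  qed (use r in auto)
  moreover have "blinfun_apply (integral (cbox a b) (fx x0)) =
      (\<lambda>v. integral (cbox a b) (\<lambda>t. D (t, x0) (0, v)))"
  proof
    fix v
    have "fx x0 integrable_on cbox a b"
    proof (rule integrable_continuous)
      have "continuous_on (cbox a b) (\<lambda>t. (\<lambda>(x, t). fx x t) (x0, t))"
        by (rule continuous_on_compose2[OF cfx]) (use x0 in \<open>auto intro!: continuous_intros\<close>)
      then show "continuous_on (cbox a b) (fx x0)" by simp
    qed
    from blinfun_apply_integral[OF this]
    have "blinfun_apply (integral (cbox a b) (fx x0)) v =
      integral (cbox a b) (\<lambda>t. blinfun_apply (fx x0 t) v)" .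
    also have "\<dots> = integral (cbox a b) (\<lambda>t. D (t, x0) (0, v))"
      by (rule integral_cong) (use x0 sub fx in auto)
    finally show "blinfun_apply (integral (cbox a b) (fx x0)) v =
      integral (cbox a b) (\<lambda>t. D (t, x0) (0, v))" .
  qed
  ultimately have "((\<lambda>x. integral (cbox a b) (\<lambda>t. F (t, x))) has_derivative
    (\<lambda>v. integral (cbox a b) (\<lambda>t. D (t, x0) (0, v)))) (at x0 within ball x0 r)"
    by (simp only:)
  then show ?thesis using at_within_open[of x0 "ball x0 r"] r by simp
qed

lemma Ck_integral_param:
  fixes F :: "'a::euclidean_space \<times> 'e::euclidean_space \<Rightarrow> 'b::euclidean_space"
  assumes W: "open W" and O: "open \<Omega>" and sub: "cbox a b \<times> W \<subseteq> \<Omega>" and F: "Ck k \<Omega> F"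
  shows "Ck k W (\<lambda>x. integral (cbox a b) (\<lambda>t. F (t, x)))"
  using F
proof (induction k arbitrary: F)
  case 0
  have "continuous_on (W \<times> cbox a b) (\<lambda>(x, t). F (t, x))"
    using 0 sub
    by (auto simp: split_beta intro!: continuous_on_compose2[of \<Omega> F] continuous_intros)
  from integral_continuous_on_param[OF this] show ?case by simp
next
  case (Suc k)
  define D where "D p = frechet_derivative F (at p within \<Omega>)" for p
  have D: "(F has_derivative D p) (at p)" if "p \<in> \<Omega>" for p
  proof -
    have "F differentiable (at p within \<Omega>)" using Suc.prems that by simp
    then show ?thesis
      using frechet_derivative_works at_within_open[OF that O] unfolding D_def by metis
  qed
  have D2: "Ck k \<Omega> (\<lambda>p. D p v)" for v
    unfolding D_def using Suc.prems[unfolded Ck_on.simps, THEN conjunct2] UNIV_I by (rule bspec)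
  have "((\<lambda>x. integral (cbox a b) (\<lambda>t. F (t, x))) has_derivative
      (\<lambda>v. integral (cbox a b) (\<lambda>t. D (t, x0) (0, v)))) (at x0)" if "x0 \<in> W" for x0
    by (rule has_derivative_integral_param[OF W sub D Ck_continuous_on[OF D2 O] that])
  then show ?case
    by (rule Ck_SucI[OF W]) (assumption, rule Suc.IH[OF D2])
qed

lemma smooth_integral_param:
  fixes F :: "'a::euclidean_space \<times> 'e::euclidean_space \<Rightarrow> 'b::euclidean_space"
  assumes "open W" "open \<Omega>" "cbox a b \<times> W \<subseteq> \<Omega>" "smooth \<Omega> F"
  shows "smooth W (\<lambda>x. integral (cbox a b) (\<lambda>t. F (t, x)))"
  using assms Ck_integral_param unfolding smooth_on_def by blast

subsection \<open>A flat function\<close>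

text \<open>
  Dividing \<open>exp (- 1 / t)\<close> by powers of \<open>t\<close> gives a family whose linear span is closed under
  differentiation, so that the smoothness of all members follows by one induction.
\<close>

definition flat :: "nat \<Rightarrow> real \<Rightarrow> real" where
  "flat n t = (if t \<le> 0 then 0 else exp (- 1 / t) / t ^ n)"

lemma flat_has_derivative:
  "(flat n has_real_derivative (flat (n + 2) t - n * flat (n + 1) t)) (at t)"
proof -
  consider "t < 0" | "t = 0" | "t > 0" by linarith
  then show ?thesis
  proof cases
    case 1
    have "((\<lambda>t. 0) has_real_derivative 0) (at t)" by simp
    then have "(flat n has_real_derivative 0) (at t)"
      by (rule has_field_derivative_transform_within_open[where S = "{..<0}"])
        (use 1 in \<open>auto simp: flat_def\<close>)
    then show ?thesis using 1 by (simp add: flat_def)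
  next
    case 3
    have "((\<lambda>t. exp (- 1 / t) / t ^ n) has_real_derivative
        (flat (n + 2) t - n * flat (n + 1) t)) (at t)"
    proof (cases "n = 0")
      case True
      then show ?thesis using 3
        by (auto intro!: derivative_eq_intros simp: flat_def field_simps power2_eq_square)
    next
      case False
      then have e: "t ^ n = t * t ^ (n - Suc 0)" by (cases n) auto
      show ?thesis using 3
        by (auto intro!: derivative_eq_intros simp: flat_def power_add e field_simps power2_eq_square)
    qed
    then show ?thesis
      by (rule has_field_derivative_transform_within_open[where S = "{0<..}"])
        (use 3 in \<open>auto simp: flat_def\<close>)
  next
    case 2
    \<comment> \<open>At \<open>0\<close> the difference quotient tends to \<open>0\<close> because the exponential dominates every power.\<close>
    have "((\<lambda>h. (inverse h) ^ Suc n / exp (inverse h)) \<longlongrightarrow> (0::real)) (at_right 0)"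
      by (rule filterlim_compose[OF tendsto_power_div_exp_0 filterlim_inverse_at_top_right])
    moreover have "\<forall>\<^sub>F h in at_right 0. inverse h ^ Suc n / exp (inverse h) = flat n h / h"
      unfolding eventually_at_right_field
      by (intro exI[of _ 1]) (auto simp: flat_def field_simps exp_minus)
    ultimately have R: "((\<lambda>h. flat n h / h) \<longlongrightarrow> 0) (at_right 0)"
      by (rule Lim_transform_eventually)
    have "\<forall>\<^sub>F h in at_left (0::real). 0 = flat n h / h"
      unfolding eventually_at_left_field
      by (intro exI[of _ "-1"]) (auto simp: flat_def)
    from Lim_transform_eventually[OF tendsto_const this]
    have "((\<lambda>h. flat n h / h) \<longlongrightarrow> 0) (at 0)"
      using R filterlim_split_at by blast
    then show ?thesis
      by (simp add: DERIV_def 2 flat_def)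
  qed
qed

lemma smooth_flat: "smooth UNIV (flat n)"
proof -
  have "Ck k UNIV (flat n)" for k
  proof (induction k arbitrary: n)
    case 0
    have "continuous_on UNIV (flat n)"
      using flat_has_derivative DERIV_isCont continuous_at_imp_continuous_on by blast
    then show ?case by simp
  next
    case (Suc k)
    show ?case
    proof (rule Ck_SucI)
      show "(flat n has_derivative (*) (flat (n + 2) x - n * flat (n + 1) x)) (at x)" for x
        using flat_has_derivative[of n x] by (simp add: has_field_derivative_def)
      have "Ck k UNIV (\<lambda>x. (flat (n + 2) x + (- real n) * flat (n + 1) x) * v)" for v
        by (intro Ck_bilinear[OF bounded_bilinear_mult] Ck_add Ck_const Suc) auto
      then show "Ck k UNIV (\<lambda>x. (flat (n + 2) x - n * flat (n + 1) x) * v)" for v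
        by simp
    qed simp
  qed
  then show ?thesis by (simp add: smooth_on_def)
qed

subsection \<open>Division by linear functions\<close>

text \<open>
  The derivative of \<open>c\<close> along the segment from \<open>P x\<close>, where \<open>c\<close> vanishes, to \<open>x\<close> is linear in \<open>x - P x\<close>.
  Integrating it gives \<open>c x\<close>, and the coefficients are integrals that depend smoothly on \<open>x\<close>.
\<close>

lemma hadamard:
  fixes c :: "'e::euclidean_space \<Rightarrow> real"
  assumes W: "open W" "convex W" and c: "smooth W c" and P: "bounded_linear P"
    and PW: "\<And>x. x \<in> W \<Longrightarrow> P x \<in> W" and cP: "\<And>x. x \<in> W \<Longrightarrow> c (P x) = 0"
  obtains g where "\<And>b. smooth W (g b)"
    "\<And>x. x \<in> W \<Longrightarrow> c x = (\<Sum>b\<in>Basis. ((x - P x) \<bullet> b) * g b x)"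
proof -
  obtain D where D: "\<And>x. x \<in> W \<Longrightarrow> (c has_derivative D x) (at x)" "\<And>v. smooth W (\<lambda>x. D x v)"
    by (rule smooth_derivE[OF c W(1)]; blast)
  define \<gamma> :: "real \<times> 'e \<Rightarrow> 'e" where "\<gamma> p = P (snd p) + fst p *\<^sub>R (snd p - P (snd p))" for p
  have \<gamma>: "smooth UNIV \<gamma>"
    unfolding \<gamma>_def by (intro smooth_rules smooth_linear[OF P] open_UNIV)
  define \<Omega> where "\<Omega> = \<gamma> -` W"
  have O: "open \<Omega>"
    unfolding \<Omega>_def by (rule open_vimage[OF W(1) smooth_continuous_on[OF \<gamma> open_UNIV]])
  have \<gamma>W: "\<gamma> (t, x) \<in> W" if "x \<in> W" "t \<in> {0..1}" for x t
  proof -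
    have "(1 - t) *\<^sub>R P x + t *\<^sub>R x \<in> W"
      using W(2) PW that by (auto simp: convex_alt)
    then show ?thesis by (simp add: \<gamma>_def algebra_simps)
  qed
  define g where "g b x = integral (cbox 0 1) (\<lambda>t. D (\<gamma> (t, x)) b)" for b x
  show ?thesis
  proof (rule that)
    fix b
    have "smooth \<Omega> (\<lambda>p. D (\<gamma> p) b)"
      by (rule smooth_compose[OF D(2) smooth_subset[OF \<gamma>] O W(1)]) (use O in \<open>auto simp: \<Omega>_def\<close>)
    then show "smooth W (g b)"
      unfolding g_def
      by (intro smooth_integral_param[OF W(1) O, of _ _ "\<lambda>p. D (\<gamma> p) b"])
        (auto simp: \<Omega>_def intro!: \<gamma>W)
  next
    fix x assume x: "x \<in> W"
    have der: "((\<lambda>t. c (\<gamma> (t, x))) has_vector_derivative D (\<gamma> (t, x)) (x - P x)) (at t within {0..1})"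
      if t: "t \<in> {0..1}" for t
    proof -
      have "((\<lambda>t. \<gamma> (t, x)) has_derivative (\<lambda>h. h *\<^sub>R (x - P x))) (at t within {0..1})"
        unfolding \<gamma>_def by (auto intro!: derivative_eq_intros)
      from has_derivative_compose[OF this D(1)[OF \<gamma>W[OF x t]]]
      show ?thesis
        using has_derivative_linear[OF D(1)[OF \<gamma>W[OF x t]]]
        by (simp add: has_vector_derivative_def linear_scale)
    qed
    have "((\<lambda>t. D (\<gamma> (t, x)) (x - P x)) has_integral c (\<gamma> (1, x)) - c (\<gamma> (0, x))) {0..1}"
      by (rule fundamental_theorem_of_calculus) (use der in auto)
    then have "c x = integral (cbox 0 1) (\<lambda>t. D (\<gamma> (t, x)) (x - P x))"
      using cP[OF x] by (simp add: \<gamma>_def integral_unique)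
    also have "\<dots> = integral (cbox 0 1) (\<lambda>t. \<Sum>b\<in>Basis. ((x - P x) \<bullet> b) * D (\<gamma> (t, x)) b)"
    proof (rule integral_cong)
      fix t :: real assume "t \<in> cbox 0 1"
      then have "linear (D (\<gamma> (t, x)))"
        using D(1)[OF \<gamma>W[OF x]] has_derivative_linear by auto
      from linear_eq_sum_Basis[OF this, of "x - P x"]
      show "D (\<gamma> (t, x)) (x - P x) = (\<Sum>b\<in>Basis. ((x - P x) \<bullet> b) * D (\<gamma> (t, x)) b)"
        by simp
    qed
    also have "\<dots> = (\<Sum>b\<in>Basis. integral (cbox 0 1) (\<lambda>t. ((x - P x) \<bullet> b) * D (\<gamma> (t, x)) b))"
    proof (rule integral_sum)
      fix b :: 'e
      have "continuous_on (cbox 0 1) (\<lambda>t. D (\<gamma> (t, x)) b)"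
        by (rule continuous_on_compose2[OF smooth_continuous_on[OF D(2) W(1)]
            continuous_on_compose2[OF smooth_continuous_on[OF \<gamma> open_UNIV]]])
          (use \<gamma>W[OF x] in \<open>auto intro!: continuous_intros\<close>)
      then show "(\<lambda>t. ((x - P x) \<bullet> b) * D (\<gamma> (t, x)) b) integrable_on cbox 0 1"
        by (intro integrable_continuous continuous_intros)
    qed simp
    also have "\<dots> = (\<Sum>b\<in>Basis. ((x - P x) \<bullet> b) * g b x)"
      by (simp add: g_def)
    finally show "c x = (\<Sum>b\<in>Basis. ((x - P x) \<bullet> b) * g b x)" .
  qed
qed

subsection \<open>Smoothness of inverses\<close>

text \<open>
  Used to differentiate the inverses of a family of linear maps, which at that stage are only known to
  be continuous.
\<close>

lemma has_derivative_vanishing_times_continuous: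
  fixes f :: "'a::real_normed_vector \<Rightarrow> real" and g :: "'a \<Rightarrow> 'b::real_normed_vector"
  assumes f: "(f has_derivative D) (at x)" and f0: "f x = 0" and g: "isCont g x"
  shows "((\<lambda>y. f y *\<^sub>R g y) has_derivative (\<lambda>h. D h *\<^sub>R g x)) (at x)"
proof -
  have bl: "bounded_linear D" using f has_derivative_bounded_linear by blast
  have lim: "((\<lambda>y. norm (f y - f x - D (y - x)) / norm (y - x)) \<longlongrightarrow> 0) (at x)"
    using f by (simp add: has_derivative_iff_norm)
  obtain K where K: "\<And>h. norm (D h) \<le> norm h * K"
    using bounded_linear.bounded[OF bl] by blast
  have g0: "((\<lambda>y. norm (g y - g x)) \<longlongrightarrow> 0) (at x)"
    using g by (simp add: isCont_def LIM_zero_iff tendsto_norm_zero_iff)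
  have ng: "((\<lambda>y. norm (g y)) \<longlongrightarrow> norm (g x)) (at x)"
    using g by (simp add: isCont_def tendsto_norm)
  have "((\<lambda>y. (norm (f y - f x - D (y - x)) / norm (y - x)) * norm (g y) + K * norm (g y - g x))
      \<longlongrightarrow> 0 * norm (g x) + K * 0) (at x)"
    by (intro tendsto_intros lim ng g0)
  then have L: "((\<lambda>y. (norm (f y - f x - D (y - x)) / norm (y - x)) * norm (g y) + K * norm (g y - g x))
      \<longlongrightarrow> 0) (at x)" by simp
  have "((\<lambda>y. norm (f y *\<^sub>R g y - f x *\<^sub>R g x - D (y - x) *\<^sub>R g x) / norm (y - x)) \<longlongrightarrow> 0) (at x)"
  proof (rule tendsto_sandwich[OF _ _ tendsto_const L])
    show "\<forall>\<^sub>F y in at x. norm (f y *\<^sub>R g y - f x *\<^sub>R g x - D (y - x) *\<^sub>R g x) / norm (y - x)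
      \<le> (norm (f y - f x - D (y - x)) / norm (y - x)) * norm (g y) + K * norm (g y - g x)"
      unfolding eventually_at_filter
    proof (intro eventuallyI always_eventually allI impI)
      fix y assume y: "y \<noteq> x"
      have "f y *\<^sub>R g y - f x *\<^sub>R g x - D (y - x) *\<^sub>R g x
          = (f y - f x - D (y - x)) *\<^sub>R g y + D (y - x) *\<^sub>R (g y - g x)"
        by (simp add: f0 algebra_simps)
      then have "norm (f y *\<^sub>R g y - f x *\<^sub>R g x - D (y - x) *\<^sub>R g x)
        \<le> norm (f y - f x - D (y - x)) * norm (g y) + norm (D (y - x)) * norm (g y - g x)"
        using norm_triangle_ineq[of "(f y - f x - D (y - x)) *\<^sub>R g y" "D (y - x) *\<^sub>R (g y - g x)"]
        by simp
      also have "norm (D (y - x)) * norm (g y - g x) \<le> (norm (y - x) * K) * norm (g y - g x)"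
        by (intro mult_right_mono K) simp
      finally have "norm (f y *\<^sub>R g y - f x *\<^sub>R g x - D (y - x) *\<^sub>R g x) / norm (y - x)
        \<le> (norm (f y - f x - D (y - x)) * norm (g y) + (norm (y - x) * K) * norm (g y - g x)) / norm (y - x)"
        by (rule divide_right_mono) auto
      also have "\<dots> = (norm (f y - f x - D (y - x)) / norm (y - x)) * norm (g y) + K * norm (g y - g x)"
        using y by (simp add: add_divide_distrib)
      finally show "norm (f y *\<^sub>R g y - f x *\<^sub>R g x - D (y - x) *\<^sub>R g x) / norm (y - x)
        \<le> (norm (f y - f x - D (y - x)) / norm (y - x)) * norm (g y) + K * norm (g y - g x)" .
    qed
  qed simp
  moreover have "bounded_linear (\<lambda>h. D h *\<^sub>R g x)"
    by (rule bounded_linear_compose[OF bounded_linear_scaleR_left bl])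
  ultimately show ?thesis by (simp add: has_derivative_iff_norm)
qed

text \<open>
  Everything follows from \<open>A x w - A y w = - A x (L x u - L y u)\<close> with \<open>u = A y w\<close>. The maps \<open>A x\<close> are
  locally bounded, so \<open>A\<close> is continuous; then \<open>A\<close> is differentiable, and its derivative is a polynomial in
  the entries of \<open>A\<close> and of the derivative of \<open>L\<close>. Hence each order of differentiability of \<open>A\<close> yields the
  next one.
\<close>

lemma smooth_inverse_family:
  fixes L A :: "'a::real_normed_vector \<Rightarrow> 'e::euclidean_space \<Rightarrow> 'e"
  assumes W: "open W" and L: "\<And>v. smooth W (\<lambda>x. L x v)"
    and lin: "\<And>x. x \<in> W \<Longrightarrow> linear (L x)" "\<And>x. x \<in> W \<Longrightarrow> linear (A x)"
    and LA: "\<And>x w. x \<in> W \<Longrightarrow> L x (A x w) = w" and AL: "\<And>x v. x \<in> W \<Longrightarrow> A x (L x v) = v"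
  shows "smooth W (\<lambda>x. A x w)"
proof -
  have contA: "isCont (\<lambda>x. A x w) y" if y: "y \<in> W" for y w
  proof -
    obtain K where K: "K > 0" "\<And>w. norm (A y w) \<le> norm w * K"
      using bounded_linear.pos_bounded[OF linear_conv_bounded_linear[THEN iffD1, OF lin(2)[OF y]]]
      by blast
    define S where "S x = (\<Sum>b\<in>Basis. norm (L x b - L y b))" for x
    have Lt: "((\<lambda>x. L x v) \<longlongrightarrow> L y v) (at y)" for v
      using smooth_continuous_on[OF L W, of v] y W
      by (simp add: continuous_on_eq_continuous_at isCont_def)
    have "(S \<longlongrightarrow> (\<Sum>b\<in>Basis. norm (L y b - L y b))) (at y)"
      unfolding S_def by (intro tendsto_intros Lt)
    then have "(S \<longlongrightarrow> 0) (at y)" by simp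
    then have "\<forall>\<^sub>F x in at y. S x < 1 / (2 * K)"
      using K(1) by (auto elim: order_tendstoD)
    moreover have "\<forall>\<^sub>F x in at y. x \<in> W"
      using W y eventually_at_in_open' by blast
    ultimately have ev: "\<forall>\<^sub>F x in at y.
        norm (A x w - A y w) \<le> 2 * K * norm (L x (A y w) - L y (A y w))"
    proof eventually_elim
      case (elim x)
      have bd: "norm v \<le> 2 * K * norm (L x v)" for v
      proof -
        have "L y v = L x v - (\<Sum>b\<in>Basis. (v \<bullet> b) *\<^sub>R (L x b - L y b))"
          using linear_eq_sum_Basis[OF lin(1)[OF elim(2)], of v]
            linear_eq_sum_Basis[OF lin(1)[OF y], of v]
          by (simp add: scaleR_diff_right sum_subtractf)
        then have "norm (L y v) \<le> norm (L x v) + norm (\<Sum>b\<in>Basis. (v \<bullet> b) *\<^sub>R (L x b - L y b))"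
          by (simp add: norm_triangle_ineq4)
        also have "norm (\<Sum>b\<in>Basis. (v \<bullet> b) *\<^sub>R (L x b - L y b)) \<le> norm v * S x"
          unfolding S_def sum_distrib_left
          by (rule sum_norm_le) (simp add: mult_right_mono Basis_le_norm)
        also have "norm v * S x \<le> norm v * (1 / (2 * K))"
          using elim(1) by (intro mult_left_mono) auto
        finally have "norm (L y v) \<le> norm (L x v) + norm v * (1 / (2 * K))" by simp
        moreover have "norm v \<le> norm (L y v) * K"
          using K(2)[of "L y v"] AL[OF y] by simp
        ultimately have "norm v \<le> (norm (L x v) + norm v * (1 / (2 * K))) * K"
          using K(1) by (meson mult_right_mono order_trans less_imp_le)
        then show ?thesis using K(1) by (simp add: field_simps)
      qed
      have "L x (A x w - A y w) = - (L x (A y w) - L y (A y w))"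
        using lin(1)[OF elim(2)] LA[OF elim(2)] LA[OF y] by (simp add: linear_diff)
      then show ?case using bd[of "A x w - A y w"] by (simp only: norm_minus_cancel)
    qed
    have "((\<lambda>x. 2 * K * norm (L x (A y w) - L y (A y w))) \<longlongrightarrow>
        2 * K * norm (L y (A y w) - L y (A y w))) (at y)"
      by (intro tendsto_intros Lt)
    then have "((\<lambda>x. 2 * K * norm (L x (A y w) - L y (A y w))) \<longlongrightarrow> 0) (at y)" by simp
    from Lim_null_comparison[OF ev this] show ?thesis
      by (simp add: isCont_def LIM_zero_iff)
  qed
  define D where "D v x = frechet_derivative (\<lambda>x. L x v) (at x)" for v x
  have D: "((\<lambda>x. L x v) has_derivative D v x) (at x)" if "x \<in> W" for x v
  proof -
    have "(\<lambda>x. L x v) differentiable (at x within W)"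
      using smoothD[OF L, of 1] that by simp
    then show ?thesis
      using frechet_derivative_works at_within_open[OF that W] unfolding D_def by metis
  qed
  have Ds: "smooth W (\<lambda>x. D v x u)" for u v
  proof -
    obtain D' where D': "\<And>x. x \<in> W \<Longrightarrow> ((\<lambda>x. L x v) has_derivative D' x) (at x)"
        "\<And>u. smooth W (\<lambda>x. D' x u)"
      by (rule smooth_derivE[OF L W, of v]; blast)
    have "D v x u = D' x u" if "x \<in> W" for x
      using has_derivative_unique[OF D[OF that] D'(1)[OF that]] by simp
    then show ?thesis using D'(2)[of u] smooth_cong[of W "\<lambda>x. D v x u" "\<lambda>x. D' x u"] by simp
  qed
  have der: "((\<lambda>x. A x w) has_derivative
     (\<lambda>h. - (\<Sum>b\<in>Basis. (\<Sum>c\<in>Basis. (A y w \<bullet> c) * (D c y h \<bullet> b)) *\<^sub>R A y b))) (at y)"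
    if y: "y \<in> W" for y w
  proof -
    define u where "u = A y w"
    have "((\<lambda>x. \<Sum>c\<in>Basis. (u \<bullet> c) *\<^sub>R L x c) has_derivative (\<lambda>h. \<Sum>c\<in>Basis. (u \<bullet> c) *\<^sub>R D c y h)) (at y)"
      by (intro has_derivative_sum has_derivative_scaleR_right D y)
    then have "((\<lambda>x. L x u) has_derivative (\<lambda>h. \<Sum>c\<in>Basis. (u \<bullet> c) *\<^sub>R D c y h)) (at y)"
      by (rule has_derivative_transform_within_open[OF _ W y])
        (use linear_eq_sum_Basis[OF lin(1), of _ u] in auto)
    then have dL: "((\<lambda>x. (L x u - L y u) \<bullet> b) has_derivative
        (\<lambda>h. (\<Sum>c\<in>Basis. (u \<bullet> c) *\<^sub>R D c y h) \<bullet> b)) (at y)" for b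
      by (auto intro!: derivative_eq_intros)
    have "((\<lambda>x. \<Sum>b\<in>Basis. ((L x u - L y u) \<bullet> b) *\<^sub>R A x b) has_derivative
        (\<lambda>h. \<Sum>b\<in>Basis. ((\<Sum>c\<in>Basis. (u \<bullet> c) *\<^sub>R D c y h) \<bullet> b) *\<^sub>R A y b)) (at y)"
      by (intro has_derivative_sum has_derivative_vanishing_times_continuous dL contA y) simp
    then have "((\<lambda>x. A y w - (\<Sum>b\<in>Basis. ((L x u - L y u) \<bullet> b) *\<^sub>R A x b)) has_derivative
        (\<lambda>h. - (\<Sum>b\<in>Basis. (\<Sum>c\<in>Basis. (u \<bullet> c) * (D c y h \<bullet> b)) *\<^sub>R A y b))) (at y)"
      using has_derivative_diff[OF has_derivative_const] by (fastforce simp: inner_sum_left)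
    then have "((\<lambda>x. A x w) has_derivative
        (\<lambda>h. - (\<Sum>b\<in>Basis. (\<Sum>c\<in>Basis. (u \<bullet> c) * (D c y h \<bullet> b)) *\<^sub>R A y b))) (at y)"
    proof (rule has_derivative_transform_within_open[OF _ W y])
      fix x assume x: "x \<in> W"
      have "A x (L x u - L y u) = (\<Sum>b\<in>Basis. ((L x u - L y u) \<bullet> b) *\<^sub>R A x b)"
        by (rule linear_eq_sum_Basis[OF lin(2)[OF x]])
      moreover have "A x (L x u - L y u) = u - A x w"
        using lin(2)[OF x] AL[OF x] LA[OF y] by (simp add: linear_diff u_def)
      ultimately show "A y w - (\<Sum>b\<in>Basis. ((L x u - L y u) \<bullet> b) *\<^sub>R A x b) = A x w"
        by (simp add: u_def)
    qed
    then show ?thesis by (simp add: u_def)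
  qed
  have "Ck k W (\<lambda>x. A x w)" for k w
  proof (induction k arbitrary: w)
    case 0
    show ?case using contA by (simp add: continuous_at_imp_continuous_on)
  next
    case (Suc k)
    have 1: "Ck k W (\<lambda>x. A x w \<bullet> c)" for c
      by (rule Ck_linear[OF bounded_linear_inner_left Suc.IH W])
    have 2: "Ck k W (\<lambda>x. D c x v \<bullet> b)" for c v b
      by (rule Ck_linear[OF bounded_linear_inner_left smoothD[OF Ds] W])
    show ?case
      by (rule Ck_SucI[OF W der], assumption,
          rule Ck_linear[OF bounded_linear_minus[OF bounded_linear_ident] _ W])
        (intro Ck_sum Ck_bilinear[OF bounded_bilinear_scaleR] Ck_bilinear[OF bounded_bilinear_mult]
          W 1 2 Suc.IH)
  qed
  then show ?thesis by (simp add: smooth_on_def)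
qed

text \<open>
  The derivative of the inverse map \<open>g\<close> at \<open>y\<close> is the inverse of the derivative of \<open>f\<close> at \<open>g y\<close>, which is
  a smooth function of \<open>g y\<close>. So each order of differentiability of \<open>g\<close> yields the next one.
\<close>

lemma smooth_local_inverse:
  fixes f :: "'e::euclidean_space \<Rightarrow> 'e"
  assumes W: "open W" and f: "smooth W f" and x0: "x0 \<in> W"
    and D0: "(f has_derivative D0) (at x0)" and inj: "\<And>v. D0 v = 0 \<Longrightarrow> v = 0"
  obtains N V g where "open N" "x0 \<in> N" "N \<subseteq> W" "open V" "homeomorphism N V f g" "smooth V g"
proof -
  obtain D where D: "\<And>x. x \<in> W \<Longrightarrow> (f has_derivative D x) (at x)" "\<And>v. smooth W (\<lambda>x. D x v)"
    by (rule smooth_derivE[OF f W]; blast)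
  define f' where "f' x = Blinfun (D x)" for x
  have f': "blinfun_apply (f' x) = D x" if "x \<in> W" for x
    using bounded_linear_Blinfun_apply[OF has_derivative_bounded_linear[OF D(1)[OF that]]]
    by (simp add: f'_def)
  have D00: "D0 = D x0" using has_derivative_unique[OF D0 D(1)[OF x0]] .
  have lin0: "linear D0" using D0 has_derivative_linear by blast
  have "inj D0" using inj lin0 by (simp add: linear_injective_0)
  then obtain B where B: "linear B" "B \<circ> D0 = id"
    using linear_injective_left_inverse[OF lin0] by blast
  have cf': "continuous_on W f'"
  proof (rule continuous_on_blinfun_componentwise)
    fix i :: 'e
    show "continuous_on W (\<lambda>x. blinfun_apply (f' x) i)"
      using smooth_continuous_on[OF D(2)[of i] W] f' by (simp cong: continuous_on_cong)
  qed
  have bB: "bounded_linear B" using B(1) linear_conv_bounded_linear by blast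
  have inv: "blinfun_compose (Blinfun B) (f' x0) = id_blinfun"
    using B(2) D00 by (intro blinfun_eqI)
      (simp add: f'[OF x0] bounded_linear_Blinfun_apply[OF bB] fun_eq_iff)
  have der': "(f has_derivative blinfun_apply (f' x)) (at x)" if "x \<in> W" for x
    using D(1)[OF that] f'[OF that] by simp
  obtain N V g g' where N: "open N" "N \<subseteq> W" "x0 \<in> N" "open V" "f x0 \<in> V" "homeomorphism N V f g"
    "\<And>y. y \<in> V \<Longrightarrow> (g has_derivative (g' y)) (at y)"
    "\<And>y. y \<in> V \<Longrightarrow> g' y = inv_into UNIV (blinfun_apply (f' (g y)))"
    "\<And>y. y \<in> V \<Longrightarrow> bij (blinfun_apply (f' (g y)))"
    using inverse_function_theorem[OF W der' cf' x0 inv] by blast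
  have gN: "g y \<in> N" if "y \<in> V" for y using N(6) that by (auto simp: homeomorphism_def)
  have fV: "f x \<in> V" "g (f x) = x" if "x \<in> N" for x using N(6) that by (auto simp: homeomorphism_def)
  define A where "A x = inv_into UNIV (D x)" for x
  have bij: "bij (D x)" if "x \<in> N" for x
    using N(9)[OF fV(1)[OF that]] fV(2)[OF that] f' N(2) that by auto
  have linD: "linear (D x)" if "x \<in> N" for x
    using D(1) N(2) that has_derivative_linear by blast
  have A: "smooth N (\<lambda>x. A x w)" for w
  proof (rule smooth_inverse_family[OF N(1), of D])
    show "smooth N (\<lambda>x. D x v)" for v by (rule smooth_subset[OF D(2) W N(1,2)])
    show "linear (A x)" if "x \<in> N" for x
      unfolding A_def using linD[OF that] bij[OF that]
      by (simp add: bij_def linear_inj_imp_surj inj_linear_imp_inv_linear)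
  qed (use linD bij in \<open>auto simp: A_def bij_def surj_f_inv_f\<close>)
  have g': "(g has_derivative A (g y)) (at y)" if "y \<in> V" for y
    using N(7)[OF that] N(8)[OF that] f' gN[OF that] N(2) by (auto simp: A_def)
  have "Ck k V g" for k
  proof (induction k)
    case 0
    show ?case using N(6) by (simp add: homeomorphism_def)
  next
    case (Suc k)
    show ?case
      by (rule Ck_SucI[OF N(4) g'], assumption, rule Ck_compose[OF smoothD[OF A] Suc N(4,1)])
        (use gN in auto)
  qed
  then show ?thesis using that N by (simp add: smooth_on_def)
qed

section \<open>Fourier analysis on the torus\<close>

abbreviation cube :: "(real ^ 'k::finite) set" where
  "cube \<equiv> cbox 0 1"

lemma torus_exp_add: "torus_exp (\<xi> + \<eta>) = (\<chi> j. torus_exp \<xi> $ j * torus_exp \<eta> $ j)"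
  by (simp add: torus_exp_def vec_eq_iff cis_mult algebra_simps)

lemma torus_exp_periodic: "torus_exp (\<xi> + axis j (of_int n)) = torus_exp \<xi>"
proof -
  have "cis (2 * pi * real_of_int n) = 1"
    by (metis cis_2pi cis_power_int mult.commute power_int_1_left of_int_mult)
  then have "cis (2 * pi * (\<xi> $ i + axis j (real_of_int n) $ i)) = cis (2 * pi * \<xi> $ i)" for i
    by (cases "i = j") (simp_all add: axis_def distrib_left flip: cis_mult)
  then show ?thesis by (simp add: torus_exp_def vec_eq_iff)
qed

lemma continuous_on_torus_exp: "continuous_on S torus_exp"
  unfolding torus_exp_def by (intro continuous_intros)

lemma torus_exp_cube: "range torus_exp = torus_exp ` cube"
proof -
  have "\<exists>\<eta>\<in>cube. torus_exp \<xi> = torus_exp \<eta>" for \<xi> :: "real ^ 'a"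
  proof
    show "(\<chi> j. frac (\<xi> $ j)) \<in> cube"
      by (simp add: mem_box_cart frac_lt_1 less_imp_le)
    have "cis (2 * pi * \<xi> $ j) = cis (2 * pi * frac (\<xi> $ j))" for j
    proof -
      have "cis (2 * pi * real_of_int \<lfloor>\<xi> $ j\<rfloor>) = 1"
        by (metis cis_2pi cis_power_int mult.commute power_int_1_left of_int_mult)
      moreover have "2 * pi * \<xi> $ j = 2 * pi * frac (\<xi> $ j) + 2 * pi * real_of_int \<lfloor>\<xi> $ j\<rfloor>"
        by (simp add: frac_def algebra_simps)
      ultimately show ?thesis by (metis cis_mult mult.right_neutral)
    qed
    then show "torus_exp \<xi> = torus_exp (\<chi> j. frac (\<xi> $ j))"
      by (simp add: torus_exp_def vec_eq_iff)
  qed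
  then show ?thesis by blast
qed

lemma compact_torus: "compact (range torus_exp)"
  unfolding torus_exp_cube by (intro compact_continuous_image continuous_on_torus_exp compact_cbox)

text \<open>
  The preimage of a closed set under \<open>H\<close> is the image under the exponential map of a closed part of the
  compact cube, hence closed.
\<close>

lemma continuous_on_torus:
  fixes H :: "complex ^ 'k::finite \<Rightarrow> 'b::topological_space"
  assumes "continuous_on UNIV (\<lambda>\<xi>. H (torus_exp \<xi>))"
  shows "continuous_on (range torus_exp) H"
proof (subst continuous_on_closed_vimage)
  show "closed (range (torus_exp :: real ^ 'k \<Rightarrow> _))" by (rule compact_imp_closed[OF compact_torus])
  show "\<forall>B. closed B \<longrightarrow> closed (H -` B \<inter> range torus_exp)"
  proof (intro allI impI)
    fix B :: "'b set" assume "closed B"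
    then have "closed ((\<lambda>\<xi>. H (torus_exp \<xi>)) -` B)"
      using assms by (simp add: continuous_closed_vimage continuous_on_eq_continuous_at)
    then have "compact (torus_exp ` (cube \<inter> (\<lambda>\<xi>. H (torus_exp \<xi>)) -` B))"
      by (intro compact_continuous_image continuous_on_torus_exp compact_Int_closed compact_cbox)
    moreover have "torus_exp ` (cube \<inter> (\<lambda>\<xi>. H (torus_exp \<xi>)) -` B) = H -` B \<inter> range torus_exp"
      unfolding torus_exp_cube by auto
    ultimately show "closed (H -` B \<inter> range (torus_exp :: real ^ 'k \<Rightarrow> _))"
      using compact_imp_closed by metis
  qed
qed

text \<open>
  Cut the shifted cube along the face of the original one, and move the protruding part back by a
  period.
\<close>

lemma integral_cube_shift_axis:
  fixes f :: "real ^ 'k::finite \<Rightarrow> 'b::euclidean_space"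
  assumes f: "continuous_on UNIV f" and per: "\<And>\<xi>. f (\<xi> + axis j 1) = f \<xi>"
    and s: "0 \<le> s" "s \<le> 1"
  shows "integral cube (\<lambda>\<xi>. f (\<xi> + axis j s)) = integral cube f"
proof -
  have int: "f integrable_on cbox a b" for a b
    using f continuous_on_subset by (blast intro: integrable_continuous)
  have e: "axis j (1::real) \<in> Basis" by (simp add: axis_in_Basis_iff)
  have ax: "axis j x $ i = (if i = j then x else 0)" for i and x :: real by (simp add: axis_def)
  have mem: "x \<in> cbox a b \<longleftrightarrow> a $ j \<le> x $ j \<and> x $ j \<le> b $ j \<and> (\<forall>i. i \<noteq> j \<longrightarrow> a $ i \<le> x $ i \<and> x $ i \<le> b $ i)"
    for a b x :: "real ^ 'k"
    unfolding mem_box_cart by metis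
  have "integral cube (\<lambda>\<xi>. f (\<xi> + axis j s)) = integral (cbox (axis j s) (1 + axis j s)) f"
    using integral_shift_cbox[of "axis j s" "axis j s" "1 + axis j s" f] by simp
  also have "\<dots> = integral (cbox (axis j s) (1 + axis j s) \<inter> {x. x \<bullet> axis j 1 \<le> 1}) f +
      integral (cbox (axis j s) (1 + axis j s) \<inter> {x. x \<bullet> axis j 1 \<ge> 1}) f"
    by (rule integral_split[OF int e])
  also have "cbox (axis j s) (1 + axis j s) \<inter> {x. x \<bullet> axis j 1 \<le> 1} = cbox (axis j s) 1"
    using s by (auto simp: mem ax inner_axis)
  also have "cbox (axis j s) (1 + axis j s) \<inter> {x. x \<bullet> axis j 1 \<ge> 1} = cbox (axis j 1) (1 + axis j s)"
    using s by (auto simp: mem ax inner_axis)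
  also have "integral (cbox (axis j 1) (1 + axis j s)) f = integral (cbox 0 (1 + axis j s - axis j 1)) f"
    using integral_shift_cbox[of "axis j 1" "axis j 1" "1 + axis j s" f] by (simp add: per)
  also have "cbox 0 (1 + axis j s - axis j 1) = cube \<inter> {x. x \<bullet> axis j 1 \<le> s}"
    using s by (auto simp: mem ax inner_axis)
  also have "cbox (axis j s) 1 = cube \<inter> {x. x \<bullet> axis j 1 \<ge> s}"
    using s by (auto simp: mem ax inner_axis)
  also have "integral (cube \<inter> {x. x \<bullet> axis j 1 \<ge> s}) f + integral (cube \<inter> {x. x \<bullet> axis j 1 \<le> s}) f
      = integral cube f"
    using integral_split[OF int e, of 0 1 s] by (simp add: add.commute)
  finally show ?thesis .
qed

lemma integral_cube_shift:
  fixes f :: "real ^ 'k::finite \<Rightarrow> 'b::euclidean_space"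
  assumes f: "continuous_on UNIV f" and per: "\<And>\<xi> j n. f (\<xi> + axis j (of_int n)) = f \<xi>"
  shows "integral cube (\<lambda>\<xi>. f (\<xi> + \<eta>)) = integral cube f"
proof -
  have "integral cube (\<lambda>\<xi>. f (\<xi> + (\<Sum>j\<in>S. axis j (\<eta> $ j)))) = integral cube f" if "finite S" for S
    using that
  proof (induction S)
    case (insert j S)
    define g where "g \<xi> = f (\<xi> + (\<Sum>j\<in>S. axis j (\<eta> $ j)))" for \<xi>
    have gper: "g (\<xi> + axis j (of_int n)) = g \<xi>" for \<xi> n
      using per[of "\<xi> + (\<Sum>j\<in>S. axis j (\<eta> $ j))" j n] by (simp add: g_def add_ac)
    have "continuous_on UNIV g"
      unfolding g_def by (rule continuous_on_compose2[OF f]) (auto intro!: continuous_intros)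
    then have "integral cube (\<lambda>\<xi>. g (\<xi> + axis j (frac (\<eta> $ j)))) = integral cube g"
      using gper[of _ 1] by (intro integral_cube_shift_axis) (auto simp: frac_lt_1 less_imp_le)
    moreover have "g (\<xi> + axis j (frac (\<eta> $ j))) = f (\<xi> + (\<Sum>j\<in>insert j S. axis j (\<eta> $ j)))" for \<xi>
    proof -
      have "axis j (\<eta> $ j) = axis j (frac (\<eta> $ j)) + axis j (of_int \<lfloor>\<eta> $ j\<rfloor>)"
        by (simp add: axis_def vec_eq_iff frac_def)
      then have "g (\<xi> + axis j (\<eta> $ j)) = g (\<xi> + axis j (frac (\<eta> $ j)))"
        using gper[of "\<xi> + axis j (frac (\<eta> $ j))"] by (simp add: add.assoc)
      then show ?thesis using insert.hyps by (simp add: g_def add.assoc)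
    qed
    ultimately have "integral cube (\<lambda>\<xi>. f (\<xi> + (\<Sum>j\<in>insert j S. axis j (\<eta> $ j)))) = integral cube g"
      by simp
    also have "\<dots> = integral cube f" unfolding g_def by (rule insert.IH)
    finally show ?case .
  qed simp
  from this[of UNIV] have "integral cube (\<lambda>\<xi>. f (\<xi> + (\<Sum>j\<in>UNIV. axis j (\<eta> $ j)))) = integral cube f"
    by simp
  moreover have "(\<Sum>j\<in>UNIV. axis j (\<eta> $ j)) = \<eta>"
    by (simp add: vec_eq_iff axis_def)
  ultimately show ?thesis by simp
qed

definition weight :: "real ^ 'k::finite \<Rightarrow> bool" where
  "weight \<alpha> \<longleftrightarrow> (\<forall>j. \<alpha> $ j \<in> \<int>)"

definition character :: "real ^ 'k::finite \<Rightarrow> real ^ 'k \<Rightarrow> complex" where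
  "character \<alpha> \<xi> = cis (2 * pi * (\<alpha> \<bullet> \<xi>))"

lemma character_add: "character \<alpha> (\<xi> + \<eta>) = character \<alpha> \<xi> * character \<alpha> \<eta>"
  by (simp add: character_def inner_add_right cis_mult distrib_left)

lemma character_add_weight: "character (\<alpha> + \<beta>) \<xi> = character \<alpha> \<xi> * character \<beta> \<xi>"
  by (simp add: character_def inner_add_left cis_mult distrib_left)

lemma character_minus: "character (- \<alpha>) \<xi> * character \<alpha> \<xi> = 1"
  by (simp add: character_def cis_mult)

lemma character_0 [simp]: "character 0 \<xi> = 1" "character \<alpha> 0 = 1"
  by (simp_all add: character_def)

lemma continuous_on_character: "continuous_on S (character \<alpha>)"
  unfolding character_def by (intro continuous_intros)

lemma character_periodic:
  assumes "weight \<alpha>"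
  shows "character \<alpha> (\<xi> + axis j (of_int n)) = character \<alpha> \<xi>"
proof -
  obtain m where "\<alpha> $ j = of_int m" using assms by (auto simp: weight_def elim: Ints_cases)
  then have "character \<alpha> (axis j (of_int n)) = cis (2 * pi * of_int (m * n))"
    by (simp add: character_def inner_axis mult.commute)
  also have "\<dots> = 1"
    by (metis cis_2pi cis_power_int mult.commute power_int_1_left)
  finally show ?thesis by (simp add: character_add)
qed

text \<open>
  Multiplication by a coordinate of the torus shifts weights. So the functions whose Fourier
  coefficients all vanish are closed under multiplication by polynomials, and \<open>H\<close> is orthogonal to all
  of them. By the theorem of Stone and Weierstrass \<open>H\<close> is then orthogonal to itself.
\<close>

lemma fourier_coefficients_zero:
  fixes H :: "complex ^ 'k::finite \<Rightarrow> real"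
  assumes H: "continuous_on UNIV (\<lambda>\<xi>. H (torus_exp \<xi>))"
    and Z: "\<And>\<alpha>. weight \<alpha> \<Longrightarrow> integral cube (\<lambda>\<xi>. H (torus_exp \<xi>) *\<^sub>R character \<alpha> \<xi>) = 0"
  shows "H (torus_exp \<xi>) = 0"
proof -
  let ?T = "range (torus_exp :: real ^ 'k \<Rightarrow> _)"
  define N where "N = {Q :: complex ^ 'k \<Rightarrow> real. continuous_on ?T Q \<and>
    (\<forall>\<alpha>. weight \<alpha> \<longrightarrow> integral cube (\<lambda>\<xi>. Q (torus_exp \<xi>) *\<^sub>R character \<alpha> \<xi>) = 0)}"
  have pull: "continuous_on cube (\<lambda>\<xi>. Q (torus_exp \<xi>))" if "continuous_on ?T Q"
    for Q :: "complex ^ 'k \<Rightarrow> real"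
    by (rule continuous_on_compose2[OF that continuous_on_torus_exp]) auto
  have int: "(\<lambda>\<xi>. Q (torus_exp \<xi>) *\<^sub>R (c * character \<alpha> \<xi>)) integrable_on cube"
    if "continuous_on ?T Q" for Q :: "complex ^ 'k \<Rightarrow> real" and \<alpha> c
    by (intro integrable_continuous continuous_intros pull[OF that] continuous_on_character)
  have HT: "continuous_on ?T H" by (rule continuous_on_torus[OF H])
  have w0: "weight (0 :: real ^ 'k)" by (simp add: weight_def)
  have HN: "H \<in> N" using HT Z by (simp add: N_def)
  have addN: "(\<lambda>z. Q z + R z) \<in> N" if "Q \<in> N" "R \<in> N" for Q R
    using that int[of Q 1] int[of R 1]
    by (simp add: N_def continuous_on_add scaleR_add_left integral_add)
  have scale: "(\<lambda>z. Q z * c) \<in> N" if "Q \<in> N" for Q c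
  proof -
    have "integral cube (\<lambda>\<xi>. (Q (torus_exp \<xi>) * c) *\<^sub>R character \<alpha> \<xi>) =
        c *\<^sub>R integral cube (\<lambda>\<xi>. Q (torus_exp \<xi>) *\<^sub>R character \<alpha> \<xi>)" for \<alpha>
      by (subst integral_cmul[symmetric]) (simp add: mult.commute)
    then show ?thesis using that by (simp add: N_def continuous_on_mult_right)
  qed
  have wax: "weight (\<alpha> + axis j 1)" "weight (\<alpha> - axis j 1)" if "weight \<alpha>" for \<alpha> :: "real ^ 'k" and j
    using that by (auto simp: weight_def axis_def)
  have chr: "character (axis j 1) \<xi> = torus_exp \<xi> $ j" for j and \<xi> :: "real ^ 'k"
    by (simp add: character_def torus_exp_def inner_commute[of "axis j 1"] inner_axis)
  have chr': "character (\<alpha> - axis j 1) \<xi> = character \<alpha> \<xi> * cnj (torus_exp \<xi> $ j)" for \<alpha> j and \<xi> :: "real ^ 'k"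
    using character_add_weight[of \<alpha> "- axis j 1" \<xi>]
    by (simp add: chr[symmetric] character_def cis_cnj)
  have coord: "(\<lambda>z. Q z * Re (z $ j)) \<in> N" "(\<lambda>z. Q z * Im (z $ j)) \<in> N" if Q: "Q \<in> N" for Q j
  proof -
    have cQ: "continuous_on ?T Q" using Q by (simp add: N_def)
    have c: "continuous_on ?T (\<lambda>z. Q z * Re (z $ j))" "continuous_on ?T (\<lambda>z. Q z * Im (z $ j))"
      by (intro continuous_intros cQ)+
    have RI: "Re z *\<^sub>R w = (1/2) * (w * z) + (1/2) * (w * cnj z)"
      "Im z *\<^sub>R w = (- \<i>/2) * (w * z) + (\<i>/2) * (w * cnj z)" for z w :: complex
      by (simp_all add: complex_eq_iff field_simps)
    have eq: "integral cube (\<lambda>\<xi>. Q (torus_exp \<xi>) *\<^sub>R (a * character (\<alpha> + axis j 1) \<xi> +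
        b * character (\<alpha> - axis j 1) \<xi>)) = 0" if "weight \<alpha>" for \<alpha> a b
    proof -
      have "integral cube (\<lambda>\<xi>. Q (torus_exp \<xi>) *\<^sub>R (c * character \<beta> \<xi>)) = 0" if "weight \<beta>" for c \<beta>
      proof -
        have "integral cube (\<lambda>\<xi>. Q (torus_exp \<xi>) *\<^sub>R (c * character \<beta> \<xi>)) =
            c * integral cube (\<lambda>\<xi>. Q (torus_exp \<xi>) *\<^sub>R character \<beta> \<xi>)"
          by (subst integral_mult_right[symmetric]) (simp add: mult_scaleR_right)
        then show ?thesis using Q that by (simp add: N_def)
      qed
      then show ?thesis
        using wax[OF that, of j] by (simp add: scaleR_add_right integral_add int[OF cQ])
    qed
    have ReIm: "(Q (torus_exp \<xi>) * Re (torus_exp \<xi> $ j)) *\<^sub>R character \<alpha> \<xi> =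
        Q (torus_exp \<xi>) *\<^sub>R ((1/2) * character (\<alpha> + axis j 1) \<xi> + (1/2) * character (\<alpha> - axis j 1) \<xi>)"
      "(Q (torus_exp \<xi>) * Im (torus_exp \<xi> $ j)) *\<^sub>R character \<alpha> \<xi> =
        Q (torus_exp \<xi>) *\<^sub>R ((-\<i>/2) * character (\<alpha> + axis j 1) \<xi> + (\<i>/2) * character (\<alpha> - axis j 1) \<xi>)"
      for \<alpha> \<xi>
      unfolding scaleR_scaleR[symmetric] RI character_add_weight chr chr' by simp_all
    show "(\<lambda>z. Q z * Re (z $ j)) \<in> N" "(\<lambda>z. Q z * Im (z $ j)) \<in> N"
      unfolding N_def mem_Collect_eq ReIm using c eq by blast+
  qed
  have sum: "(\<lambda>z. \<Sum>j\<in>S. q j z) \<in> N" if "finite S" "\<And>j. q j \<in> N" for S :: "'k set" and q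
    using that scale[OF HN, of 0] by (induction S) (auto intro: addN)
  have mult: "\<forall>Q\<in>N. (\<lambda>z. Q z * P z) \<in> N" if "real_polynomial_function P" for P
    using that
  proof (induction P rule: real_polynomial_function.induct)
    case (linear f)
    have f: "f z = (\<Sum>j\<in>UNIV. Re (z $ j) * f (axis j 1) + Im (z $ j) * f (axis j \<i>))" for z
    proof -
      have "z = (\<Sum>j\<in>UNIV. Re (z $ j) *\<^sub>R axis j 1 + Im (z $ j) *\<^sub>R axis j \<i>)"
        by (simp add: vec_eq_iff axis_def complex_eq_iff if_distrib sum.distrib cong: if_cong)
      then have "f z = f (\<Sum>j\<in>UNIV. Re (z $ j) *\<^sub>R axis j 1 + Im (z $ j) *\<^sub>R axis j \<i>)" by simp
      also have "\<dots> = (\<Sum>j\<in>UNIV. Re (z $ j) * f (axis j 1) + Im (z $ j) * f (axis j \<i>))"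
        using bounded_linear.linear[OF linear] by (simp add: linear_sum linear_add linear_scale)
      finally show ?thesis .
    qed
    show ?case
    proof
      fix Q assume Q: "Q \<in> N"
      have "(\<lambda>z. \<Sum>j\<in>UNIV. Q z * Re (z $ j) * f (axis j 1) + Q z * Im (z $ j) * f (axis j \<i>)) \<in> N"
        by (intro sum addN scale coord Q) simp
      then show "(\<lambda>z. Q z * f z) \<in> N"
        by (subst f) (simp add: sum_distrib_left distrib_left mult.assoc)
    qed
  next
    case (const c)
    then show ?case using scale by blast
  next
    case (add f g)
    then show ?case by (simp add: distrib_left addN)
  next
    case (mult f g)
    then show ?case by (simp add: mult.assoc[symmetric])
  qed
  define h where "h \<xi> = H (torus_exp \<xi>)" for \<xi>
  have hc: "continuous_on cube h" unfolding h_def by (rule pull[OF HT])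
  define C where "C = integral cube (\<lambda>\<xi>. \<bar>h \<xi>\<bar>)"
  have le: "integral cube (\<lambda>\<xi>. h \<xi> * h \<xi>) \<le> e * C" if e: "e > 0" for e
  proof -
    obtain P where P: "real_polynomial_function P" "\<And>z. z \<in> ?T \<Longrightarrow> \<bar>H z - P z\<bar> < e"
      using Stone_Weierstrass_real_polynomial_function[OF compact_torus HT e] by blast
    define p where "p \<xi> = P (torus_exp \<xi>)" for \<xi> :: "real ^ 'k"
    have "(\<lambda>z. H z * P z) \<in> N" using mult[OF P(1)] HN by blast
    then have HP: "continuous_on ?T (\<lambda>z. H z * P z)"
      "integral cube (\<lambda>\<xi>. (h \<xi> * p \<xi>) *\<^sub>R character 0 \<xi>) = 0"
      using w0 unfolding N_def mem_Collect_eq h_def p_def by blast+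
    have hp: "continuous_on cube (\<lambda>\<xi>. h \<xi> * p \<xi>)"
      unfolding h_def p_def by (rule pull[OF HP(1)])
    have "integral cube (Re \<circ> (\<lambda>\<xi>. (h \<xi> * p \<xi>) *\<^sub>R (1::complex))) =
        Re (integral cube (\<lambda>\<xi>. (h \<xi> * p \<xi>) *\<^sub>R 1))"
      by (intro integral_linear bounded_linear_Re integrable_continuous continuous_intros hp)
    then have 0: "integral cube (\<lambda>\<xi>. h \<xi> * p \<xi>) = 0"
      using HP(2) by (simp add: o_def)
    have "integral cube (\<lambda>\<xi>. h \<xi> * h \<xi>) = integral cube (\<lambda>\<xi>. h \<xi> * h \<xi> - h \<xi> * p \<xi>)"
      by (subst integral_diff) (auto intro!: integrable_continuous continuous_intros hc hp simp: 0)
    also have "\<dots> \<le> integral cube (\<lambda>\<xi>. e * \<bar>h \<xi>\<bar>)"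
    proof (rule integral_le)
      show "h \<xi> * h \<xi> - h \<xi> * p \<xi> \<le> e * \<bar>h \<xi>\<bar>" for \<xi>
      proof -
        have "\<bar>h \<xi> - p \<xi>\<bar> \<le> e" using P(2)[of "torus_exp \<xi>"] by (simp add: h_def p_def less_imp_le)
        then have "\<bar>h \<xi>\<bar> * \<bar>h \<xi> - p \<xi>\<bar> \<le> \<bar>h \<xi>\<bar> * e" by (rule mult_left_mono) simp
        then have "\<bar>h \<xi> * (h \<xi> - p \<xi>)\<bar> \<le> e * \<bar>h \<xi>\<bar>" by (simp add: abs_mult mult.commute)
        then show ?thesis by (simp add: right_diff_distrib)
      qed
    qed (auto intro!: integrable_continuous continuous_intros hc hp)
    also have "\<dots> = e * C" by (simp add: C_def)
    finally show ?thesis .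
  qed
  have "C \<ge> 0" unfolding C_def by (rule integral_nonneg) (auto intro!: integrable_continuous continuous_intros hc)
  have "integral cube (\<lambda>\<xi>. h \<xi> * h \<xi>) \<le> 0"
  proof (rule field_le_epsilon)
    fix e :: real assume "e > 0"
    then have "integral cube (\<lambda>\<xi>. h \<xi> * h \<xi>) \<le> e * (C / (C + 1))"
      using le[of "e / (C + 1)"] \<open>C \<ge> 0\<close> by simp
    also have "\<dots> \<le> e * 1"
      using \<open>C \<ge> 0\<close> \<open>e > 0\<close> by (intro mult_left_mono) auto
    finally show "integral cube (\<lambda>\<xi>. h \<xi> * h \<xi>) \<le> 0 + e" by simp
  qed
  moreover have "integral cube (\<lambda>\<xi>. h \<xi> * h \<xi>) \<ge> 0"
    by (rule integral_nonneg) (auto intro!: integrable_continuous continuous_intros hc)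
  ultimately have "integral cube (\<lambda>\<xi>. h \<xi> * h \<xi>) = 0" by simp
  moreover have "box 0 (1 :: real ^ 'k) \<noteq> {}"
    by (simp add: interval_ne_empty_cart)
  ultimately have "\<forall>\<xi>\<in>cube. h \<xi> * h \<xi> = 0"
    by (subst integral_cbox_eq_0_iff[symmetric]) (auto intro!: continuous_intros hc)
  then have "H z = 0" if "z \<in> ?T" for z
    using that unfolding torus_exp_cube h_def by auto
  then show ?thesis by blast
qed

lemma smooth_cis: "smooth UNIV cis"
proof -
  have "Ck k UNIV cis" for k
  proof (induction k)
    case 0
    show ?case by (simp add: continuous_on_cis)
  next
    case (Suc k)
    show ?case
    proof (rule Ck_SucI)
      show "(cis has_derivative (\<lambda>v. v *\<^sub>R (\<i> * cis x))) (at x)" for x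
        using has_derivative_cis[OF has_derivative_ident] by simp
      have "bounded_linear (\<lambda>z::complex. v *\<^sub>R (\<i> * z))" for v :: real
        by (intro bounded_linear_intros)
      then show "Ck k UNIV (\<lambda>x. v *\<^sub>R (\<i> * cis x))" for v
        by (rule Ck_linear[OF _ Suc]) simp
    qed simp
  qed
  then show ?thesis by (simp add: smooth_on_def)
qed

lemma smooth_character: "smooth UNIV (character \<alpha>)"
proof -
  have "smooth UNIV (\<lambda>\<xi>. 2 * pi * (\<alpha> \<bullet> \<xi>))"
    by (rule smooth_linear[of "\<lambda>\<xi>. 2 * pi * (\<alpha> \<bullet> \<xi>)" UNIV "\<lambda>\<xi>. \<xi>"])
      (auto intro!: bounded_linear_intros smooth_id)
  from smooth_compose[OF smooth_cis this] show ?thesis by (simp add: character_def[abs_def])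
qed


section \<open>Linear algebra\<close>

lemma in_span_if_orthogonal:
  fixes v :: "'v::euclidean_space"
  assumes "\<And>\<xi>. (\<And>s. s \<in> S \<Longrightarrow> s \<bullet> \<xi> = 0) \<Longrightarrow> v \<bullet> \<xi> = 0"
  shows "v \<in> span S"
proof -
  obtain y z where yz: "y \<in> span S" "\<And>w. w \<in> span S \<Longrightarrow> orthogonal z w" "v = y + z"
    using orthogonal_subspace_decomp_exists[of S v] by metis
  have "v \<bullet> z = 0"
    by (rule assms) (use yz(2) span_base in \<open>auto simp: orthogonal_def inner_commute\<close>)
  moreover have "y \<bullet> z = 0" using yz(1,2) by (simp add: orthogonal_def inner_commute)
  ultimately have "z = 0" using yz(3) by (simp add: inner_add_left)
  then show ?thesis using yz by simp
qed

text \<open>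
  Even if the family \<open>a\<close> is linearly dependent, the coefficients of the vectors in its span can be chosen
  to be linear functions of the vector. This is what makes the coefficients of a smooth map smooth.
\<close>

lemma linear_coefficients:
  fixes a :: "'j \<Rightarrow> 'v::euclidean_space"
  assumes "finite I"
  shows "\<exists>l. (\<forall>j. linear (l j)) \<and> (\<forall>v\<in>span (a ` I). v = (\<Sum>j\<in>I. l j v *\<^sub>R a j))"
  using assms
proof (induction I)
  case empty
  show ?case by (intro exI[of _ "\<lambda>_ _. 0"]) (auto simp: linear_iff)
next
  case (insert i I)
  then obtain l :: "'j \<Rightarrow> 'v \<Rightarrow> real"
    where l: "\<And>j. linear (l j)" "\<And>v. v \<in> span (a ` I) \<Longrightarrow> v = (\<Sum>j\<in>I. l j v *\<^sub>R a j)" by auto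
  obtain \<phi> where \<phi>: "linear \<phi>" "\<And>v. v \<in> span (insert (a i) (a ` I)) \<Longrightarrow> v - \<phi> v *\<^sub>R a i \<in> span (a ` I)"
  proof (cases "a i \<in> span (a ` I)")
    case True
    show ?thesis
      by (rule that[of "\<lambda>_. 0"]) (use span_redundant[OF True] in \<open>auto simp: linear_iff\<close>)
  next
    case False
    obtain s t where st: "s \<in> span (a ` I)" "\<And>w. w \<in> span (a ` I) \<Longrightarrow> orthogonal t w" "a i = s + t"
      using orthogonal_subspace_decomp_exists[of "a ` I" "a i"] by metis
    have t0: "t \<bullet> t \<noteq> 0" using False st by auto
    have sp: "w \<bullet> t = 0" if "w \<in> span (a ` I)" for w
      using st(2)[OF that] by (simp add: orthogonal_def inner_commute)
    show ?thesis
    proof (rule that[of "\<lambda>v. (v \<bullet> t) / (t \<bullet> t)"])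
      show "linear (\<lambda>v. (v \<bullet> t) / (t \<bullet> t))"
        by (auto simp: linear_iff inner_add_left add_divide_distrib)
      fix v assume "v \<in> span (insert (a i) (a ` I))"
      then obtain k where k: "v - k *\<^sub>R a i \<in> span (a ` I)" using span_insert by blast
      have "(a i) \<bullet> t = t \<bullet> t" using st sp by (simp add: inner_add_left)
      with sp[OF k] t0 have "(v \<bullet> t) / (t \<bullet> t) = k" by (simp add: inner_diff_left)
      then show "v - ((v \<bullet> t) / (t \<bullet> t)) *\<^sub>R a i \<in> span (a ` I)" using k by simp
    qed
  qed
  define l' where "l' j v = (if j = i then \<phi> v else l j (v - \<phi> v *\<^sub>R a i))" for j v
  have "linear (l' j)" for j
  proof (cases "j = i")
    case False
    have "linear (\<lambda>v. v - \<phi> v *\<^sub>R a i)"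
      using \<phi>(1) by (auto simp: linear_iff algebra_simps)
    from linear_compose[OF this l(1)[of j]] show ?thesis
      using False by (simp add: l'_def[abs_def] o_def)
  qed (use \<phi>(1) in \<open>simp add: l'_def[abs_def]\<close>)
  moreover have "v = (\<Sum>j\<in>insert i I. l' j v *\<^sub>R a j)" if "v \<in> span (a ` insert i I)" for v
  proof -
    have "(\<Sum>j\<in>I. l' j v *\<^sub>R a j) = (\<Sum>j\<in>I. l j (v - \<phi> v *\<^sub>R a i) *\<^sub>R a j)"
      using insert.hyps by (intro sum.cong) (auto simp: l'_def)
    also have "\<dots> = v - \<phi> v *\<^sub>R a i" using l(2)[OF \<phi>(2)] that by simp
    finally show ?thesis using insert.hyps by (simp add: l'_def)
  qed
  ultimately show ?case by blast
qed

text \<open>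
  In the application \<open>R p\<close> and \<open>I p\<close> are the differentials of the real and imaginary parts of
  eigenfunctions, and \<open>N\<close> consists of those that a stabilizer rotates. Condition \<open>rot\<close> says that the span
  of some of the pairs either contains a given pair or is independent of it. So a maximal independent
  set of pairs spans all pairs from \<open>N\<close>, and it can be completed to a basis by single vectors from \<open>Q\<close>.
\<close>

lemma choose_coordinates:
  fixes R I :: "'p \<Rightarrow> 'e::euclidean_space"
  assumes sp: "span (R ` (N \<union> Q) \<union> I ` (N \<union> Q)) = UNIV"
    and rot: "\<And>J p a b. J \<subseteq> N \<Longrightarrow> p \<in> N \<Longrightarrow> (a, b) \<noteq> (0, 0) \<Longrightarrow>
      a *\<^sub>R R p + b *\<^sub>R I p \<in> span (R ` J \<union> I ` J) \<Longrightarrow>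
      R p \<in> span (R ` J \<union> I ` J) \<and> I p \<in> span (R ` J \<union> I ` J)"
  obtains J B where "finite J" "J \<subseteq> N" "inj_on R J" "inj_on I J" "R ` J \<inter> I ` J = {}"
    "B \<subseteq> R ` Q \<union> I ` Q" "B \<inter> (R ` J \<union> I ` J) = {}"
    "independent (R ` J \<union> I ` J \<union> B)" "span (R ` J \<union> I ` J \<union> B) = UNIV"
proof -
  define good where "good J \<longleftrightarrow> finite J \<and> J \<subseteq> N \<and> inj_on R J \<and> inj_on I J \<and> R ` J \<inter> I ` J = {} \<and>
    independent (R ` J \<union> I ` J)" for J
  have "card J < Suc DIM('e)" if "good J" for J
  proof -
    have "card J = card (R ` J)" using that by (simp add: good_def card_image)
    also have "\<dots> \<le> card (R ` J \<union> I ` J)" using that by (intro card_mono) (auto simp: good_def)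
    also have "\<dots> \<le> DIM('e)" using that independent_bound by (auto simp: good_def)
    finally show ?thesis by simp
  qed
  moreover have "good {}" by (simp add: good_def independent_empty)
  ultimately obtain J where J: "good J" "\<And>J'. good J' \<Longrightarrow> card J' \<le> card J"
    using ex_has_greatest_nat[of good "{}" card "Suc DIM('e)"] by blast
  define S where "S = span (R ` J \<union> I ` J)"
  have inS: "R p \<in> S \<and> I p \<in> S" if p: "p \<in> N" for p
  proof (rule ccontr)
    assume no: "\<not> (R p \<in> S \<and> I p \<in> S)"
    have out: "a *\<^sub>R R p + b *\<^sub>R I p \<notin> S" if "(a, b) \<noteq> (0, 0)" for a b
      using rot[of J p a b] J(1) p that no by (auto simp: S_def good_def)
    have R: "R p \<notin> S" using out[of 1 0] by simp
    have I: "I p \<notin> S" using out[of 0 1] by simp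
    have RI: "I p \<notin> span (insert (R p) (R ` J \<union> I ` J))"
    proof
      assume "I p \<in> span (insert (R p) (R ` J \<union> I ` J))"
      then obtain k where "I p - k *\<^sub>R R p \<in> S" unfolding S_def using span_insert by blast
      then show False using out[of "-k" 1] by simp
    qed
    have JS: "R q \<in> S" "I q \<in> S" if "q \<in> J" for q
      using that by (auto simp: S_def intro: span_base)
    have pJ: "p \<notin> J" using JS R by blast
    have ne: "R p \<noteq> I p" using RI span_base[of "R p" "insert (R p) (R ` J \<union> I ` J)"] by auto
    have i: "independent (R ` J \<union> I ` J)" using J(1) by (simp add: good_def)
    have "independent (insert (I p) (insert (R p) (R ` J \<union> I ` J)))"
      by (intro independent_insertI RI R[unfolded S_def] i)
    moreover have "R ` insert p J \<union> I ` insert p J = insert (I p) (insert (R p) (R ` J \<union> I ` J))" by auto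
    moreover have "inj_on R (insert p J)" "inj_on I (insert p J)" "R ` insert p J \<inter> I ` insert p J = {}"
      using J(1) R I JS ne pJ unfolding good_def by auto
    ultimately have "good (insert p J)"
      using J(1) p by (simp add: good_def)
    then show False using J(2)[of "insert p J"] J(1) pJ by (simp add: good_def)
  qed
  define S0 where "S0 = R ` J \<union> I ` J"
  have ind: "independent S0" using J(1) by (simp add: good_def S0_def)
  obtain B' where B': "S0 \<subseteq> B'" "B' \<subseteq> S0 \<union> (R ` Q \<union> I ` Q)" "independent B'" "S0 \<union> (R ` Q \<union> I ` Q) \<subseteq> span B'"
    using maximal_independent_subset_extend[OF Un_upper1 ind] by metis
  have "S \<subseteq> span B'" unfolding S_def using B'(1) by (intro span_mono) (simp add: S0_def)
  then have "R ` (N \<union> Q) \<union> I ` (N \<union> Q) \<subseteq> span B'"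
    using inS B'(4) by auto
  then have "span B' = UNIV" using sp by (metis span_minimal subspace_span top.extremum_uniqueI)
  moreover have "R ` J \<union> I ` J \<union> (B' - S0) = B'" using B'(1) by (auto simp: S0_def)
  moreover have "B' - S0 \<subseteq> R ` Q \<union> I ` Q" "(B' - S0) \<inter> (R ` J \<union> I ` J) = {}"
    using B'(2) by (auto simp: S0_def)
  ultimately show ?thesis
    using B'(3) J(1) that[of J "B' - S0"] by (simp add: good_def)
qed

section \<open>Splitting a vector-valued function along coordinate subspaces\<close>

text \<open>
  The projection \<open>P j\<close> sets the coordinates belonging to \<open>j\<close> to zero. Indices are moved one by one from \<open>S\<close>
  to \<open>R\<close> by means of \<open>F = F \<circ> P s + (F - F \<circ> P s)\<close>: the first summand has no more need of \<open>a s\<close>, and the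
  second one vanishes where the coordinates of \<open>s\<close> do. When \<open>S\<close> is exhausted, \<open>F\<close> vanishes where the
  coordinates of any \<open>j \<in> R\<close> do, and so do all its coefficients.
\<close>

lemma coordinate_decomposition_aux:
  fixes F :: "'e::euclidean_space \<Rightarrow> 'v::euclidean_space" and a :: "'j \<Rightarrow> 'v"
    and P :: "'j \<Rightarrow> 'e \<Rightarrow> 'e"
  assumes W: "open W" and A: "finite A"
    and P: "\<And>j. bounded_linear (P j)" "\<And>j x. x \<in> W \<Longrightarrow> P j x \<in> W" "\<And>j x. P j (P j x) = P j x"
      "\<And>i j x. P i (P j x) = P j (P i x)"
    and "finite S" "finite R" "S \<inter> R = {}" "S \<inter> A = {}"
    and "smooth W F" "\<And>x. x \<in> W \<Longrightarrow> F x \<in> span (a ` ({j\<in>S. P j x \<noteq> x} \<union> R \<union> A))"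
      "\<And>x j. x \<in> W \<Longrightarrow> j \<in> R \<Longrightarrow> P j x = x \<Longrightarrow> F x = 0"
  shows "\<exists>c. (\<forall>j. smooth W (c j)) \<and> (\<forall>x\<in>W. \<forall>j\<in>S \<union> R. P j x = x \<longrightarrow> c j x = (0::real)) \<and>
    (\<forall>x\<in>W. F x = (\<Sum>j\<in>S \<union> R \<union> A. c j x *\<^sub>R a j))"
  using assms(7-)
proof (induction S arbitrary: R F)
  case empty
  obtain l :: "'j \<Rightarrow> 'v \<Rightarrow> real" where l: "\<And>j. linear (l j)"
    "\<And>v. v \<in> span (a ` (R \<union> A)) \<Longrightarrow> v = (\<Sum>j\<in>R \<union> A. l j v *\<^sub>R a j)"
    using linear_coefficients[of "R \<union> A" a] A empty.prems(1) by auto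
  show ?case
  proof (intro exI[of _ "\<lambda>j x. l j (F x)"] conjI allI ballI impI)
    show "smooth W (\<lambda>x. l j (F x))" for j
      by (rule smooth_linear[OF linear_conv_bounded_linear[THEN iffD1, OF l(1)] empty.prems(4) W])
    show "l j (F x) = 0" if "x \<in> W" "j \<in> {} \<union> R" "P j x = x" for x j
      using empty.prems(6)[OF that(1) _ that(3)] that(2) l(1)[of j] linear_0 by auto
    show "F x = (\<Sum>j\<in>{} \<union> R \<union> A. l j (F x) *\<^sub>R a j)" if "x \<in> W" for x
      using l(2)[of "F x"] empty.prems(5)[OF that] by simp
  qed
next
  case (insert s S)
  have sm: "smooth W (\<lambda>x. F (P s x))"
    by (rule smooth_compose[OF insert.prems(4) smooth_linear[OF P(1) smooth_id] W W]) (use W P(2) in auto)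
  have spP: "F (P s x) \<in> span (a ` ({j\<in>S. P j x \<noteq> x} \<union> R \<union> A))" if x: "x \<in> W" for x
  proof -
    have "{j\<in>insert s S. P j (P s x) \<noteq> P s x} \<subseteq> {j\<in>S. P j x \<noteq> x}"
    proof
      fix j assume j: "j \<in> {j\<in>insert s S. P j (P s x) \<noteq> P s x}"
      then have "j \<noteq> s" using P(3)[of s x] by auto
      moreover have "P j x \<noteq> x" using j P(4)[of j s x] by force
      ultimately show "j \<in> {j\<in>S. P j x \<noteq> x}" using j by simp
    qed
    then have "span (a ` ({j\<in>insert s S. P j (P s x) \<noteq> P s x} \<union> R \<union> A)) \<subseteq>
        span (a ` ({j\<in>S. P j x \<noteq> x} \<union> R \<union> A))"
      by (intro span_mono image_mono) blast
    then show ?thesis using insert.prems(5)[OF P(2)[OF x, of s]] by blast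
  qed
  have vP: "F (P s x) = 0" if "x \<in> W" "j \<in> R" "P j x = x" for x j
    using insert.prems(6)[OF P(2)[OF that(1), of s] that(2)] P(4)[of j s x] that(3) by simp
  have "\<exists>c. (\<forall>j. smooth W (c j)) \<and> (\<forall>x\<in>W. \<forall>j\<in>S \<union> R. P j x = x \<longrightarrow> c j x = (0::real)) \<and>
      (\<forall>x\<in>W. F (P s x) = (\<Sum>j\<in>S \<union> R \<union> A. c j x *\<^sub>R a j))"
    by (rule insert.IH[OF insert.prems(1) _ _ sm spP vP]) (use insert.prems in auto)
  then obtain c1 where c1: "\<And>j. smooth W (c1 j)"
      "\<And>x j. x \<in> W \<Longrightarrow> j \<in> S \<union> R \<Longrightarrow> P j x = x \<Longrightarrow> c1 j x = (0::real)"
      "\<And>x. x \<in> W \<Longrightarrow> F (P s x) = (\<Sum>j\<in>S \<union> R \<union> A. c1 j x *\<^sub>R a j)" by blast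
  have sm2: "smooth W (\<lambda>x. F x - F (P s x))"
    by (rule smooth_diff[OF insert.prems(4) sm W])
  have sp2: "F x - F (P s x) \<in> span (a ` ({j\<in>S. P j x \<noteq> x} \<union> insert s R \<union> A))" if x: "x \<in> W" for x
  proof (rule span_diff)
    have "span (a ` ({j\<in>insert s S. P j x \<noteq> x} \<union> R \<union> A)) \<subseteq> span (a ` ({j\<in>S. P j x \<noteq> x} \<union> insert s R \<union> A))"
      by (intro span_mono image_mono) blast
    then show "F x \<in> span (a ` ({j\<in>S. P j x \<noteq> x} \<union> insert s R \<union> A))"
      using insert.prems(5)[OF x] by blast
    have "span (a ` ({j\<in>S. P j x \<noteq> x} \<union> R \<union> A)) \<subseteq> span (a ` ({j\<in>S. P j x \<noteq> x} \<union> insert s R \<union> A))"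
      by (intro span_mono image_mono) blast
    then show "F (P s x) \<in> span (a ` ({j\<in>S. P j x \<noteq> x} \<union> insert s R \<union> A))"
      using spP[OF x] by blast
  qed
  have v2: "F x - F (P s x) = 0" if "x \<in> W" "j \<in> insert s R" "P j x = x" for x j
    using that insert.prems(6)[OF that(1) _ that(3)] vP[OF that(1) _ that(3)] by auto
  have "\<exists>c. (\<forall>j. smooth W (c j)) \<and> (\<forall>x\<in>W. \<forall>j\<in>S \<union> insert s R. P j x = x \<longrightarrow> c j x = (0::real)) \<and>
      (\<forall>x\<in>W. F x - F (P s x) = (\<Sum>j\<in>S \<union> insert s R \<union> A. c j x *\<^sub>R a j))"
    by (rule insert.IH[OF _ _ _ sm2 sp2 v2]) (use insert in auto)
  then obtain c2 where c2: "\<And>j. smooth W (c2 j)"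
      "\<And>x j. x \<in> W \<Longrightarrow> j \<in> S \<union> insert s R \<Longrightarrow> P j x = x \<Longrightarrow> c2 j x = (0::real)"
      "\<And>x. x \<in> W \<Longrightarrow> F x - F (P s x) = (\<Sum>j\<in>S \<union> insert s R \<union> A. c2 j x *\<^sub>R a j)" by blast
  define c where "c j x = (if j = s then 0 else c1 j x) + c2 j x" for j x
  show ?case
  proof (intro exI[of _ c] conjI allI ballI impI)
    show "smooth W (c j)" for j
      unfolding c_def by (cases "j = s") (simp_all add: c1(1) c2(1) smooth_add W smooth_const)
    show "c j x = 0" if "x \<in> W" "j \<in> insert s S \<union> R" "P j x = x" for x j
      using c1(2)[OF that(1) _ that(3)] c2(2)[OF that(1) _ that(3)] that(2) by (auto simp: c_def)
    fix x assume x: "x \<in> W"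
    have s: "s \<notin> S \<union> R \<union> A" using insert.hyps insert.prems by auto
    have fin: "finite (S \<union> R \<union> A)" using insert A by auto
    have U: "insert s S \<union> R \<union> A = insert s (S \<union> R \<union> A)" "S \<union> insert s R \<union> A = insert s (S \<union> R \<union> A)" by auto
    have "F x = (\<Sum>j\<in>S \<union> R \<union> A. c1 j x *\<^sub>R a j) + (\<Sum>j\<in>S \<union> insert s R \<union> A. c2 j x *\<^sub>R a j)"
      unfolding c1(3)[OF x, symmetric] c2(3)[OF x, symmetric] by simp
    also have "(\<Sum>j\<in>S \<union> R \<union> A. c1 j x *\<^sub>R a j) =
        (\<Sum>j\<in>insert s (S \<union> R \<union> A). (if j = s then 0 else c1 j x) *\<^sub>R a j)"
      using s fin by (auto intro!: sum.cong)
    finally show "F x = (\<Sum>j\<in>insert s S \<union> R \<union> A. c j x *\<^sub>R a j)"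
      unfolding U c_def scaleR_add_left sum.distrib .
  qed
qed

lemma coordinate_decomposition:
  fixes F :: "'e::euclidean_space \<Rightarrow> 'v::euclidean_space" and a :: "'j \<Rightarrow> 'v"
    and P :: "'j \<Rightarrow> 'e \<Rightarrow> 'e"
  assumes W: "open W" and fin: "finite J" "finite A" "J \<inter> A = {}"
    and P: "\<And>j. bounded_linear (P j)" "\<And>j x. x \<in> W \<Longrightarrow> P j x \<in> W" "\<And>j x. P j (P j x) = P j x"
      "\<And>i j x. P i (P j x) = P j (P i x)"
    and F: "smooth W F" "\<And>x. x \<in> W \<Longrightarrow> F x \<in> span (a ` ({j\<in>J. P j x \<noteq> x} \<union> A))"
  obtains c where "\<And>j. smooth W (c j)" "\<And>x j. x \<in> W \<Longrightarrow> j \<in> J \<Longrightarrow> P j x = x \<Longrightarrow> c j x = (0::real)"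
    "\<And>x. x \<in> W \<Longrightarrow> F x = (\<Sum>j\<in>J \<union> A. c j x *\<^sub>R a j)"
proof -
  have "\<exists>c. (\<forall>j. smooth W (c j)) \<and> (\<forall>x\<in>W. \<forall>j\<in>J \<union> {}. P j x = x \<longrightarrow> c j x = (0::real)) \<and>
    (\<forall>x\<in>W. F x = (\<Sum>j\<in>J \<union> {} \<union> A. c j x *\<^sub>R a j))"
    by (rule coordinate_decomposition_aux[OF W fin(2) P fin(1) _ _ fin(3) F(1)]) (use F(2) in auto)
  then show ?thesis using that by (simp only: Un_empty_right) blast
qed

section \<open>Smooth functions on a manifold with a torus action\<close>

text \<open>
  An eigenfunction of the action together with its weight.
\<close>

type_synonym ('m, 'k) eigenpair = "('m \<Rightarrow> complex) \<times> ((real, 'k) vec)"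

locale torus_manifold =
  fixes M :: "('m::{t2_space, second_countable_topology}, 'e::euclidean_space) manifold"
    and \<rho> :: "complex ^ 'k::finite \<Rightarrow> 'm \<Rightarrow> 'm"
  assumes manifold: "smooth_manifold M" and model: "model M = UNIV"
    and action: "smooth_torus_action M UNIV \<rho>"
begin

abbreviation flow :: "real ^ 'k \<Rightarrow> 'm \<Rightarrow> 'm" where
  "flow \<xi> \<equiv> \<rho> (torus_exp \<xi>)"

abbreviation inv_chart :: "'m set \<times> ('m \<Rightarrow> 'e) \<Rightarrow> 'e \<Rightarrow> 'm" where
  "inv_chart c \<equiv> inv_into (fst c) (snd c)"

lemma chart_atlas: "c \<in> atlas M \<Longrightarrow> chart UNIV c"
  using manifold model by (auto simp: smooth_manifold_def)

lemma chart_open: "c \<in> atlas M \<Longrightarrow> open (fst c)"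
  and chart_open_image: "c \<in> atlas M \<Longrightarrow> open (snd c ` fst c)"
  and chart_homeomorphism: "c \<in> atlas M \<Longrightarrow> homeomorphism (fst c) (snd c ` fst c) (snd c) (inv_chart c)"
  using chart_atlas by (fastforce simp: chart_def split_beta)+

lemma inv_chart [simp]: "c \<in> atlas M \<Longrightarrow> x \<in> fst c \<Longrightarrow> inv_chart c (snd c x) = x"
  using chart_homeomorphism by (auto simp: homeomorphism_def)

lemma chart_inv [simp]: "x \<in> snd c ` fst c \<Longrightarrow> snd c (inv_chart c x) = x"
  by (rule f_inv_into_f)

lemma inv_chart_in: "x \<in> snd c ` fst c \<Longrightarrow> inv_chart c x \<in> fst c"
  by (rule inv_into_into)

lemma chart_open_image_subset:
  assumes "c \<in> atlas M" "open N" "N \<subseteq> fst c"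
  shows "open (snd c ` N)"
proof -
  have "openin (top_of_set (fst c)) N" using assms by (auto intro: open_subset)
  then have "openin (top_of_set (snd c ` fst c)) (snd c ` N)"
    using homeomorphism_imp_open_map[OF chart_homeomorphism[OF assms(1)]] by blast
  then show ?thesis using chart_open_image[OF assms(1)] openin_open_trans by blast
qed

lemma continuous_on_chart: "c \<in> atlas M \<Longrightarrow> continuous_on (fst c) (snd c)"
  and continuous_on_inv_chart: "c \<in> atlas M \<Longrightarrow> continuous_on (snd c ` fst c) (inv_chart c)"
  using chart_homeomorphism by (auto simp: homeomorphism_def)

lemma chart_at: obtains c where "c \<in> atlas M" "m \<in> fst c"
proof -
  have "(\<Union>c\<in>atlas M. fst c) = UNIV" using manifold by (simp add: smooth_manifold_def)
  then show ?thesis using that by blast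
qed

lemma transition_smooth:
  assumes "c \<in> atlas M" "d \<in> atlas M"
  shows "smooth (snd c ` (fst c \<inter> fst d)) (snd d \<circ> inv_chart c)"
proof -
  have "\<forall>(U, \<phi>)\<in>atlas M. \<forall>(V, \<psi>)\<in>atlas M.
        smooth (\<phi> ` (U \<inter> V)) (\<psi> \<circ> inv_into U \<phi>)"
    using manifold unfolding smooth_manifold_def model by (elim conjE)
  then show ?thesis using assms by (fastforce simp: split_beta)
qed

text \<open>
  Besides real functions, complex eigenfunctions and the vector-valued moment map have to be treated.
\<close>

definition smooth_map :: "('m \<Rightarrow> 'b::real_normed_vector) \<Rightarrow> bool" where
  "smooth_map f \<longleftrightarrow> (\<forall>c\<in>atlas M. smooth (snd c ` fst c) (f \<circ> inv_chart c))"

lemma smooth_function_iff: "smooth_function M f \<longleftrightarrow> smooth_map f"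
  unfolding smooth_function_def smooth_map_def model by (auto simp: split_beta)

text \<open>
  One chart around each point suffices because the transition maps are smooth.
\<close>

lemma smooth_mapI_local:
  fixes f :: "'m \<Rightarrow> 'b::real_normed_vector"
  assumes "\<And>m. \<exists>c N. c \<in> atlas M \<and> open N \<and> m \<in> N \<and> N \<subseteq> fst c \<and> smooth (snd c ` N) (f \<circ> inv_chart c)"
  shows "smooth_map f"
  unfolding smooth_map_def
proof
  fix d assume d: "d \<in> atlas M"
  show "smooth (snd d ` fst d) (f \<circ> inv_chart d)"
  proof (rule smooth_local[OF chart_open_image[OF d]])
    fix y assume y: "y \<in> snd d ` fst d"
    define m where "m = inv_chart d y"
    have m: "m \<in> fst d" "snd d m = y" using y by (auto simp: m_def inv_chart_in)
    obtain c N where c: "c \<in> atlas M" and N: "open N" "m \<in> N" "N \<subseteq> fst c"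
      "smooth (snd c ` N) (f \<circ> inv_chart c)" using assms by blast
    define V where "V = snd d ` (fst d \<inter> N)"
    have oV: "open V" unfolding V_def
      using N chart_open[OF d] by (intro chart_open_image_subset[OF d]) auto
    have o2: "open (snd d ` (fst d \<inter> fst c))"
      using chart_open[OF c] chart_open[OF d] by (intro chart_open_image_subset[OF d]) auto
    have "smooth V (snd c \<circ> inv_chart d)"
      by (rule smooth_subset[OF transition_smooth[OF d c] o2 oV]) (use N in \<open>auto simp: V_def\<close>)
    then have "smooth V (\<lambda>x. (f \<circ> inv_chart c) ((snd c \<circ> inv_chart d) x))"
      by (rule smooth_compose[OF N(4) _ oV chart_open_image_subset[OF c N(1,3)]])
        (use d in \<open>auto simp: V_def\<close>)
    moreover have "(f \<circ> inv_chart c) ((snd c \<circ> inv_chart d) x) = (f \<circ> inv_chart d) x" if "x \<in> V" for x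
      using that c d N by (auto simp: V_def)
    ultimately have "smooth V (f \<circ> inv_chart d)"
      by (simp cong: smooth_cong)
    then show "\<exists>V. open V \<and> y \<in> V \<and> V \<subseteq> snd d ` fst d \<and> smooth V (f \<circ> inv_chart d)"
      using oV m N by (intro exI[of _ V]) (auto simp: V_def)
  qed
qed

lemma smooth_map_chart_subset:
  assumes "smooth_map f" "c \<in> atlas M" "open N" "N \<subseteq> fst c"
  shows "smooth (snd c ` N) (f \<circ> inv_chart c)"
  using assms smooth_subset[OF _ chart_open_image chart_open_image_subset, of c]
  by (metis image_mono smooth_map_def)

lemma smooth_map_local:
  fixes f :: "'m \<Rightarrow> 'b::real_normed_vector"
  assumes "\<And>m. \<exists>g N. open N \<and> m \<in> N \<and> smooth_map g \<and> (\<forall>x\<in>N. f x = g x)"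
  shows "smooth_map f"
proof (rule smooth_mapI_local)
  fix m
  obtain g N where g: "open N" "m \<in> N" "smooth_map g" "\<forall>x\<in>N. f x = g x" using assms by blast
  obtain c where c: "c \<in> atlas M" "m \<in> fst c" by (rule chart_at)
  have o: "open (N \<inter> fst c)" using g(1) chart_open[OF c(1)] by blast
  have "smooth (snd c ` (N \<inter> fst c)) (g \<circ> inv_chart c)"
    by (rule smooth_map_chart_subset[OF g(3) c(1) o]) simp
  moreover have "(g \<circ> inv_chart c) x = (f \<circ> inv_chart c) x" if "x \<in> snd c ` (N \<inter> fst c)" for x
    using that c g by auto
  ultimately have "smooth (snd c ` (N \<inter> fst c)) (f \<circ> inv_chart c)"
    by (simp cong: smooth_cong)
  then show "\<exists>c N. c \<in> atlas M \<and> open N \<and> m \<in> N \<and> N \<subseteq> fst c \<and> smooth (snd c ` N) (f \<circ> inv_chart c)"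
    using c g o by (intro exI[of _ c] exI[of _ "N \<inter> fst c"]) auto
qed

lemma smooth_map_continuous:
  assumes "smooth_map f"
  shows "continuous_on UNIV f"
proof (rule continuous_at_imp_continuous_on, rule ballI)
  fix m
  obtain c where c: "c \<in> atlas M" "m \<in> fst c" by (rule chart_at)
  have "continuous_on (snd c ` fst c) (f \<circ> inv_chart c)"
    using assms c by (intro smooth_continuous_on chart_open_image) (auto simp: smooth_map_def)
  then have "continuous_on (fst c) (\<lambda>x. (f \<circ> inv_chart c) (snd c x))"
    using continuous_on_chart[OF c(1)] by (rule continuous_on_compose2) auto
  then have "continuous_on (fst c) f"
    using c by (simp cong: continuous_on_cong)
  then show "isCont f m" using c chart_open by (simp add: continuous_on_eq_continuous_at)
qed

lemma smooth_map_const: "smooth_map (\<lambda>x. a)"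
  unfolding smooth_map_def o_def by (auto intro!: smooth_const chart_open_image)

lemma smooth_map_linear:
  assumes "bounded_linear L" "smooth_map f"
  shows "smooth_map (\<lambda>x. L (f x))"
  unfolding smooth_map_def o_def
proof
  fix c assume c: "c \<in> atlas M"
  then have "smooth (snd c ` fst c) (\<lambda>x. f (inv_chart c x))"
    using assms(2) by (simp add: smooth_map_def o_def)
  then show "smooth (snd c ` fst c) (\<lambda>x. L (f (inv_chart c x)))"
    by (rule smooth_linear[OF assms(1) _ chart_open_image[OF c]])
qed

lemma smooth_map_add: "smooth_map f \<Longrightarrow> smooth_map g \<Longrightarrow> smooth_map (\<lambda>x. f x + g x)"
  unfolding smooth_map_def o_def by (simp add: smooth_add chart_open_image)

lemma smooth_map_diff: "smooth_map f \<Longrightarrow> smooth_map g \<Longrightarrow> smooth_map (\<lambda>x. f x - g x)"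
  unfolding smooth_map_def o_def by (simp add: smooth_diff chart_open_image)

lemma smooth_map_bilinear:
  assumes "bounded_bilinear B" "smooth_map f" "smooth_map g"
  shows "smooth_map (\<lambda>x. B (f x) (g x))"
  unfolding smooth_map_def o_def
proof
  fix c assume c: "c \<in> atlas M"
  then have "smooth (snd c ` fst c) (\<lambda>x. f (inv_chart c x))"
    "smooth (snd c ` fst c) (\<lambda>x. g (inv_chart c x))"
    using assms(2,3) by (simp_all add: smooth_map_def o_def)
  then show "smooth (snd c ` fst c) (\<lambda>x. B (f (inv_chart c x)) (g (inv_chart c x)))"
    by (rule smooth_bilinear[OF assms(1) _ _ chart_open_image[OF c]])
qed

lemmas smooth_map_mult = smooth_map_bilinear[OF bounded_bilinear_mult]
lemmas smooth_map_Re = smooth_map_linear[OF bounded_linear_Re]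
lemmas smooth_map_Im = smooth_map_linear[OF bounded_linear_Im]
lemmas smooth_map_of_real =
  smooth_map_linear[OF bounded_linear_of_real[where ?'a = complex]]

lemma smooth_map_sum:
  "(\<And>i. i \<in> I \<Longrightarrow> smooth_map (f i)) \<Longrightarrow> smooth_map (\<lambda>x. \<Sum>i\<in>I. f i x)"
  by (induction I rule: infinite_finite_induct) (auto intro: smooth_map_add smooth_map_const)

lemma smooth_map_prod:
  fixes f :: "'i \<Rightarrow> 'm \<Rightarrow> real"
  shows "(\<And>i. i \<in> I \<Longrightarrow> smooth_map (f i)) \<Longrightarrow> smooth_map (\<lambda>x. \<Prod>i\<in>I. f i x)"
  by (induction I rule: infinite_finite_induct) (auto intro: smooth_map_mult smooth_map_const)

lemma smooth_map_real_compose: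
  fixes f :: "'m \<Rightarrow> real"
  assumes "smooth UNIV g" "smooth_map f"
  shows "smooth_map (\<lambda>x. g (f x))"
  unfolding smooth_map_def o_def
proof
  fix c assume c: "c \<in> atlas M"
  then have "smooth (snd c ` fst c) (\<lambda>x. f (inv_chart c x))"
    using assms(2) by (simp add: smooth_map_def o_def)
  then show "smooth (snd c ` fst c) (\<lambda>x. g (f (inv_chart c x)))"
    by (rule smooth_compose[OF assms(1) _ chart_open_image[OF c]]) auto
qed

lemma smooth_map_inverse:
  fixes f :: "'m \<Rightarrow> real"
  assumes "smooth_map f" "\<And>x. f x \<noteq> 0"
  shows "smooth_map (\<lambda>x. inverse (f x))"
  using assms unfolding smooth_map_def o_def
  by (simp add: smooth_inverse_real chart_open_image)

subsection \<open>Bump functions\<close>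

text \<open>
  A bump function here is positive on a ball and zero outside, but not constant near the centre. That is
  enough, since local identities are only ever multiplied by it.
\<close>

definition bump :: "'e \<Rightarrow> real \<Rightarrow> 'e \<Rightarrow> real" where
  "bump x0 r x = flat 0 (r\<^sup>2 - (x - x0) \<bullet> (x - x0))"

lemma smooth_bump: "smooth UNIV (bump x0 r)"
  unfolding bump_def
  by (rule smooth_compose[OF smooth_flat]; (intro smooth_rules open_UNIV)?) simp

lemma bump_nonneg: "bump x0 r x \<ge> 0"
  by (simp add: bump_def flat_def)

lemma bump_center: "r > 0 \<Longrightarrow> bump x0 r x0 > 0"
  by (simp add: bump_def flat_def)

lemma bump_outside: "r > 0 \<Longrightarrow> x \<notin> cball x0 r \<Longrightarrow> bump x0 r x = 0"
  by (auto simp: bump_def flat_def dist_norm norm_minus_commute dot_square_norm power_mono)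

definition extend_by_bump ::
  "'m set \<times> ('m \<Rightarrow> 'e) \<Rightarrow> 'e \<Rightarrow> real \<Rightarrow> ('e \<Rightarrow> 'b::real_normed_vector) \<Rightarrow> 'm \<Rightarrow> 'b" where
  "extend_by_bump c x0 r q m =
     (if m \<in> fst c \<and> snd c m \<in> cball x0 r then bump x0 r (snd c m) *\<^sub>R q (snd c m) else 0)"

text \<open>
  The set where the extension is defined by the chart contains the preimage of a compact ball. This is
  compact and hence closed, because the manifold is Hausdorff, and the extension is zero off it.
\<close>

lemma smooth_extend_by_bump:
  fixes q :: "'e \<Rightarrow> 'b::real_normed_vector"
  assumes c: "c \<in> atlas M" and W: "open W" "W \<subseteq> snd c ` fst c" and q: "smooth W q"
    and r: "r > 0" "cball x0 r \<subseteq> W"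
  shows "smooth_map (extend_by_bump c x0 r q)"
proof (rule smooth_mapI_local)
  fix m
  define C where "C = inv_chart c ` cball x0 r"
  have C: "closed C" unfolding C_def
    by (intro compact_imp_closed compact_continuous_image continuous_on_subset[OF continuous_on_inv_chart[OF c]])
      (use r W in auto)
  have Cc: "C \<subseteq> fst c" unfolding C_def using r W by (intro image_subsetI inv_chart_in) blast
  have CI: "x \<in> C" if "x \<in> fst c" "snd c x \<in> cball x0 r" for x
    using that c unfolding C_def by (metis image_eqI inv_chart)
  show "\<exists>d N. d \<in> atlas M \<and> open N \<and> m \<in> N \<and> N \<subseteq> fst d \<and>
      smooth (snd d ` N) (extend_by_bump c x0 r q \<circ> inv_chart d)"
  proof (cases "m \<in> C")
    case True
    define N where "N = inv_chart c ` W"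
    have "homeomorphism (snd c ` fst c) (fst c) (inv_chart c) (snd c)"
      using chart_homeomorphism[OF c] homeomorphism_symD by blast
    moreover have "openin (top_of_set (snd c ` fst c)) W"
      using W by (auto intro: open_subset)
    ultimately have "openin (top_of_set (fst c)) N"
      unfolding N_def using homeomorphism_imp_open_map by blast
    then have oN: "open N" using chart_open[OF c] openin_open_trans by blast
    have Nc: "N \<subseteq> fst c" unfolding N_def using W by (intro image_subsetI inv_chart_in) blast
    have cN: "snd c ` N = W" using W(2) by (force simp: N_def image_iff subset_iff)
    have "smooth W (\<lambda>x. bump x0 r x *\<^sub>R q x)"
      by (intro smooth_rules q W smooth_subset[OF smooth_bump]) auto
    moreover have "bump x0 r x *\<^sub>R q x = (extend_by_bump c x0 r q \<circ> inv_chart c) x" if "x \<in> W" for x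
    proof -
      have "x \<in> snd c ` fst c" using that W by blast
      then show ?thesis
        using bump_outside[OF r(1), of x x0] by (auto simp: extend_by_bump_def inv_chart_in)
    qed
    ultimately have "smooth (snd c ` N) (extend_by_bump c x0 r q \<circ> inv_chart c)"
      unfolding cN by (simp cong: smooth_cong)
    moreover have "m \<in> N" using True r by (auto simp: C_def N_def)
    ultimately show ?thesis using c oN Nc by (intro exI[of _ c] exI[of _ N] conjI)
  next
    case False
    obtain d where d: "d \<in> atlas M" "m \<in> fst d" by (rule chart_at)
    define N where "N = fst d - C"
    have N: "open N" "N \<subseteq> fst d" "m \<in> N" using C chart_open[OF d(1)] d False by (auto simp: N_def)
    have "smooth (snd d ` N) (\<lambda>x. 0 :: 'b)"
      by (intro smooth_const chart_open_image_subset[OF d(1)] N)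
    moreover have "0 = (extend_by_bump c x0 r q \<circ> inv_chart d) x" if "x \<in> snd d ` N" for x
      using that d CI by (auto simp: extend_by_bump_def N_def)
    ultimately have "smooth (snd d ` N) (extend_by_bump c x0 r q \<circ> inv_chart d)"
      by (simp cong: smooth_cong)
    then show ?thesis using d N by (intro exI[of _ d] exI[of _ N] conjI)
  qed
qed

lemma small_ball:
  assumes "open W" "x \<in> W"
  obtains r where "r > 0" "cball x r \<subseteq> (W :: 'e set)"
  using assms open_contains_cball by blast

lemma smooth_maps_separate:
  assumes "m \<noteq> m'"
  obtains f :: "'m \<Rightarrow> real" where "smooth_map f" "f m \<noteq> f m'"
proof -
  obtain c where c: "c \<in> atlas M" "m \<in> fst c" by (rule chart_at)
  define W where "W = snd c ` (fst c - {m'})"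
  have W: "open W" "W \<subseteq> snd c ` fst c" "snd c m \<in> W"
    unfolding W_def using c assms chart_open[OF c(1)]
    by (auto intro!: chart_open_image_subset[OF c(1)])
  obtain r where r: "r > 0" "cball (snd c m) r \<subseteq> W" by (rule small_ball[OF W(1,3)])
  define f where "f = extend_by_bump c (snd c m) r (\<lambda>x. 1 :: real)"
  have "smooth_map f"
    unfolding f_def by (rule smooth_extend_by_bump[OF c(1) W(1,2) _ r]) (intro smooth_const W)
  moreover have "f m \<noteq> 0"
    using c r bump_center[OF r(1), of "snd c m"] by (simp add: f_def extend_by_bump_def)
  moreover have "f m' = 0"
  proof -
    have "snd c m' \<notin> W" if "m' \<in> fst c"
    proof
      assume "snd c m' \<in> W"
      then obtain y where "y \<in> fst c" "y \<noteq> m'" "snd c m' = snd c y" by (auto simp: W_def)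
      then show False using inv_chart[OF c(1), of y] inv_chart[OF c(1) that] by simp
    qed
    then show ?thesis using r by (auto simp: f_def extend_by_bump_def)
  qed
  ultimately show ?thesis using that by metis
qed

section \<open>The flow of the torus\<close>

lemma flow_0 [simp]: "flow 0 m = m"
  and flow_add: "flow (\<xi> + \<eta>) m = flow \<xi> (flow \<eta> m)"
proof -
  interpret A: group_action "torus UNIV" UNIV \<rho>
    using action by (simp add: smooth_torus_action_def)
  have "\<one>\<^bsub>torus UNIV\<^esub> = torus_exp (0 :: real ^ 'k)"
    by (simp add: torus_def torus_exp_def vec_eq_iff)
  then show "flow 0 m = m" using A.id_eq_one by (metis UNIV_I restrict_apply')
  have "torus_exp (\<xi> + \<eta>) = torus_exp \<xi> \<otimes>\<^bsub>torus UNIV\<^esub> torus_exp \<eta>"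
    by (simp add: torus_def torus_exp_add)
  then show "flow (\<xi> + \<eta>) m = flow \<xi> (flow \<eta> m)"
    using A.composition_rule[of m "torus_exp \<xi>" "torus_exp \<eta>"] by (simp add: torus_def)
qed

lemma flow_periodic: "flow (\<xi> + axis j (of_int n)) = flow \<xi>"
  by (simp add: torus_exp_periodic)

lemma continuous_flow: "continuous_on UNIV (\<lambda>p. flow (fst p) (snd p))"
  using action by (simp add: smooth_torus_action_def split_beta)

lemma continuous_flow_param: "continuous_on S (\<lambda>\<xi>. flow \<xi> m)"
  by (rule continuous_on_compose2[OF continuous_flow, of _ "\<lambda>\<xi>. (\<xi>, m)", simplified])
    (intro continuous_intros)

abbreviation lifted_flow :: "'m set \<times> ('m \<Rightarrow> 'e) \<Rightarrow> (real ^ 'k) \<times> 'e \<Rightarrow> 'm" where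
  "lifted_flow c \<equiv> \<lambda>p. flow (fst p) (inv_chart c (snd p))"

abbreviation lifted_dom :: "'m set \<times> ('m \<Rightarrow> 'e) \<Rightarrow> ((real ^ 'k) \<times> 'e) set" where
  "lifted_dom c \<equiv> UNIV \<times> snd c ` fst c"

lemma open_lifted_dom: "c \<in> atlas M \<Longrightarrow> open (lifted_dom c)"
  by (intro open_Times open_UNIV chart_open_image)

lemma continuous_lifted_flow:
  assumes c: "c \<in> atlas M"
  shows "continuous_on (lifted_dom c) (lifted_flow c)"
proof (rule continuous_on_compose2[OF continuous_flow, of _ "\<lambda>p. (fst p, inv_chart c (snd p))", simplified])
  show "continuous_on (lifted_dom c) (\<lambda>p. (fst p, inv_chart c (snd p)))"
    by (intro continuous_intros continuous_on_compose2[OF continuous_on_inv_chart[OF c]]) auto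
qed

lemma smooth_lifted_flow:
  assumes c: "c \<in> atlas M" and d: "d \<in> atlas M"
  shows "smooth (lifted_dom c \<inter> lifted_flow c -` fst d) (\<lambda>p. snd d (lifted_flow c p))"
proof -
  have "\<forall>(U, \<phi>)\<in>atlas M. \<forall>(V, \<psi>)\<in>atlas M.
        smooth_on (UNIV \<times> UNIV)
          {(\<xi>, x). \<xi> \<in> UNIV \<and> x \<in> \<phi> ` U \<and> flow \<xi> (inv_into U \<phi> x) \<in> V}
          (\<lambda>(\<xi>, x). \<psi> (flow \<xi> (inv_into U \<phi> x)))"
    using action unfolding smooth_torus_action_def model by (elim conjE)
  from bspec[OF bspec[OF this c, unfolded split_beta] d]
  have "smooth_on (UNIV \<times> UNIV)
          {p. fst p \<in> UNIV \<and> snd p \<in> snd c ` fst c \<and> lifted_flow c p \<in> fst d}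
          (\<lambda>p. snd d (lifted_flow c p))"
    by (simp only: split_beta)
  moreover have "{p. fst p \<in> UNIV \<and> snd p \<in> snd c ` fst c \<and> lifted_flow c p \<in> fst d}
      = lifted_dom c \<inter> lifted_flow c -` fst d" by auto
  ultimately show ?thesis by simp
qed

lemma open_lifted_flow_vimage:
  assumes "c \<in> atlas M" "open S"
  shows "open (lifted_dom c \<inter> lifted_flow c -` S)"
  by (rule continuous_open_preimage[OF continuous_lifted_flow[OF assms(1)] open_lifted_dom[OF assms(1)] assms(2)])

text \<open>
  The smoothness of the action is given in pairs of charts. For real or vector-valued functions the
  chart on the target disappears by composition.
\<close>

lemma smooth_map_lifted_flow:
  fixes f :: "'m \<Rightarrow> 'b::real_normed_vector"
  assumes c: "c \<in> atlas M" and f: "smooth_map f"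
  shows "smooth (lifted_dom c) (\<lambda>p. f (lifted_flow c p))"
proof (rule smooth_local[OF open_lifted_dom[OF c]])
  fix p assume p: "p \<in> lifted_dom c"
  obtain d where d: "d \<in> atlas M" "lifted_flow c p \<in> fst d" by (rule chart_at)
  define V where "V = lifted_dom c \<inter> lifted_flow c -` fst d"
  have oV: "open V" unfolding V_def by (rule open_lifted_flow_vimage[OF c chart_open[OF d(1)]])
  have "smooth V (\<lambda>p. (f \<circ> inv_chart d) (snd d (lifted_flow c p)))"
    by (rule smooth_compose[OF f[unfolded smooth_map_def, rule_format, OF d(1)]
          smooth_lifted_flow[OF c d(1), folded V_def] oV chart_open_image[OF d(1)]])
      (auto simp: V_def)
  moreover have "(f \<circ> inv_chart d) (snd d (lifted_flow c p)) = f (lifted_flow c p)" if "p \<in> V" for p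
    using that d(1) by (simp add: V_def)
  ultimately have "smooth V (\<lambda>p. f (lifted_flow c p))" by (simp cong: smooth_cong)
  moreover have "p \<in> V" using p d by (simp add: V_def)
  ultimately show "\<exists>V. open V \<and> p \<in> V \<and> V \<subseteq> lifted_dom c \<and> smooth V (\<lambda>p. f (lifted_flow c p))"
    using oV by (intro exI[of _ V]) (simp add: V_def)
qed

lemma smooth_lifted_flow_fixed:
  fixes f :: "'m \<Rightarrow> 'b::real_normed_vector"
  assumes c: "c \<in> atlas M" and f: "smooth_map f"
  shows "smooth (snd c ` fst c) (\<lambda>x. f (flow \<xi> (inv_chart c x)))"
  using smooth_compose[OF smooth_map_lifted_flow[OF c f] smooth_Pair[OF smooth_const smooth_id], of "snd c ` fst c" \<xi>]
    chart_open_image[OF c] open_lifted_dom[OF c] by auto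

lemma smooth_map_flow:
  fixes f :: "'m \<Rightarrow> 'b::real_normed_vector"
  shows "smooth_map f \<Longrightarrow> smooth_map (\<lambda>m. f (flow \<xi> m))"
  using smooth_lifted_flow_fixed[of _ f \<xi>] by (simp add: smooth_map_def o_def)

subsection \<open>Gradients and velocities in a chart\<close>

text \<open>
  The differential of a function in a chart, represented as a vector so that the linear algebra of
  Euclidean spaces applies to it.
\<close>

definition grad :: "'m set \<times> ('m \<Rightarrow> 'e) \<Rightarrow> 'm \<Rightarrow> ('m \<Rightarrow> real) \<Rightarrow> 'e" where
  "grad c m f = (\<Sum>b\<in>Basis. frechet_derivative (f \<circ> inv_chart c) (at (snd c m)) b *\<^sub>R b)"

lemma grad_unique:
  assumes "((f \<circ> inv_chart c) has_derivative (\<lambda>v. v \<bullet> w)) (at (snd c m))"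
  shows "grad c m f = w"
proof -
  have "frechet_derivative (f \<circ> inv_chart c) (at (snd c m)) = (\<lambda>v. v \<bullet> w)"
    using frechet_derivative_at[OF assms] by simp
  then show ?thesis
    unfolding grad_def by (simp add: inner_commute[of _ w] euclidean_representation)
qed

lemma has_derivative_grad:
  assumes f: "smooth_map f" and c: "c \<in> atlas M" "m \<in> fst c"
  shows "((f \<circ> inv_chart c) has_derivative (\<lambda>v. v \<bullet> grad c m f)) (at (snd c m))"
proof -
  have "smooth (snd c ` fst c) (f \<circ> inv_chart c)" using f c by (simp add: smooth_map_def)
  then obtain D where D: "\<And>x. x \<in> snd c ` fst c \<Longrightarrow> ((f \<circ> inv_chart c) has_derivative D x) (at x)"
    by (rule smooth_derivE[OF _ chart_open_image[OF c(1)]]; blast)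
  let ?D = "D (snd c m)"
  have d: "((f \<circ> inv_chart c) has_derivative ?D) (at (snd c m))" using D c by blast
  have "?D v = v \<bullet> (\<Sum>b\<in>Basis. ?D b *\<^sub>R b)" for v
    using linear_eq_sum_Basis[OF has_derivative_linear[OF d], of v]
    by (simp add: inner_sum_right mult.commute)
  then have "?D = (\<lambda>v. v \<bullet> (\<Sum>b\<in>Basis. ?D b *\<^sub>R b))" by blast
  then have "((f \<circ> inv_chart c) has_derivative (\<lambda>v. v \<bullet> (\<Sum>b\<in>Basis. ?D b *\<^sub>R b))) (at (snd c m))"
    using d by simp
  then show ?thesis using grad_unique by simp
qed

text \<open>
  The value of \<open>\<xi>\<^sub>M\<close> is the directional derivative along the velocity of the orbit in the chart, and the
  velocity is linear in \<open>\<xi>\<close> because it is the derivative of \<open>\<xi> \<mapsto> exp \<xi> \<cdot> m\<close> at \<open>0\<close>.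
\<close>

lemma generating_field_velocity:
  assumes c: "c \<in> atlas M" "m \<in> fst c"
  obtains L where "linear L"
    "\<And>f \<xi>. smooth_map f \<Longrightarrow> ((\<lambda>t. f (flow (t *\<^sub>R \<xi>) m)) has_real_derivative L \<xi> \<bullet> grad c m f) (at 0)"
    "\<And>f \<xi>. smooth_map f \<Longrightarrow> generating_field M \<rho> \<xi> m f = L \<xi> \<bullet> grad c m f"
proof -
  define V where "V = lifted_dom c \<inter> lifted_flow c -` fst c"
  have oV: "open V" unfolding V_def by (rule open_lifted_flow_vimage[OF c(1) chart_open[OF c(1)]])
  have p: "(0, snd c m) \<in> V" using c by (simp add: V_def)
  define G where "G \<xi> = snd c (flow \<xi> m)" for \<xi>
  define N where "N = (\<lambda>\<xi>. flow \<xi> m) -` fst c"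
  have oN: "open N" unfolding N_def
    by (rule open_vimage[OF chart_open[OF c(1)] continuous_flow_param])
  have N0: "0 \<in> N" using c by (simp add: N_def)
  have "smooth N (\<lambda>\<xi>. snd c (lifted_flow c (\<xi>, snd c m)))"
    by (rule smooth_compose[OF smooth_lifted_flow[OF c(1) c(1), folded V_def]])
      (use oN oV c in \<open>auto simp: V_def N_def intro!: smooth_Pair smooth_const smooth_id\<close>)
  then have "smooth N G" using c by (simp add: G_def[abs_def])
  then obtain L' where "\<And>x. x \<in> N \<Longrightarrow> (G has_derivative L' x) (at x)"
    by (rule smooth_derivE[OF _ oN]; blast)
  then have L: "(G has_derivative L' 0) (at 0)" using N0 by blast
  have der: "((\<lambda>t. f (flow (t *\<^sub>R \<xi>) m)) has_real_derivative L' 0 \<xi> \<bullet> grad c m f) (at 0)"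
    if f: "smooth_map f" for f \<xi>
  proof -
    have G0: "G 0 = snd c m" by (simp add: G_def)
    have "((f \<circ> inv_chart c) has_derivative (\<lambda>v. v \<bullet> grad c m f)) (at (G 0))"
      unfolding G0 by (rule has_derivative_grad[OF f c])
    from has_derivative_compose[OF L this]
    have "((\<lambda>\<xi>. (f \<circ> inv_chart c) (G \<xi>)) has_derivative (\<lambda>\<xi>. L' 0 \<xi> \<bullet> grad c m f)) (at 0)" .
    then have 1: "((\<lambda>\<xi>. f (flow \<xi> m)) has_derivative (\<lambda>\<xi>. L' 0 \<xi> \<bullet> grad c m f)) (at (0 *\<^sub>R \<xi>))"
      by (simp, elim has_derivative_transform_within_open[OF _ oN N0])
        (use c in \<open>simp add: N_def G_def\<close>)
    have "((\<lambda>t. t *\<^sub>R \<xi>) has_derivative (\<lambda>t. t *\<^sub>R \<xi>)) (at 0)"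
      by (auto intro!: derivative_eq_intros)
    from has_derivative_compose[OF this 1]
    show ?thesis
      using has_derivative_linear[OF L] by (simp add: has_field_derivative_def linear_scale mult.commute fun_eq_iff)
        (simp add: mult_commute_abs)
  qed
  show ?thesis
  proof (rule that[of "L' 0"])
    show "linear (L' 0)" using L has_derivative_linear by blast
    show "generating_field M \<rho> \<xi> m f = L' 0 \<xi> \<bullet> grad c m f" if "smooth_map f" for f \<xi>
      using DERIV_imp_deriv[OF der[OF that]] that by (simp add: generating_field_def smooth_function_iff)
  qed (rule der)
qed

text \<open>
  The derivative of a smooth function \<open>f\<close> along the orbit at time \<open>s\<close> is the derivative at time \<open>0\<close> of the
  smooth function \<open>f \<circ> flow (s \<xi>)\<close>, hence zero. So all smooth functions are constant along the orbit, and
  they separate points.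
\<close>

lemma generating_field_0_imp_fixed:
  assumes "generating_field M \<rho> \<xi> m = (\<lambda>f. 0)"
  shows "flow (t *\<^sub>R \<xi>) m = m"
proof (rule ccontr)
  assume "flow (t *\<^sub>R \<xi>) m \<noteq> m"
  then obtain f :: "'m \<Rightarrow> real" where f: "smooth_map f" "f (flow (t *\<^sub>R \<xi>) m) \<noteq> f m"
    by (rule smooth_maps_separate)
  obtain c where c: "c \<in> atlas M" "m \<in> fst c" by (rule chart_at)
  obtain L where L: "\<And>f \<xi>. smooth_map f \<Longrightarrow> ((\<lambda>t. f (flow (t *\<^sub>R \<xi>) m)) has_real_derivative L \<xi> \<bullet> grad c m f) (at 0)"
    "\<And>f \<xi>. smooth_map f \<Longrightarrow> generating_field M \<rho> \<xi> m f = L \<xi> \<bullet> grad c m f"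
    using generating_field_velocity[OF c] by metis
  have "((\<lambda>t. f (flow (t *\<^sub>R \<xi>) m)) has_real_derivative 0) (at s)" for s
  proof -
    have g: "smooth_map (\<lambda>m. f (flow (s *\<^sub>R \<xi>) m))" by (rule smooth_map_flow[OF f(1)])
    have "((\<lambda>t. f (flow (s *\<^sub>R \<xi>) (flow (t *\<^sub>R \<xi>) m))) has_real_derivative 0) (at 0)"
      using L(1)[OF g, of \<xi>] L(2)[OF g, of \<xi>] assms by simp
    then have "((\<lambda>t. f (flow ((t + s) *\<^sub>R \<xi>) m)) has_real_derivative 0) (at 0)"
      by (simp add: scaleR_add_left add.commute flow_add[symmetric])
    then show ?thesis using DERIV_shift[of "\<lambda>t. f (flow (t *\<^sub>R \<xi>) m)" 0 0 s] by simp
  qed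
  from DERIV_isconst_all[of "\<lambda>t. f (flow (t *\<^sub>R \<xi>) m)" t 0] this have "f (flow (t *\<^sub>R \<xi>) m) = f m" by simp
  with f(2) show False by simp
qed

lemma subspace_inf_stabilizer: "subspace (inf_stabilizer M UNIV \<rho> m)"
proof -
  obtain c where c: "c \<in> atlas M" "m \<in> fst c" by (rule chart_at)
  obtain L where L: "linear L" "\<And>f \<xi>. smooth_map f \<Longrightarrow> generating_field M \<rho> \<xi> m f = L \<xi> \<bullet> grad c m f"
    using generating_field_velocity[OF c] by metis
  have "generating_field M \<rho> \<xi> m = (\<lambda>f. 0) \<longleftrightarrow> (\<forall>f. smooth_map f \<longrightarrow> L \<xi> \<bullet> grad c m f = 0)" for \<xi>
  proof
    assume "generating_field M \<rho> \<xi> m = (\<lambda>f. 0)"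
    then show "\<forall>f. smooth_map f \<longrightarrow> L \<xi> \<bullet> grad c m f = 0" using L(2)[of _ \<xi>] by simp
  next
    assume 0: "\<forall>f. smooth_map f \<longrightarrow> L \<xi> \<bullet> grad c m f = 0"
    show "generating_field M \<rho> \<xi> m = (\<lambda>f. 0)"
    proof
      fix f
      show "generating_field M \<rho> \<xi> m f = 0"
        using L(2)[of f \<xi>] 0
        by (cases "smooth_map f") (simp, simp add: generating_field_def smooth_function_iff)
    qed
  qed
  then show ?thesis
    using L(1) by (auto simp: inf_stabilizer_def subspace_def linear_0 linear_add linear_scale inner_add_left)
qed

section \<open>Fourier components of smooth functions\<close>

definition equivariant :: "('m \<Rightarrow> complex) \<Rightarrow> real ^ 'k \<Rightarrow> bool" where
  "equivariant z \<alpha> \<longleftrightarrow> smooth_map z \<and> weight \<alpha> \<and> (\<forall>\<xi> m. z (flow \<xi> m) = character \<alpha> \<xi> * z m)"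

definition fourier :: "real ^ 'k \<Rightarrow> ('m \<Rightarrow> complex) \<Rightarrow> 'm \<Rightarrow> complex" where
  "fourier \<alpha> z m = integral cube (\<lambda>\<xi>. z (flow \<xi> m) * character (- \<alpha>) \<xi>)"

lemma continuous_fourier_integrand:
  assumes "smooth_map z"
  shows "continuous_on S (\<lambda>\<xi>. z (flow \<xi> m) * character \<alpha> \<xi>)"
  by (intro continuous_on_mult continuous_on_character
      continuous_on_compose2[OF smooth_map_continuous[OF assms] continuous_flow_param]) simp

lemma smooth_fourier_integrand:
  assumes c: "c \<in> atlas M" and z: "smooth_map z"
  shows "smooth (lifted_dom c) (\<lambda>p. z (lifted_flow c p) * character \<alpha> (fst p))"
proof -
  have "smooth (lifted_dom c) (\<lambda>p. character \<alpha> (fst p))"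
    by (rule smooth_compose[OF smooth_character smooth_fst]) (use open_lifted_dom[OF c] in auto)
  then show ?thesis
    by (rule smooth_bilinear[OF bounded_bilinear_mult smooth_map_lifted_flow[OF c z] _ open_lifted_dom[OF c]])
qed

lemma fourier_in_chart:
  "fourier \<alpha> z \<circ> inv_chart c =
    (\<lambda>x. integral cube (\<lambda>\<xi>. (\<lambda>p. z (lifted_flow c p) * character (- \<alpha>) (fst p)) (\<xi>, x)))"
  by (simp add: fourier_def fun_eq_iff)

lemma smooth_fourier:
  assumes z: "smooth_map z"
  shows "smooth_map (fourier \<alpha> z)"
  unfolding smooth_map_def fourier_in_chart
proof
  fix c assume c: "c \<in> atlas M"
  show "smooth (snd c ` fst c)
      (\<lambda>x. integral cube (\<lambda>\<xi>. (\<lambda>p. z (lifted_flow c p) * character (- \<alpha>) (fst p)) (\<xi>, x)))"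
    by (rule smooth_integral_param[OF chart_open_image[OF c] open_lifted_dom[OF c] _ smooth_fourier_integrand[OF c z]])
      auto
qed

text \<open>
  Translation invariance of the integral over the torus.
\<close>

lemma equivariant_fourier:
  assumes z: "smooth_map z" and w: "weight \<alpha>"
  shows "equivariant (fourier \<alpha> z) \<alpha>"
proof -
  have "fourier \<alpha> z (flow \<eta> m) = character \<alpha> \<eta> * fourier \<alpha> z m" for \<eta> m
  proof -
    define f where "f \<xi> = z (flow \<xi> m) * character (- \<alpha>) \<xi>" for \<xi>
    have w': "weight (- \<alpha>)" using w by (simp add: weight_def)
    have "fourier \<alpha> z (flow \<eta> m) = integral cube (\<lambda>\<xi>. character \<alpha> \<eta> * f (\<xi> + \<eta>))"
      unfolding fourier_def
    proof (rule integral_cong)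
      fix \<xi>
      show "z (flow \<xi> (flow \<eta> m)) * character (- \<alpha>) \<xi> = character \<alpha> \<eta> * f (\<xi> + \<eta>)"
        using character_minus[of \<alpha> \<eta>] by (simp add: f_def flow_add[symmetric] character_add mult_ac)
    qed
    also have "\<dots> = character \<alpha> \<eta> * integral cube (\<lambda>\<xi>. f (\<xi> + \<eta>))"
      by (rule integral_mult_right)
    also have "integral cube (\<lambda>\<xi>. f (\<xi> + \<eta>)) = integral cube f"
      by (rule integral_cube_shift)
        (auto simp: f_def flow_periodic character_periodic[OF w'] intro: continuous_fourier_integrand[OF z])
    finally show ?thesis by (simp add: fourier_def f_def[abs_def])
  qed
  then show ?thesis using smooth_fourier[OF z] w by (simp add: equivariant_def)
qed

text \<open>
  Along an orbit the eigenfunction \<open>y\<close> is a constant times a character, so it leaves the integral.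
\<close>

lemma fourier_mult_equivariant:
  assumes "equivariant y \<beta>"
  shows "fourier (\<alpha> + \<beta>) (\<lambda>m. z m * y m) m = fourier \<alpha> z m * y m"
proof -
  have "z (flow \<xi> m) * y (flow \<xi> m) * character (- (\<alpha> + \<beta>)) \<xi> = z (flow \<xi> m) * character (- \<alpha>) \<xi> * y m" for \<xi>
  proof -
    have "character (- (\<alpha> + \<beta>)) \<xi> = character (- \<alpha>) \<xi> * character (- \<beta>) \<xi>"
      using character_add_weight[of "-\<alpha>" "-\<beta>" \<xi>] by simp
    then show ?thesis using assms character_minus[of \<beta> \<xi>] by (simp add: equivariant_def mult_ac)
  qed
  then show ?thesis by (simp only: fourier_def integral_mult_left)
qed

text \<open>
  Suppose that \<open>v\<close> is orthogonal to all these gradients. For a smooth function \<open>f\<close>, the derivatives in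
  direction \<open>v\<close> of the translates of \<open>f\<close> form a continuous function on the torus. Its Fourier coefficients
  are the derivatives of the Fourier components of \<open>f\<close>, and so they are zero. Hence the derivative of every
  smooth \<open>f\<close> in direction \<open>v\<close> is zero, which is false for a linear coordinate times a bump function.
\<close>

lemma span_grad_equivariant:
  assumes c: "c \<in> atlas M" "m \<in> fst c"
  shows "span {g. \<exists>z \<alpha>. equivariant z \<alpha> \<and>
      (g = grad c m (\<lambda>x. Re (z x)) \<or> g = grad c m (\<lambda>x. Im (z x)))} = UNIV" (is "span ?S = _")
proof (rule ccontr)
  assume "span ?S \<noteq> UNIV"
  from span_not_UNIV_orthogonal[OF this] obtain v where v0: "v \<noteq> 0" "\<forall>g\<in>span ?S. v \<bullet> g = 0"
    by (elim exE conjE)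
  have v: "v \<noteq> 0" "v \<bullet> g = 0" if "g \<in> ?S" for g
    using v0(1) bspec[OF v0(2) span_base[OF that]] .
  define x0 where "x0 = snd c m"
  have x0: "x0 \<in> snd c ` fst c" using c by (simp add: x0_def)
  have kills: "v \<bullet> grad c m f = 0" if f: "smooth_map f" for f
  proof -
    define F where "F p = f (lifted_flow c p)" for p
    have Fs: "smooth (lifted_dom c) F"
      unfolding F_def by (rule smooth_map_lifted_flow[OF c(1) f])
    define D where "D p = frechet_derivative F (at p)" for p
    have D: "(F has_derivative D p) (at p)" if "p \<in> lifted_dom c" for p
      unfolding D_def by (rule smooth_has_derivative[OF Fs open_lifted_dom[OF c(1)] that])
    have D2: "smooth (lifted_dom c) (\<lambda>p. D p v)" for v
      unfolding D_def by (rule smooth_frechet_derivative[OF Fs open_lifted_dom[OF c(1)]])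
    define H where "H g = frechet_derivative (\<lambda>x. f (\<rho> g (inv_chart c x))) (at x0) v" for g
    have Fx: "((\<lambda>x. f (flow \<xi> (inv_chart c x))) has_derivative (\<lambda>u. D (\<xi>, x0) (0, u))) (at x0)" for \<xi>
    proof -
      have 1: "((\<lambda>x. (\<xi>, x)) has_derivative (\<lambda>u. (0, u))) (at x0)"
        by (auto intro!: derivative_eq_intros)
      have 2: "(F has_derivative D (\<xi>, x0)) (at (\<xi>, x0))" by (rule D) (use x0 in simp)
      show ?thesis using has_derivative_compose[OF 1 2] by (simp add: F_def)
    qed
    have HD: "H (torus_exp \<xi>) = D (\<xi>, x0) (0, v)" for \<xi>
      unfolding H_def using frechet_derivative_at[OF Fx] by metis
    have Hc: "continuous_on UNIV (\<lambda>\<xi>. H (torus_exp \<xi>))"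
      unfolding HD
      by (rule continuous_on_compose2[OF smooth_continuous_on[OF D2 open_lifted_dom[OF c(1)]]])
        (use x0 in \<open>auto intro!: continuous_intros\<close>)
    have "integral cube (\<lambda>\<xi>. H (torus_exp \<xi>) *\<^sub>R character \<beta> \<xi>) = 0" if \<beta>: "weight \<beta>" for \<beta>
    proof -
      define z where "z = fourier (- \<beta>) (\<lambda>x. of_real (f x))"
      have zf: "smooth_map (\<lambda>x. of_real (f x) :: complex)" by (rule smooth_map_of_real[OF f])
      have z: "equivariant z (- \<beta>)" unfolding z_def
        by (rule equivariant_fourier[OF zf]) (use \<beta> in \<open>simp add: weight_def\<close>)
      define G where "G p = of_real (f (lifted_flow c p)) * character \<beta> (fst p)" for p
      have Gs: "smooth (lifted_dom c) G"
        unfolding G_def by (rule smooth_fourier_integrand[OF c(1) zf])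
      define E where "E p = frechet_derivative G (at p)" for p
      have E: "(G has_derivative E p) (at p)" if "p \<in> lifted_dom c" for p
        unfolding E_def by (rule smooth_has_derivative[OF Gs open_lifted_dom[OF c(1)] that])
      have E2: "smooth (lifted_dom c) (\<lambda>p. E p v)" for v
        unfolding E_def by (rule smooth_frechet_derivative[OF Gs open_lifted_dom[OF c(1)]])
      have E0: "E (\<xi>, x0) (0, u) = D (\<xi>, x0) (0, u) *\<^sub>R character \<beta> \<xi>" for \<xi> u
      proof -
        have 1: "((\<lambda>x. (\<xi>, x)) has_derivative (\<lambda>u. (0, u))) (at x0)"
          by (auto intro!: derivative_eq_intros)
        have 2: "(G has_derivative E (\<xi>, x0)) (at (\<xi>, x0))" by (rule E) (use x0 in simp)
        have 3: "((\<lambda>x. f (flow \<xi> (inv_chart c x)) *\<^sub>R character \<beta> \<xi>) has_derivative (\<lambda>u. E (\<xi>, x0) (0, u))) (at x0)"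
          using has_derivative_compose[OF 1 2] by (simp add: G_def scaleR_conv_of_real)
        have 4: "((\<lambda>x. f (flow \<xi> (inv_chart c x)) *\<^sub>R character \<beta> \<xi>) has_derivative
            (\<lambda>u. D (\<xi>, x0) (0, u) *\<^sub>R character \<beta> \<xi>)) (at x0)"
          by (rule has_derivative_scaleR_left[OF Fx])
        show ?thesis by (rule fun_cong[OF has_derivative_unique[OF 3 4]])
      qed
      have "(z \<circ> inv_chart c has_derivative (\<lambda>u. integral cube (\<lambda>\<xi>. E (\<xi>, x0) (0, u)))) (at x0)"
        unfolding z_def fourier_in_chart minus_minus G_def[symmetric]
        by (rule has_derivative_integral_param[OF chart_open_image[OF c(1)] _ E
              smooth_continuous_on[OF E2 open_lifted_dom[OF c(1)]] x0]) auto
      then have dz: "(z \<circ> inv_chart c has_derivative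
          (\<lambda>u. integral cube (\<lambda>\<xi>. D (\<xi>, x0) (0, u) *\<^sub>R character \<beta> \<xi>))) (at x0)"
        by (simp add: E0)
      let ?I = "\<lambda>u. integral cube (\<lambda>\<xi>. D (\<xi>, x0) (0, u) *\<^sub>R character \<beta> \<xi>)"
      have sm: "smooth_map z" using z by (simp add: equivariant_def)
      have RI: "((\<lambda>x. Re (z x)) \<circ> inv_chart c has_derivative (\<lambda>u. Re (?I u))) (at (snd c m))"
        "((\<lambda>x. Im (z x)) \<circ> inv_chart c has_derivative (\<lambda>u. Im (?I u))) (at (snd c m))"
        using bounded_linear.has_derivative[OF bounded_linear_Re dz]
          bounded_linear.has_derivative[OF bounded_linear_Im dz] by (simp_all add: o_def x0_def)
      have "Re (?I v) = v \<bullet> grad c m (\<lambda>x. Re (z x))" "Im (?I v) = v \<bullet> grad c m (\<lambda>x. Im (z x))"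
        using fun_cong[OF has_derivative_unique[OF RI(1) has_derivative_grad[OF smooth_map_Re[OF sm] c]], of v]
          fun_cong[OF has_derivative_unique[OF RI(2) has_derivative_grad[OF smooth_map_Im[OF sm] c]], of v]
        by blast+
      then have "Re (?I v) = 0" "Im (?I v) = 0" using v(2) z by auto
      then show ?thesis by (simp add: HD complex_eq_iff)
    qed
    then have "H (torus_exp 0) = 0" by (rule fourier_coefficients_zero[OF Hc])
    moreover have f0: "((f \<circ> inv_chart c) has_derivative (\<lambda>u. D (0, x0) (0, u))) (at (snd c m))"
      using Fx[of 0] by (simp add: o_def x0_def)
    have "D (0, x0) (0, v) = v \<bullet> grad c m f"
      by (rule fun_cong[OF has_derivative_unique[OF f0 has_derivative_grad[OF f c]]])
    ultimately show ?thesis by (simp add: HD)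
  qed
  define W where "W = snd c ` fst c"
  have oW: "open W" unfolding W_def by (rule chart_open_image[OF c(1)])
  obtain r where r: "r > 0" "cball x0 r \<subseteq> W" using small_ball[OF oW] x0 W_def by metis
  define f where "f = extend_by_bump c x0 r (\<lambda>x. (x - x0) \<bullet> v)"
  have fs: "smooth_map f" unfolding f_def
    by (rule smooth_extend_by_bump[OF c(1) oW _ _ r]) (auto simp: W_def[symmetric] intro!: smooth_rules oW)
  obtain B where B: "\<And>x. x \<in> UNIV \<Longrightarrow> (bump x0 r has_derivative B x) (at x)"
    by (rule smooth_derivE[OF smooth_bump open_UNIV, of x0 r]; blast)
  have d1: "((\<lambda>x. bump x0 r x * ((x - x0) \<bullet> v)) has_derivative (\<lambda>u. bump x0 r x0 * (u \<bullet> v))) (at x0)"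
    using has_derivative_mult[OF B[of x0] has_derivative_inner_left[OF has_derivative_diff[OF has_derivative_ident has_derivative_const]], of x0 v]
    by simp
  have "(f \<circ> inv_chart c has_derivative (\<lambda>u. bump x0 r x0 * (u \<bullet> v))) (at x0)"
  proof (rule has_derivative_transform_within_open[OF d1 open_ball[of x0 r]])
    show "x0 \<in> ball x0 r" using r by simp
    fix x assume "x \<in> ball x0 r"
    moreover then have "x \<in> snd c ` fst c" using r W_def by auto
    ultimately show "bump x0 r x * ((x - x0) \<bullet> v) = (f \<circ> inv_chart c) x"
      by (simp add: f_def extend_by_bump_def inv_chart_in)
  qed
  then have "(f \<circ> inv_chart c has_derivative (\<lambda>u. u \<bullet> (bump x0 r x0 *\<^sub>R v))) (at (snd c m))"
    by (simp add: x0_def)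
  then have "grad c m f = bump x0 r x0 *\<^sub>R v" by (rule grad_unique)
  then show False using kills[OF fs] v0(1) bump_center[OF r(1), of x0] by simp
qed

section \<open>Coordinates adapted to the torus action\<close>

lemma equivariant_constant_along:
  assumes "equivariant z \<alpha>" "\<alpha> \<bullet> \<xi> = 0 \<or> z m = 0"
  shows "z (flow (t *\<^sub>R \<xi>) m) = z m"
  using assms by (auto simp: equivariant_def character_def)

lemma grad_linear_combination:
  assumes "smooth_map f" "smooth_map g" "c \<in> atlas M" "m \<in> fst c"
  shows "grad c m (\<lambda>x. a * f x + b * g x) = a *\<^sub>R grad c m f + b *\<^sub>R grad c m g"
proof (rule grad_unique)
  have "((\<lambda>x. a * (f \<circ> inv_chart c) x + b * (g \<circ> inv_chart c) x) has_derivative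
      (\<lambda>v. a * (v \<bullet> grad c m f) + b * (v \<bullet> grad c m g))) (at (snd c m))"
    by (intro has_derivative_add has_derivative_mult_right has_derivative_grad assms)
  then show "((\<lambda>x. a * f x + b * g x) \<circ> inv_chart c has_derivative
      (\<lambda>v. v \<bullet> (a *\<^sub>R grad c m f + b *\<^sub>R grad c m g))) (at (snd c m))"
    by (simp add: o_def inner_add_right)
qed

text \<open>
  The map \<open>T\<close> is the transpose of the derivative of the flow at its fixed point.
\<close>

lemma grad_flow:
  assumes c: "c \<in> atlas M" "m \<in> fst c" and fixd: "flow \<eta> m = m"
  obtains T where "linear T" "\<And>f. smooth_map f \<Longrightarrow> grad c m (\<lambda>x. f (flow \<eta> x)) = T (grad c m f)"
proof -
  define V where "V = snd c ` fst c \<inter> (\<lambda>x. flow \<eta> (inv_chart c x)) -` fst c"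
  define h where "h x = snd c (flow \<eta> (inv_chart c x))" for x
  have "continuous_on (snd c ` fst c) (\<lambda>x. lifted_flow c (\<eta>, x))"
    by (rule continuous_on_compose2[OF continuous_lifted_flow[OF c(1)]]) (auto intro!: continuous_intros)
  then have oV: "open V" unfolding V_def
    using continuous_open_preimage[OF _ chart_open_image[OF c(1)] chart_open[OF c(1)]] by simp
  have x0: "snd c m \<in> V" using c fixd by (simp add: V_def)
  have "smooth V (\<lambda>x. snd c (lifted_flow c (\<eta>, x)))"
    by (rule smooth_compose[OF smooth_lifted_flow[OF c(1) c(1)] smooth_Pair[OF smooth_const smooth_id] oV
          open_lifted_flow_vimage[OF c(1) chart_open[OF c(1)]]])
      (use oV in \<open>auto simp: V_def\<close>)
  then have "smooth V h" by (simp add: h_def[abs_def])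
  then have K: "(h has_derivative frechet_derivative h (at (snd c m))) (at (snd c m))" (is "(_ has_derivative ?K) _")
    by (rule smooth_has_derivative[OF _ oV x0])
  have linK: "linear ?K" using K has_derivative_linear by blast
  show ?thesis
  proof (rule that[of "adjoint ?K"])
    show "linear (adjoint ?K)" by (rule adjoint_linear[OF linK])
    fix f :: "'m \<Rightarrow> real" assume f: "smooth_map f"
    have hx: "h (snd c m) = snd c m" using c fixd by (simp add: h_def)
    have "((f \<circ> inv_chart c) has_derivative (\<lambda>v. v \<bullet> grad c m f)) (at (h (snd c m)))"
      unfolding hx by (rule has_derivative_grad[OF f c])
    from has_derivative_compose[OF K this]
    have 1: "((\<lambda>x. (f \<circ> inv_chart c) (h x)) has_derivative (\<lambda>v. ?K v \<bullet> grad c m f)) (at (snd c m))" .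
    have "((\<lambda>x. f (flow \<eta> x)) \<circ> inv_chart c has_derivative (\<lambda>v. ?K v \<bullet> grad c m f)) (at (snd c m))"
      by (rule has_derivative_transform_within_open[OF 1 oV x0]) (use c in \<open>auto simp: h_def V_def\<close>)
    then show "grad c m (\<lambda>x. f (flow \<eta> x)) = adjoint ?K (grad c m f)"
      by (intro grad_unique) (simp add: adjoint_works[OF linK])
  qed
qed

text \<open>
  Every eigenfunction is constant along the orbit: either its weight is orthogonal to \<open>\<xi>\<close> or it is zero
  there. As the gradients of eigenfunctions span, the velocity of the orbit vanishes.
\<close>

lemma fixed_if_weights_vanish:
  assumes "\<And>z \<alpha>. equivariant z \<alpha> \<Longrightarrow> z m \<noteq> 0 \<Longrightarrow> \<alpha> \<bullet> \<xi> = 0"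
  shows "flow (t *\<^sub>R \<xi>) m = m"
proof (rule generating_field_0_imp_fixed)
  obtain c where c: "c \<in> atlas M" "m \<in> fst c" by (rule chart_at)
  obtain L where L: "\<And>f \<xi>. smooth_map f \<Longrightarrow> ((\<lambda>t. f (flow (t *\<^sub>R \<xi>) m)) has_real_derivative L \<xi> \<bullet> grad c m f) (at 0)"
    "\<And>f \<xi>. smooth_map f \<Longrightarrow> generating_field M \<rho> \<xi> m f = L \<xi> \<bullet> grad c m f"
    using generating_field_velocity[OF c] by metis
  have *: "L \<xi> \<bullet> grad c m (\<lambda>x. Re (z x)) = 0 \<and> L \<xi> \<bullet> grad c m (\<lambda>x. Im (z x)) = 0"
    if z: "equivariant z \<alpha>" for z \<alpha>
  proof -
    have zc: "z (flow (t *\<^sub>R \<xi>) m) = z m" for t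
      by (rule equivariant_constant_along[OF z]) (use assms[OF z] in blast)
    have sm: "smooth_map z" using z by (simp add: equivariant_def)
    show ?thesis
      using DERIV_unique[OF L(1)[OF smooth_map_Re[OF sm], of \<xi>]]
        DERIV_unique[OF L(1)[OF smooth_map_Im[OF sm], of \<xi>]] by (simp add: zc)
  qed
  let ?S = "{g. \<exists>z \<alpha>. equivariant z \<alpha> \<and>
      (g = grad c m (\<lambda>x. Re (z x)) \<or> g = grad c m (\<lambda>x. Im (z x)))}"
  have "subspace {g. L \<xi> \<bullet> g = 0}" by (simp add: subspace_hyperplane)
  moreover have "?S \<subseteq> {g. L \<xi> \<bullet> g = 0}" using * by blast
  ultimately have "span ?S \<subseteq> {g. L \<xi> \<bullet> g = 0}" by (rule span_minimal[rotated])
  then have "L \<xi> \<bullet> g = 0" for g using span_grad_equivariant[OF c] by blast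
  then have "generating_field M \<rho> \<xi> m f = 0" for f
    using L(2)[of f \<xi>] by (cases "smooth_map f") (simp, simp add: generating_field_def smooth_function_iff)
  then show "generating_field M \<rho> \<xi> m = (\<lambda>f. 0)" by blast
qed

text \<open>
  Let \<open>h\<close> be the Lie algebra of the stabilizer of \<open>m\<^sub>0\<close>; it consists of the \<open>\<xi>\<close> orthogonal to the weights of
  all eigenfunctions that are nonzero at \<open>m\<^sub>0\<close>. The eigenfunctions in \<open>N\<close> are those on which \<open>h\<close> acts
  nontrivially, so they vanish at \<open>m\<^sub>0\<close>. Since the stabilizer fixes \<open>m\<^sub>0\<close>, it rotates their differentials
  there, and a nonzero combination of the two parts of an eigenfunction generates both parts. Now \<open>choose_coordinates\<close>
  provides coordinates \<open>\<Phi>\<close> that consist of both parts of the eigenfunctions in \<open>J \<subseteq> N\<close> and of further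
  functions that are invariant under \<open>h\<close>. The finite set \<open>A\<close> of eigenfunctions without zeros on \<open>Ob\<close> has
  weights spanning the orthogonal complement of \<open>h\<close>.

  In the last property, \<open>\<xi>\<close> is orthogonal to the weights of all members of \<open>J \<union> A\<close> that are nonzero at
  \<open>x\<close>. Then \<open>\<xi>\<close> belongs to \<open>h\<close>, all coordinates are constant along its orbit through \<open>x\<close>, and the orbit
  stays at \<open>x\<close>.
\<close>

lemma coordinates_at:
  fixes m0 :: 'm
  obtains c Ob and J A :: "('m, 'k) eigenpair set" and \<Phi> :: "'m \<Rightarrow> 'e" and r G
    and e e' :: "('m, 'k) eigenpair \<Rightarrow> 'e"
  where "c \<in> atlas M" "m0 \<in> Ob" "open Ob" "Ob \<subseteq> fst c"
    "finite J" "finite A" "J \<inter> A = {}" "\<And>p. p \<in> J \<union> A \<Longrightarrow> equivariant (fst p) (snd p)"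
    "smooth_map \<Phi>" "r > 0" "\<And>y. y \<in> ball (\<Phi> m0) r \<Longrightarrow> G y \<in> Ob \<and> \<Phi> (G y) = y"
    "\<And>x. x \<in> Ob \<Longrightarrow> G (\<Phi> x) = x"
    "smooth (ball (\<Phi> m0) r) (\<lambda>y. snd c (G y))"
    "\<And>p. p \<in> J \<Longrightarrow> e p \<in> Basis \<and> e' p \<in> Basis" "\<And>p q. p \<in> J \<Longrightarrow> q \<in> J \<Longrightarrow> e p \<noteq> e' q"
    "\<And>p x. p \<in> J \<Longrightarrow> \<Phi> x \<bullet> e p = Re (fst p x) \<and> \<Phi> x \<bullet> e' p = Im (fst p x)"
    "\<And>p. p \<in> J \<Longrightarrow> fst p m0 = 0" "\<And>p x. p \<in> A \<Longrightarrow> x \<in> Ob \<Longrightarrow> fst p x \<noteq> 0"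
    "\<And>x \<xi>. x \<in> Ob \<Longrightarrow> (\<And>p. p \<in> J \<Longrightarrow> fst p x \<noteq> 0 \<Longrightarrow> snd p \<bullet> \<xi> = 0) \<Longrightarrow>
      (\<And>p. p \<in> A \<Longrightarrow> snd p \<bullet> \<xi> = 0) \<Longrightarrow> generating_field M \<rho> \<xi> x = (\<lambda>f. 0)"
proof -
  obtain c where c: "c \<in> atlas M" "m0 \<in> fst c" by (rule chart_at)
  define x0 where "x0 = snd c m0"
  define Z where "Z = {p. equivariant (fst p) (snd p)}"
  define h where "h = {\<xi>. \<forall>p\<in>Z. fst p m0 \<noteq> 0 \<longrightarrow> snd p \<bullet> \<xi> = 0}"
  define N where "N = {p\<in>Z. \<exists>\<xi>\<in>h. snd p \<bullet> \<xi> \<noteq> 0}"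
  define Q where "Q = Z - N"
  define R where "R p = grad c m0 (\<lambda>x. Re (fst p x))" for p :: "('m, 'k) eigenpair"
  define I where "I p = grad c m0 (\<lambda>x. Im (fst p x))" for p :: "('m, 'k) eigenpair"
  have smz: "smooth_map (fst p)" "smooth_map (\<lambda>x. Re (fst p x))" "smooth_map (\<lambda>x. Im (fst p x))"
    if "p \<in> Z" for p
    using that by (auto simp: Z_def equivariant_def intro: smooth_map_Re smooth_map_Im)
  have hfix: "flow \<xi> m0 = m0" if "\<xi> \<in> h" for \<xi>
    using fixed_if_weights_vanish[of m0 \<xi> 1] that by (force simp: h_def Z_def)
  have NQ: "N \<union> Q = Z" by (auto simp: N_def Q_def)
  have "R ` Z \<union> I ` Z = {g. \<exists>z \<alpha>. equivariant z \<alpha> \<and>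
      (g = grad c m0 (\<lambda>x. Re (z x)) \<or> g = grad c m0 (\<lambda>x. Im (z x)))}"
  proof -
    have "R ` Z \<union> I ` Z = {g. \<exists>p. p \<in> Z \<and> (g = R p \<or> g = I p)}" by blast
    then show ?thesis by (simp add: split_paired_Ex Z_def R_def I_def)
  qed
  then have sp: "span (R ` (N \<union> Q) \<union> I ` (N \<union> Q)) = UNIV"
    using span_grad_equivariant[OF c] by (simp add: NQ)
  have rot: "R p \<in> span (R ` J \<union> I ` J) \<and> I p \<in> span (R ` J \<union> I ` J)"
    if J: "J \<subseteq> N" and p: "p \<in> N" and ab: "(a, b) \<noteq> (0, 0)"
      and u: "a *\<^sub>R R p + b *\<^sub>R I p \<in> span (R ` J \<union> I ` J)" for J p a b
  proof -
    define S where "S = span (R ` J \<union> I ` J)"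
    obtain \<xi> where \<xi>: "\<xi> \<in> h" "snd p \<bullet> \<xi> \<noteq> 0" using p by (auto simp: N_def)
    \<comment> \<open>With this multiple of \<open>\<xi>\<close> the flow multiplies the eigenfunction of \<open>p\<close> by \<open>exp (2\<pi>i / 4) = i\<close>.\<close>
    define \<eta> where "\<eta> = (1 / (4 * (snd p \<bullet> \<xi>))) *\<^sub>R \<xi>"
    have \<eta>: "\<eta> \<in> h" "snd p \<bullet> \<eta> = 1 / 4" using \<xi> by (auto simp: \<eta>_def h_def)
    obtain T where T: "linear T" "\<And>f. smooth_map f \<Longrightarrow> grad c m0 (\<lambda>x. f (flow \<eta> x)) = T (grad c m0 f)"
      using grad_flow[OF c hfix[OF \<eta>(1)]] by metis
    define cs sn where "cs q = cos (2 * pi * (snd q \<bullet> \<eta>))" and "sn q = sin (2 * pi * (snd q \<bullet> \<eta>))"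
      for q :: "('m, 'k) eigenpair"
    have TRI: "T (R q) = cs q *\<^sub>R R q + (- sn q) *\<^sub>R I q" "T (I q) = sn q *\<^sub>R R q + cs q *\<^sub>R I q"
      if q: "q \<in> Z" for q
    proof -
      have "fst q (flow \<eta> x) = cis (2 * pi * (snd q \<bullet> \<eta>)) * fst q x" for x
        using q by (auto simp: Z_def equivariant_def character_def)
      then have "Re (fst q (flow \<eta> x)) = cs q * Re (fst q x) + (- sn q) * Im (fst q x)"
        "Im (fst q (flow \<eta> x)) = sn q * Re (fst q x) + cs q * Im (fst q x)" for x
        by (simp_all add: cs_def sn_def)
      then show "T (R q) = cs q *\<^sub>R R q + (- sn q) *\<^sub>R I q" "T (I q) = sn q *\<^sub>R R q + cs q *\<^sub>R I q"
        unfolding R_def I_def T(2)[OF smz(2)[OF q], symmetric] T(2)[OF smz(3)[OF q], symmetric]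
          grad_linear_combination[OF smz(2)[OF q] smz(3)[OF q] c, symmetric] by simp_all
    qed
    have "T ` (R ` J \<union> I ` J) \<subseteq> S"
    proof
      fix w assume "w \<in> T ` (R ` J \<union> I ` J)"
      then obtain q where q: "q \<in> J" "w = T (R q) \<or> w = T (I q)" by auto
      have "q \<in> Z" using q(1) J by (auto simp: N_def)
      moreover have "R q \<in> S" "I q \<in> S" using q(1) by (auto simp: S_def intro: span_base)
      ultimately show "w \<in> S"
        using q(2) TRI[of q] unfolding S_def by (metis span_add span_scale)
    qed
    then have "T ` S \<subseteq> S"
      unfolding S_def linear_span_image[OF T(1), symmetric] by (intro span_minimal subspace_span)
    then have Tu: "T (a *\<^sub>R R p + b *\<^sub>R I p) \<in> S" using u by (auto simp: S_def)
    have pZ: "p \<in> Z" using p by (simp add: N_def)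
    have "cs p = 0" "sn p = 1"
      by (simp_all add: cs_def sn_def \<eta>(2))
    then have "T (R p) = - I p" "T (I p) = R p" using TRI[OF pZ] by simp_all
    then have Tu': "b *\<^sub>R R p - a *\<^sub>R I p \<in> S"
      using Tu T(1) by (simp add: linear_add linear_scale)
    define k where "k = a * a + b * b"
    have ab2: "k \<noteq> 0" unfolding k_def using ab by (simp add: sum_squares_eq_zero_iff)
    have "(1 / k) *\<^sub>R (a *\<^sub>R (a *\<^sub>R R p + b *\<^sub>R I p) + b *\<^sub>R (b *\<^sub>R R p - a *\<^sub>R I p)) \<in> S"
      unfolding S_def
      by (rule span_scale[OF span_add[OF span_scale[OF u] span_scale[OF Tu'[unfolded S_def]]]])
    moreover have "a *\<^sub>R (a *\<^sub>R R p + b *\<^sub>R I p) + b *\<^sub>R (b *\<^sub>R R p - a *\<^sub>R I p) = k *\<^sub>R R p"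
      by (simp add: k_def algebra_simps)
    ultimately have "R p \<in> S" using ab2 by simp
    have "(1 / k) *\<^sub>R (b *\<^sub>R (a *\<^sub>R R p + b *\<^sub>R I p) - a *\<^sub>R (b *\<^sub>R R p - a *\<^sub>R I p)) \<in> S"
      unfolding S_def
      by (rule span_scale[OF span_diff[OF span_scale[OF u] span_scale[OF Tu'[unfolded S_def]]]])
    moreover have "b *\<^sub>R (a *\<^sub>R R p + b *\<^sub>R I p) - a *\<^sub>R (b *\<^sub>R R p - a *\<^sub>R I p) = k *\<^sub>R I p"
      by (simp add: k_def algebra_simps)
    ultimately have "I p \<in> S" using ab2 by simp
    with \<open>R p \<in> S\<close> show ?thesis by (simp add: S_def)
  qed
  obtain J B where J: "finite J" "J \<subseteq> N" "inj_on R J" "inj_on I J" "R ` J \<inter> I ` J = {}"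
    "B \<subseteq> R ` Q \<union> I ` Q" "B \<inter> (R ` J \<union> I ` J) = {}"
    "independent (R ` J \<union> I ` J \<union> B)" "span (R ` J \<union> I ` J \<union> B) = UNIV"
    by (rule choose_coordinates[OF sp rot])
  define B' where "B' = R ` J \<union> I ` J \<union> B"
  have finB': "finite B'" using J(8) independent_bound by (auto simp: B'_def)
  have "card B' = card (Basis :: 'e set)"
    using dim_eq_card[of B' UNIV] J(8,9) by (simp add: B'_def)
  then obtain T where T: "bij_betw T B' (Basis :: 'e set)"
    using finite_same_card_bij[OF finB' finite_Basis] by blast
  have TB: "T b \<in> Basis" if "b \<in> B'" for b using T that by (auto simp: bij_betw_def)
  have Tinj: "T b = T b' \<longleftrightarrow> b = b'" if "b \<in> B'" "b' \<in> B'" for b b'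
    using T that by (auto simp: bij_betw_def inj_on_def)
  define coord where "coord b f \<longleftrightarrow> smooth_map f \<and> grad c m0 f = b \<and>
      (\<forall>p\<in>J. (b = R p \<longrightarrow> f = (\<lambda>x. Re (fst p x))) \<and> (b = I p \<longrightarrow> f = (\<lambda>x. Im (fst p x)))) \<and>
      (b \<in> B \<longrightarrow> (\<exists>q\<in>Q. f = (\<lambda>x. Re (fst q x)) \<or> f = (\<lambda>x. Im (fst q x))))" for b f
  have ex: "\<exists>f. coord b f" if b: "b \<in> B'" for b
  proof -
    have JZ: "J \<subseteq> Z" using J(2) by (auto simp: N_def)
    consider p where "p \<in> J" "b = R p" | p where "p \<in> J" "b = I p" | "b \<in> B"
      using b by (auto simp: B'_def)
    then show ?thesis
    proof cases
      case 1
      then show ?thesis unfolding coord_def using smz(2)[of p] JZ J(3,5,7)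
        by (intro exI[of _ "\<lambda>x. Re (fst p x)"]) (auto simp: R_def[symmetric] dest: inj_onD)
    next
      case 2
      then show ?thesis unfolding coord_def using smz(3)[of p] JZ J(4,5,7)
        by (intro exI[of _ "\<lambda>x. Im (fst p x)"]) (auto simp: I_def[symmetric] dest: inj_onD)
    next
      case 3
      then obtain q where q: "q \<in> Q" "b = R q \<or> b = I q" using J(6) by blast
      then have "q \<in> Z" by (simp add: Q_def)
      have nJ: "b \<notin> R ` J" "b \<notin> I ` J" using 3 J(7) by auto
      show ?thesis
        using q(2)
      proof
        assume "b = R q"
        then show ?thesis unfolding coord_def using q(1) smz[OF \<open>q \<in> Z\<close>] nJ
          by (intro exI[of _ "\<lambda>x. Re (fst q x)"]) (auto simp: R_def[symmetric])
      next
        assume "b = I q"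
        then show ?thesis unfolding coord_def using q(1) smz[OF \<open>q \<in> Z\<close>] nJ
          by (intro exI[of _ "\<lambda>x. Im (fst q x)"]) (auto simp: I_def[symmetric])
      qed
    qed
  qed
  define fb where "fb b = (SOME f. coord b f)" for b
  note fb' = someI_ex[OF ex, folded fb_def, unfolded coord_def]
  have JB: "R p \<in> B'" "I p \<in> B'" if "p \<in> J" for p using that by (auto simp: B'_def)
  have fb: "smooth_map (fb b)" "grad c m0 (fb b) = b" if "b \<in> B'" for b
    using fb'[OF that] by blast+
  have fbJ: "fb (R p) = (\<lambda>x. Re (fst p x))" "fb (I p) = (\<lambda>x. Im (fst p x))" if "p \<in> J" for p
    using fb'[OF JB(1)[OF that]] fb'[OF JB(2)[OF that]] that by blast+
  have fbB: "\<exists>q\<in>Q. fb b = (\<lambda>x. Re (fst q x)) \<or> fb b = (\<lambda>x. Im (fst q x))" if "b \<in> B" for b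
    using fb'[of b] that by (simp add: B'_def)
  define \<Phi> where "\<Phi> x = (\<Sum>b\<in>B'. fb b x *\<^sub>R T b)" for x
  have inner: "(\<Sum>b\<in>B'. k b *\<^sub>R T b) \<bullet> T b' = k b'" if b': "b' \<in> B'" for k b'
  proof -
    have "(\<Sum>b\<in>B'. k b *\<^sub>R T b) \<bullet> T b' = (\<Sum>b\<in>B'. if b = b' then k b else 0)"
      unfolding inner_sum_left
      by (rule sum.cong) (use b' in \<open>auto simp: inner_Basis TB Tinj\<close>)
    then show ?thesis using b' finB' by simp
  qed
  have \<Phi>s: "smooth_map \<Phi>" unfolding \<Phi>_def
    by (intro smooth_map_sum smooth_map_linear[OF bounded_linear_scaleR_left] fb(1))
  define D0 where "D0 v = (\<Sum>b\<in>B'. (v \<bullet> b) *\<^sub>R T b)" for v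
  have "((\<lambda>x. \<Sum>b\<in>B'. (fb b \<circ> inv_chart c) x *\<^sub>R T b) has_derivative
      (\<lambda>v. \<Sum>b\<in>B'. (v \<bullet> grad c m0 (fb b)) *\<^sub>R T b)) (at (snd c m0))"
    by (intro has_derivative_sum has_derivative_scaleR_left has_derivative_grad c fb(1))
  then have D0: "((\<Phi> \<circ> inv_chart c) has_derivative D0) (at x0)"
    by (simp add: \<Phi>_def D0_def[abs_def] o_def x0_def fb(2) cong: sum.cong)
  have D0inj: "v = 0" if "D0 v = 0" for v
  proof -
    have "v \<bullet> b = 0" if "b \<in> B'" for b
      using inner[OF that, of "\<lambda>b. v \<bullet> b"] \<open>D0 v = 0\<close> by (simp add: D0_def)
    then have "span B' \<subseteq> {w. v \<bullet> w = 0}"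
      by (intro span_minimal) (auto simp: subspace_hyperplane)
    then have "v \<in> {w. v \<bullet> w = 0}" using J(9) unfolding B'_def by blast
    then show ?thesis by simp
  qed
  have \<Phi>c: "smooth (snd c ` fst c) (\<Phi> \<circ> inv_chart c)" using \<Phi>s c by (simp add: smooth_map_def)
  have x0: "x0 \<in> snd c ` fst c" using c by (simp add: x0_def)
  obtain N1 V1 g where g: "open N1" "x0 \<in> N1" "N1 \<subseteq> snd c ` fst c" "open V1"
    "homeomorphism N1 V1 (\<Phi> \<circ> inv_chart c) g" "smooth V1 g"
    by (rule smooth_local_inverse[OF chart_open_image[OF c(1)] \<Phi>c x0 D0 D0inj])
  define Z0 where "Z0 = {p\<in>Z. fst p m0 \<noteq> 0}"
  obtain B0 where B0: "B0 \<subseteq> snd ` Z0" "independent B0" "snd ` Z0 \<subseteq> span B0"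
    using maximal_independent_subset by metis
  then obtain A where A: "A \<subseteq> Z0" "finite A" "B0 = snd ` A"
    using finite_subset_image[of B0 snd Z0] independent_bound by blast
  have A_h: "\<xi> \<in> h" if \<xi>: "\<And>p. p \<in> A \<Longrightarrow> snd p \<bullet> \<xi> = 0" for \<xi>
  proof -
    have "subspace {w. \<xi> \<bullet> w = 0}" by (simp add: subspace_hyperplane)
    then have "span B0 \<subseteq> {w. \<xi> \<bullet> w = 0}"
      by (intro span_minimal) (use \<xi> A(3) in \<open>auto simp: inner_commute\<close>)
    moreover have "snd p \<in> span B0" if "p \<in> Z0" for p using B0(3) that by blast
    ultimately have "\<xi> \<bullet> snd p = 0" if "p \<in> Z0" for p using that by blast
    then show ?thesis by (simp add: h_def Z0_def inner_commute)
  qed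
  define Ob where "Ob = (fst c \<inter> snd c -` N1) \<inter> (\<Inter>p\<in>A. {x. fst p x \<noteq> 0})"
  have "open {x. fst p x \<noteq> 0}" if "p \<in> A" for p
  proof -
    have "p \<in> Z" using that A(1) unfolding Z0_def by blast
    then have "smooth_map (fst p)" by (rule smz(1))
    then show ?thesis by (intro open_Collect_neq smooth_map_continuous continuous_on_const)
  qed
  then have oO: "open Ob" unfolding Ob_def
    by (intro open_Int continuous_open_preimage[OF continuous_on_chart[OF c(1)] chart_open[OF c(1)] g(1)]
        open_INT A(2)) auto
  have Oc: "Ob \<subseteq> fst c" by (auto simp: Ob_def)
  have mO: "m0 \<in> Ob" using c g(2) A(1) by (auto simp: Ob_def x0_def Z0_def)
  define V2 where "V2 = (\<Phi> \<circ> inv_chart c) ` (snd c ` Ob)"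
  have ON1: "snd c ` Ob \<subseteq> N1" by (auto simp: Ob_def)
  have "openin (top_of_set N1) (snd c ` Ob)"
    using chart_open_image_subset[OF c(1) oO Oc] ON1 by (intro open_subset)
  then have "openin (top_of_set V1) V2" unfolding V2_def
    using homeomorphism_imp_open_map[OF g(5)] by blast
  then have oV2: "open V2" "V2 \<subseteq> V1" using g(4) openin_open_trans openin_imp_subset by blast+
  have m2: "\<Phi> m0 \<in> V2" using mO c by (force simp: V2_def)
  obtain r where r: "r > 0" "ball (\<Phi> m0) r \<subseteq> V2"
    using oV2(1) m2 open_contains_ball by blast
  define G where "G y = inv_chart c (g y)" for y
  have g\<Phi>: "g (\<Phi> x) = snd c x" if "x \<in> Ob" for x
  proof -
    have "snd c x \<in> N1" using ON1 that by blast
    then have "g ((\<Phi> \<circ> inv_chart c) (snd c x)) = snd c x" using g(5) by (simp add: homeomorphism_def)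
    then show ?thesis using that Oc c(1) by auto
  qed
  have G\<Phi>: "G (\<Phi> x) = x" if "x \<in> Ob" for x
    using g\<Phi>[OF that] that Oc c(1) by (auto simp: G_def)
  have V2: "\<exists>x\<in>Ob. y = \<Phi> x" if y: "y \<in> V2" for y
  proof -
    obtain x where x: "x \<in> Ob" "y = \<Phi> (inv_chart c (snd c x))" using y by (auto simp: V2_def)
    then have "x \<in> fst c" using Oc by blast
    then have "y = \<Phi> x" using x(2) inv_chart[OF c(1)] by simp
    with x(1) show ?thesis by blast
  qed
  have sg: "snd c (G y) = g y" if "y \<in> V2" for y
  proof -
    obtain x where "x \<in> Ob" "y = \<Phi> x" using V2[OF \<open>y \<in> V2\<close>] by blast
    then show ?thesis using g\<Phi>[of x] G\<Phi>[of x] by simp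
  qed
  have "smooth (ball (\<Phi> m0) r) g"
    by (rule smooth_subset[OF g(6,4)]) (use r oV2 in auto)
  moreover have "g y = snd c (G y)" if "y \<in> ball (\<Phi> m0) r" for y
    using sg[of y] subsetD[OF r(2) that] by simp
  ultimately have smG: "smooth (ball (\<Phi> m0) r) (\<lambda>y. snd c (G y))"
    by (rule smooth_cong[THEN iffD1, rotated])
  have Nz: "fst p m0 = 0" if "p \<in> N" for p using that by (auto simp: N_def h_def)
  show ?thesis
  proof (rule that[of c Ob J A \<Phi> r G "\<lambda>p. T (R p)" "\<lambda>p. T (I p)"])
    show "J \<inter> A = {}" using J(2) Nz A(1) by (auto simp: Z0_def)
    show "equivariant (fst p) (snd p)" if "p \<in> J \<union> A" for p
      using that J(2) A(1) by (auto simp: Z0_def N_def Z_def)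
    show "G y \<in> Ob \<and> \<Phi> (G y) = y" if "y \<in> ball (\<Phi> m0) r" for y
    proof -
      obtain x where "x \<in> Ob" "y = \<Phi> x" using V2[of y] r(2) \<open>y \<in> ball (\<Phi> m0) r\<close> by blast
      then show ?thesis using G\<Phi>[of x] by simp
    qed
    show "T (R p) \<noteq> T (I q)" if "p \<in> J" "q \<in> J" for p q
      using that JB Tinj J(5) by blast
    show "\<Phi> x \<bullet> T (R p) = Re (fst p x) \<and> \<Phi> x \<bullet> T (I p) = Im (fst p x)" if "p \<in> J" for p x
      using inner[OF JB(1)[OF that]] inner[OF JB(2)[OF that]] fbJ[OF that] by (simp add: \<Phi>_def)
    show "fst p m0 = 0" if "p \<in> J" for p using Nz J(2) that by blast
    show "fst p x \<noteq> 0" if "p \<in> A" "x \<in> Ob" for p x using that by (auto simp: Ob_def)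
    fix x \<xi>
    assume x: "x \<in> Ob" and hJ: "\<And>p. p \<in> J \<Longrightarrow> fst p x \<noteq> 0 \<Longrightarrow> snd p \<bullet> \<xi> = 0"
      and hA: "\<And>p. p \<in> A \<Longrightarrow> snd p \<bullet> \<xi> = 0"
    have \<xi>h: "\<xi> \<in> h" by (rule A_h[OF hA])
    have fbc: "fb b (flow (t *\<^sub>R \<xi>) x) = fb b x" if b: "b \<in> B'" for b t
    proof -
      have z: "fst p (flow (t *\<^sub>R \<xi>) x) = fst p x" if "p \<in> J" for p
        by (rule equivariant_constant_along[of _ "snd p"]) (use hJ[OF that] that J(2) in \<open>auto simp: N_def Z_def\<close>)
      have zQ: "fst q (flow (t *\<^sub>R \<xi>) x) = fst q x" if "q \<in> Q" for q
        by (rule equivariant_constant_along[of _ "snd q"]) (use that \<xi>h in \<open>auto simp: Q_def N_def Z_def\<close>)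
      consider p where "p \<in> J" "b = R p" | p where "p \<in> J" "b = I p" | "b \<in> B"
        using b by (auto simp: B'_def)
      then show ?thesis
      proof cases
        case 3
        from fbB[OF this] obtain q where "q \<in> Q" "fb b = (\<lambda>x. Re (fst q x)) \<or> fb b = (\<lambda>x. Im (fst q x))" ..
        then show ?thesis using zQ[of q] by auto
      qed (use fbJ z in simp_all)
    qed
    then have \<Phi>c: "\<Phi> (flow (t *\<^sub>R \<xi>) x) = \<Phi> x" for t by (simp add: \<Phi>_def cong: sum.cong)
    define S where "S = (\<lambda>t. flow (t *\<^sub>R \<xi>) x) -` Ob"
    have oS: "open S" unfolding S_def
      by (intro open_vimage[OF oO] continuous_on_compose2[OF continuous_flow_param[of UNIV]] continuous_intros) auto
    have S0: "0 \<in> S" using x by (simp add: S_def)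
    have const: "flow (t *\<^sub>R \<xi>) x = x" if "t \<in> S" for t
      using G\<Phi>[of "flow (t *\<^sub>R \<xi>) x"] G\<Phi>[OF x] \<Phi>c that by (simp add: S_def)
    have "deriv (\<lambda>t. f (flow (t *\<^sub>R \<xi>) x)) 0 = 0" for f :: "'m \<Rightarrow> real"
    proof -
      have "((\<lambda>t. f x) has_real_derivative 0) (at 0)" by simp
      then have "((\<lambda>t. f (flow (t *\<^sub>R \<xi>) x)) has_real_derivative 0) (at 0)"
        by (rule has_field_derivative_transform_within_open[OF _ oS S0]) (simp add: const)
      then show ?thesis by (rule DERIV_imp_deriv)
    qed
    then show "generating_field M \<rho> \<xi> x = (\<lambda>f. 0)" by (simp add: generating_field_def fun_eq_iff)
  qed (use c mO oO Oc J(1) A(2) \<Phi>s r(1) G\<Phi> smG JB TB in auto)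
qed

section \<open>The local form of a moment map with vanishing assignment\<close>

lemma smooth_along_local_inverse:
  fixes f :: "'m \<Rightarrow> 'b::real_normed_vector"
  assumes c: "c \<in> atlas M" and f: "smooth_map f" and W: "open W"
    and G: "smooth W (\<lambda>y. snd c (G y))" "\<And>y. y \<in> W \<Longrightarrow> G y \<in> fst c"
  shows "smooth W (\<lambda>y. f (G y))"
proof -
  have "smooth W (\<lambda>y. (f \<circ> inv_chart c) (snd c (G y)))"
    by (rule smooth_compose[OF f[unfolded smooth_map_def, rule_format, OF c] G(1) W chart_open_image[OF c]])
      (use G(2) in auto)
  moreover have "(f \<circ> inv_chart c) (snd c (G y)) = f (G y)" if "y \<in> W" for y
    using G(2)[OF that] c by simp
  ultimately show ?thesis by (simp cong: smooth_cong)
qed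

text \<open>
  In the coordinates of \<open>coordinates_at\<close>, the projection \<open>P p\<close> sets the two real coordinates of the
  eigenfunction \<open>p \<in> J\<close> to zero; it preserves balls around the image of \<open>m\<^sub>0\<close>, because these coordinates vanish
  there. Orthogonality of \<open>V\<close> to stabilizers becomes the span condition of \<open>coordinate_decomposition\<close>. The
  resulting coefficient of the weight of \<open>p\<close> is a real part \<open>Re (w z)\<close>: by \<open>hadamard\<close> for \<open>p \<in> J\<close>, and by
  division by \<open>z\<close> for \<open>p \<in> A\<close>.
\<close>

lemma local_decomposition:
  fixes V :: "'m \<Rightarrow> real ^ 'k"
  assumes V: "smooth_map V"
    and Vst: "\<And>\<xi> m. generating_field M \<rho> \<xi> m = (\<lambda>f. 0) \<Longrightarrow> V m \<bullet> \<xi> = 0"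
  obtains \<psi> :: "'m \<Rightarrow> real" and K :: "('m, 'k) eigenpair set" and w
  where "smooth_map \<psi>" "\<And>m. \<psi> m \<ge> 0" "\<psi> m0 > 0" "finite K"
    "\<And>p. p \<in> K \<Longrightarrow> equivariant (fst p) (snd p)" "\<And>p. p \<in> K \<Longrightarrow> smooth_map (w p)"
    "\<And>m. \<psi> m *\<^sub>R V m = (\<Sum>p\<in>K. Re (w p m * fst p m) *\<^sub>R snd p)"
proof (rule coordinates_at[of m0])
  fix c Ob and J A :: "('m, 'k) eigenpair set" and \<Phi> :: "'m \<Rightarrow> 'e" and r G
    and e e' :: "('m, 'k) eigenpair \<Rightarrow> 'e"
  assume C: "c \<in> atlas M" "m0 \<in> Ob" "open Ob" "Ob \<subseteq> fst c"
    "finite J" "finite A" "J \<inter> A = {}" and eqv: "\<And>p. p \<in> J \<union> A \<Longrightarrow> equivariant (fst p) (snd p)"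
    and \<Phi>: "smooth_map \<Phi>" and r: "r > 0" and G: "\<And>y. y \<in> ball (\<Phi> m0) r \<Longrightarrow> G y \<in> Ob \<and> \<Phi> (G y) = y"
    and G\<Phi>: "\<And>x. x \<in> Ob \<Longrightarrow> G (\<Phi> x) = x"
    and smG: "smooth (ball (\<Phi> m0) r) (\<lambda>y. snd c (G y))"
    and ee: "\<And>p. p \<in> J \<Longrightarrow> e p \<in> Basis \<and> e' p \<in> Basis" "\<And>p q. p \<in> J \<Longrightarrow> q \<in> J \<Longrightarrow> e p \<noteq> e' q"
    and \<Phi>e: "\<And>p x. p \<in> J \<Longrightarrow> \<Phi> x \<bullet> e p = Re (fst p x) \<and> \<Phi> x \<bullet> e' p = Im (fst p x)"
    and J0: "\<And>p. p \<in> J \<Longrightarrow> fst p m0 = 0" and A0: "\<And>p x. p \<in> A \<Longrightarrow> x \<in> Ob \<Longrightarrow> fst p x \<noteq> 0"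
    and stab: "\<And>x \<xi>. x \<in> Ob \<Longrightarrow> (\<And>p. p \<in> J \<Longrightarrow> fst p x \<noteq> 0 \<Longrightarrow> snd p \<bullet> \<xi> = 0) \<Longrightarrow>
      (\<And>p. p \<in> A \<Longrightarrow> snd p \<bullet> \<xi> = 0) \<Longrightarrow> generating_field M \<rho> \<xi> x = (\<lambda>f. 0)"
  define W where "W = ball (\<Phi> m0) r"
  have oW: "open W" and cW: "convex W" by (auto simp: W_def)
  define P where "P p y = (if p \<in> J then y - (y \<bullet> e p) *\<^sub>R e p - (y \<bullet> e' p) *\<^sub>R e' p else y)" for p y
  have Pb: "P p y \<bullet> b = (if p \<in> J \<and> (b = e p \<or> b = e' p) then 0 else y \<bullet> b)" if "b \<in> Basis" for p y b
    using that ee(1)[of p] ee(2)[of p p] by (auto simp: P_def inner_diff_left inner_Basis)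
  have P: "bounded_linear (P p)" for p
    unfolding linear_conv_bounded_linear[symmetric]
    by (auto simp: linear_iff P_def algebra_simps)
  have Pc: "P p (\<Phi> m0) = \<Phi> m0" for p using \<Phi>e J0 by (auto simp: P_def)
  have PW: "P p y \<in> W" if "y \<in> W" for p y
  proof -
    have "norm (P p (y - \<Phi> m0)) \<le> norm (y - \<Phi> m0)"
      unfolding norm_le euclidean_inner[of "P p (y - \<Phi> m0)" "P p (y - \<Phi> m0)"]
        euclidean_inner[of "y - \<Phi> m0" "y - \<Phi> m0"]
      by (rule sum_mono) (simp add: Pb)
    moreover have "P p (y - \<Phi> m0) = P p y - \<Phi> m0"
      using bounded_linear.linear[OF P[of p]] Pc[of p] by (simp add: linear_diff)
    ultimately show ?thesis using that by (auto simp: W_def dist_norm norm_minus_commute)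
  qed
  have Pid: "P p (P p y) = P p y" for p y
    by (rule euclidean_eqI) (auto simp: Pb)
  have Pcom: "P p (P q y) = P q (P p y)" for p q y
    by (rule euclidean_eqI) (auto simp: Pb)
  have PG: "P p y = y \<longleftrightarrow> fst p (G y) = 0" if "p \<in> J" "y \<in> W" for p y
  proof -
    have "P p y = y \<longleftrightarrow> y \<bullet> e p = 0 \<and> y \<bullet> e' p = 0"
    proof
      assume "P p y = y"
      then show "y \<bullet> e p = 0 \<and> y \<bullet> e' p = 0"
        using Pb[of "e p" p y] Pb[of "e' p" p y] ee(1)[OF that(1)] that(1) by simp
    qed (simp add: P_def)
    also have "\<dots> \<longleftrightarrow> fst p (G y) = 0"
      using \<Phi>e[OF that(1), of "G y"] G[of y] that(2) by (auto simp: W_def complex_eq_iff)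
    finally show ?thesis .
  qed
  have GO: "G y \<in> Ob" "\<Phi> (G y) = y" if "y \<in> W" for y using G that by (auto simp: W_def)
  have Gc: "G y \<in> fst c" if "y \<in> W" for y using GO(1)[OF that] C(4) by blast
  have smG': "smooth W (\<lambda>y. snd c (G y))" using smG by (simp add: W_def)
  have F: "smooth W (\<lambda>y. V (G y))"
    by (rule smooth_along_local_inverse[OF C(1) V oW smG' Gc])
  have Fsp: "V (G y) \<in> span (snd ` ({p\<in>J. P p y \<noteq> y} \<union> A))" if y: "y \<in> W" for y
  proof (rule in_span_if_orthogonal)
    fix \<xi> assume \<xi>: "\<And>s. s \<in> snd ` ({p\<in>J. P p y \<noteq> y} \<union> A) \<Longrightarrow> s \<bullet> \<xi> = 0"
    show "V (G y) \<bullet> \<xi> = 0"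
    proof (rule Vst, rule stab[OF GO(1)[OF y]])
      show "snd p \<bullet> \<xi> = 0" if "p \<in> J" "fst p (G y) \<noteq> 0" for p
        by (rule \<xi>) (use PG[OF that(1) y] that in blast)
      show "snd p \<bullet> \<xi> = 0" if "p \<in> A" for p
        by (rule \<xi>) (use that in blast)
    qed
  qed
  obtain cf where cf: "\<And>p. smooth W (cf p)" "\<And>x p. x \<in> W \<Longrightarrow> p \<in> J \<Longrightarrow> P p x = x \<Longrightarrow> cf p x = (0::real)"
    "\<And>x. x \<in> W \<Longrightarrow> V (G x) = (\<Sum>p\<in>J \<union> A. cf p x *\<^sub>R snd p)"
    by (rule coordinate_decomposition[OF oW C(5,6,7) P PW Pid Pcom F Fsp]; blast)
  have ex: "\<exists>w :: 'e \<Rightarrow> complex. smooth W w \<and> (\<forall>y\<in>W. cf p y = Re (w y * fst p (G y)))"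
    if p: "p \<in> J \<union> A" for p
  proof (cases "p \<in> J")
    case True
    obtain g where g: "\<And>b. smooth W (g b)"
      "\<And>x. x \<in> W \<Longrightarrow> cf p x = (\<Sum>b\<in>Basis. ((x - P p x) \<bullet> b) * g b x)"
      by (rule hadamard[OF oW cW cf(1)[of p] P[of p] PW cf(2)[OF PW True Pid]]; blast)
    \<comment> \<open>For real \<open>a\<close> and \<open>b\<close>, \<open>Re ((a - \<i> b) z) = a Re z + b Im z\<close>.\<close>
    define w where "w y = g (e p) y *\<^sub>R 1 + g (e' p) y *\<^sub>R (- \<i>)" for y
    have "smooth W w" unfolding w_def by (intro smooth_rules g oW)
    moreover have "cf p y = Re (w y * fst p (G y))" if y: "y \<in> W" for y
    proof -
      have "cf p y = (\<Sum>b\<in>Basis. (if b = e p \<or> b = e' p then (y \<bullet> b) * g b y else 0))"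
        unfolding g(2)[OF y] by (rule sum.cong) (auto simp: inner_diff_left Pb True)
      also have "\<dots> = (\<Sum>b\<in>{e p, e' p}. (y \<bullet> b) * g b y)"
        using ee(1)[OF True] by (intro sum.mono_neutral_cong_right) auto
      also have "\<dots> = Re (fst p (G y)) * g (e p) y + Im (fst p (G y)) * g (e' p) y"
        using ee(2)[OF True True] \<Phi>e[OF True, of "G y"] GO(2)[OF y] by simp
      also have "\<dots> = Re (w y * fst p (G y))"
        by (simp add: w_def mult.commute)
      finally show ?thesis .
    qed
    ultimately show ?thesis by blast
  next
    case False
    then have pA: "p \<in> A" using p by blast
    define z where "z y = fst p (G y)" for y
    have sz: "smooth W z" unfolding z_def
      by (rule smooth_along_local_inverse[OF C(1) _ oW smG' Gc]) (use eqv[OF p] in \<open>auto simp: equivariant_def\<close>)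
    have z0: "z y \<noteq> 0" if "y \<in> W" for y using A0[OF pA GO(1)[OF that]] by (simp add: z_def)
    have zz: "z y \<bullet> z y \<noteq> 0" if "y \<in> W" for y using z0[OF that] by simp
    \<comment> \<open>This is \<open>cf p y / z y\<close>, since \<open>z y \<bullet> z y\<close> is the square of the absolute value.\<close>
    define w where "w y = (cf p y * inverse (z y \<bullet> z y)) *\<^sub>R cnj (z y)" for y
    have "smooth W w" unfolding w_def
      by (intro smooth_rules smooth_inverse_real smooth_linear[OF bounded_linear_cnj] sz cf(1) oW zz)
    moreover have "cf p y = Re (w y * fst p (G y))" if y: "y \<in> W" for y
    proof -
      have "cnj (z y) * z y = of_real (z y \<bullet> z y)"
        by (simp add: complex_eq_iff inner_complex_def)
      then have "w y * fst p (G y) = of_real (cf p y * inverse (z y \<bullet> z y) * (z y \<bullet> z y))"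
        by (simp add: w_def z_def[symmetric] scaleR_conv_of_real mult.assoc)
      also have "cf p y * inverse (z y \<bullet> z y) * (z y \<bullet> z y) = cf p y" using zz[OF y] by simp
      finally show ?thesis by (simp only: Re_complex_of_real)
    qed
    ultimately show ?thesis by blast
  qed
  define wl where "wl p = (SOME w :: 'e \<Rightarrow> complex. smooth W w \<and> (\<forall>y\<in>W. cf p y = Re (w y * fst p (G y))))" for p
  have wl: "smooth W (wl p) \<and> (\<forall>y\<in>W. cf p y = Re (wl p y * fst p (G y)))"
    if "p \<in> J \<union> A" for p
    unfolding wl_def by (rule someI_ex[OF ex[OF that]])
  define x0 where "x0 = snd c m0"
  define D where "D = snd c ` Ob \<inter> (\<Phi> \<circ> inv_chart c) -` W"
  have oO: "open (snd c ` Ob)" by (rule chart_open_image_subset[OF C(1,3,4)])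
  have Os: "snd c ` Ob \<subseteq> snd c ` fst c" using C(4) by blast
  have s\<Phi>: "smooth (snd c ` Ob) (\<Phi> \<circ> inv_chart c)"
    by (rule smooth_map_chart_subset[OF \<Phi> C(1,3,4)])
  have oD: "open D" unfolding D_def
    by (rule continuous_open_preimage[OF smooth_continuous_on[OF s\<Phi> oO] oO oW])
  have x0D: "x0 \<in> D" using C(1,2,4) r by (auto simp: D_def x0_def W_def)
  have Dc: "D \<subseteq> snd c ` fst c" using Os by (auto simp: D_def)
  obtain r' where r': "r' > 0" "cball x0 r' \<subseteq> D" by (rule small_ball[OF oD x0D])
  define \<psi> where "\<psi> = extend_by_bump c x0 r' (\<lambda>x. 1 :: real)"
  define w where "w p = extend_by_bump c x0 r' (\<lambda>x. wl p ((\<Phi> \<circ> inv_chart c) x))" for p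
  have s\<Phi>D: "smooth D (\<Phi> \<circ> inv_chart c)" by (rule smooth_subset[OF s\<Phi> oO oD]) (auto simp: D_def)
  show thesis
  proof (rule that[of \<psi> "J \<union> A" w])
    show "smooth_map \<psi>" unfolding \<psi>_def
      by (rule smooth_extend_by_bump[OF C(1) oD Dc smooth_const[OF oD] r'])
    show "\<psi> m \<ge> 0" for m by (simp add: \<psi>_def extend_by_bump_def bump_nonneg)
    show "\<psi> m0 > 0"
      using C(2,4) bump_center[OF r'(1)] r'(1) by (auto simp: \<psi>_def extend_by_bump_def x0_def)
    show "finite (J \<union> A)" using C by blast
    show "smooth_map (w p)" if "p \<in> J \<union> A" for p
    proof -
      have "smooth D (\<lambda>x. wl p ((\<Phi> \<circ> inv_chart c) x))"
        by (rule smooth_compose[OF conjunct1[OF wl[OF that]] s\<Phi>D oD oW]) (auto simp: D_def)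
      then show ?thesis unfolding w_def by (rule smooth_extend_by_bump[OF C(1) oD Dc _ r'])
    qed
    fix m
    show "\<psi> m *\<^sub>R V m = (\<Sum>p\<in>J \<union> A. Re (w p m * fst p m) *\<^sub>R snd p)"
    proof (cases "m \<in> fst c \<and> snd c m \<in> cball x0 r'")
      case True
      then have mD: "snd c m \<in> D" using r' by blast
      then obtain n where n: "n \<in> Ob" "snd c m = snd c n" by (auto simp: D_def)
      have "m = n" using inv_chart[OF C(1), of m] inv_chart[OF C(1), of n] n True C(4) by auto
      then have mO: "m \<in> Ob" using n by simp
      have \<Phi>W: "\<Phi> m \<in> W" using mD True C(1) by (simp add: D_def)
      define \<beta> where "\<beta> = bump x0 r' (snd c m)"
      have wm: "w p m = \<beta> *\<^sub>R wl p (\<Phi> m)" for p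
        using True C(1) by (simp add: w_def extend_by_bump_def \<beta>_def)
      have "\<psi> m *\<^sub>R V m = \<beta> *\<^sub>R V (G (\<Phi> m))"
        using True G\<Phi>[OF mO] by (simp add: \<psi>_def extend_by_bump_def \<beta>_def)
      also have "\<dots> = (\<Sum>p\<in>J \<union> A. (\<beta> * cf p (\<Phi> m)) *\<^sub>R snd p)"
        unfolding cf(3)[OF \<Phi>W] by (simp add: scaleR_sum_right)
      also have "\<dots> = (\<Sum>p\<in>J \<union> A. Re (w p m * fst p m) *\<^sub>R snd p)"
      proof (rule sum.cong)
        fix p assume p: "p \<in> J \<union> A"
        have "cf p (\<Phi> m) = Re (wl p (\<Phi> m) * fst p m)"
          using wl[OF p] \<Phi>W G\<Phi>[OF mO] by simp
        then have "\<beta> * cf p (\<Phi> m) = Re (w p m * fst p m)"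
          by (simp only: wm mult_scaleR_left scaleR_complex.simps)
        then show "(\<beta> * cf p (\<Phi> m)) *\<^sub>R snd p = Re (w p m * fst p m) *\<^sub>R snd p"
          by simp
      qed simp
      finally show ?thesis .
    next
      case False
      then have "\<psi> m = 0" "w p m = 0" for p by (auto simp: \<psi>_def w_def extend_by_bump_def)
      then show ?thesis by simp
    qed
  qed (rule eqv)
qed

text \<open>
  The invariant version of the local decomposition; \<open>w p\<close> has the weight opposite to that of \<open>p\<close>.
\<close>

definition decomposition_datum ::
  "('m \<Rightarrow> real ^ 'k) \<Rightarrow> ('m \<Rightarrow> real) \<Rightarrow> ('m, 'k) eigenpair set \<Rightarrow>
    (('m, 'k) eigenpair \<Rightarrow> 'm \<Rightarrow> complex) \<Rightarrow> bool" where
  "decomposition_datum V \<psi> K w \<longleftrightarrow>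
     smooth_map \<psi> \<and> (\<forall>m. \<psi> m \<ge> 0) \<and> (\<forall>\<xi> m. \<psi> (flow \<xi> m) = \<psi> m) \<and> finite K \<and>
     (\<forall>p\<in>K. equivariant (fst p) (snd p) \<and> equivariant (w p) (- snd p)) \<and>
     (\<forall>m. \<psi> m *\<^sub>R V m = (\<Sum>p\<in>K. Re (w p m * fst p m) *\<^sub>R snd p))"

text \<open>
  Integrate the local decomposition over the orbits. The left side remains a multiple of \<open>V\<close> because \<open>V\<close>
  is constant on orbits. In the summand of \<open>p\<close>, only the Fourier component of \<open>w0 p\<close> of weight \<open>- snd p\<close>
  survives (\<open>fourier_mult_equivariant\<close>).
\<close>

lemma invariant_local_decomposition:
  fixes V :: "'m \<Rightarrow> real ^ 'k"
  assumes V: "smooth_map V" and Vinv: "\<And>\<xi> m. V (flow \<xi> m) = V m"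
    and Vst: "\<And>\<xi> m. generating_field M \<rho> \<xi> m = (\<lambda>f. 0) \<Longrightarrow> V m \<bullet> \<xi> = 0"
  shows "\<exists>\<psi> K w. decomposition_datum V \<psi> K w \<and> \<psi> m0 > 0"
proof -
  obtain \<psi>0 K w0 where L: "smooth_map \<psi>0" "\<And>m. \<psi>0 m \<ge> (0::real)" "\<psi>0 m0 > 0" "finite K"
    "\<And>p. p \<in> K \<Longrightarrow> equivariant (fst p) (snd p)" "\<And>p. p \<in> K \<Longrightarrow> smooth_map (w0 p)"
    "\<And>m. \<psi>0 m *\<^sub>R V m = (\<Sum>p\<in>K. Re (w0 p m * fst p m) *\<^sub>R snd p)"
    by (rule local_decomposition[OF V Vst, of m0]; blast)
  define w where "w p = fourier (- snd p) (w0 p)" for p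
  define X where "X = fourier 0 (\<lambda>x. of_real (\<psi>0 x))"
  define \<psi> where "\<psi> m = Re (X m)" for m
  have X: "equivariant X 0" unfolding X_def
    by (rule equivariant_fourier[OF smooth_map_of_real[OF L(1)]]) (simp add: weight_def)
  have cont: "continuous_on S (\<lambda>\<eta>. f (flow \<eta> m))" if "smooth_map f" for f :: "'m \<Rightarrow> 'b::real_normed_vector" and m S
    by (rule continuous_on_compose2[OF smooth_map_continuous[OF that] continuous_flow_param]) simp
  have \<psi>: "\<psi> m = integral cube (\<lambda>\<eta>. \<psi>0 (flow \<eta> m))" for m
  proof -
    have "integral cube (Re \<circ> (\<lambda>\<eta>. complex_of_real (\<psi>0 (flow \<eta> m)))) =
        Re (integral cube (\<lambda>\<eta>. complex_of_real (\<psi>0 (flow \<eta> m))))"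
      by (intro integral_linear bounded_linear_Re integrable_continuous continuous_on_of_real cont L)
    then show ?thesis by (simp add: \<psi>_def X_def fourier_def o_def)
  qed
  have wz: "integral cube (\<lambda>\<eta>. Re (w0 p (flow \<eta> m) * fst p (flow \<eta> m))) =
      Re (w p m * fst p m)" if p: "p \<in> K" for p m
  proof -
    have sm: "smooth_map (fst p)" "smooth_map (w0 p)" using L(5,6)[OF p] by (auto simp: equivariant_def)
    have "(\<lambda>\<eta>. w0 p (flow \<eta> m) * fst p (flow \<eta> m)) integrable_on cube"
      by (intro integrable_continuous continuous_on_mult cont sm)
    from integral_linear[OF this bounded_linear_Re]
    have "integral cube (Re \<circ> (\<lambda>\<eta>. w0 p (flow \<eta> m) * fst p (flow \<eta> m))) =
        Re (integral cube (\<lambda>\<eta>. w0 p (flow \<eta> m) * fst p (flow \<eta> m)))" .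
    moreover have "integral cube (\<lambda>\<eta>. w0 p (flow \<eta> m) * fst p (flow \<eta> m)) = w p m * fst p m"
      using fourier_mult_equivariant[OF L(5)[OF p], of "- snd p" "w0 p" m]
      by (simp add: w_def fourier_def)
    ultimately show ?thesis by (simp add: o_def)
  qed
  show ?thesis
    unfolding decomposition_datum_def
  proof (intro exI[of _ \<psi>] exI[of _ K] exI[of _ w] conjI allI ballI)
    show "smooth_map \<psi>" unfolding \<psi>_def using X by (auto simp: equivariant_def intro: smooth_map_Re)
    show "\<psi> (flow \<xi> m) = \<psi> m" for \<xi> m using X by (simp add: \<psi>_def equivariant_def)
    show pos: "\<psi> m \<ge> 0" for m unfolding \<psi>
      by (intro integral_nonneg integrable_continuous cont L)
    show "\<psi> m0 > 0"
    proof (rule ccontr)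
      assume "\<not> \<psi> m0 > 0"
      then have "integral cube (\<lambda>\<eta>. \<psi>0 (flow \<eta> m0)) = 0" using pos[of m0] \<psi>[of m0] by simp
      moreover have "box 0 (1 :: real ^ 'k) \<noteq> {}" by (simp add: interval_ne_empty_cart)
      ultimately have "\<forall>\<eta>\<in>cube. \<psi>0 (flow \<eta> m0) = 0"
        by (subst integral_cbox_eq_0_iff[symmetric]) (auto intro: cont L)
      moreover have "(0 :: real ^ 'k) \<in> cube" by (simp add: mem_box_cart)
      ultimately have "\<psi>0 (flow 0 m0) = 0" by blast
      then show False using L(3) by simp
    qed
    fix p assume p: "p \<in> K"
    show "equivariant (fst p) (snd p)" by (rule L(5)[OF p])
    then have "weight (- snd p)" by (simp add: equivariant_def weight_def)
    then show "equivariant (w p) (- snd p)" unfolding w_def by (rule equivariant_fourier[OF L(6)[OF p]])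
  next
    fix m
    have sm: "smooth_map (fst p)" "smooth_map (w0 p)" if "p \<in> K" for p
      using L(5,6)[OF that] by (auto simp: equivariant_def)
    have "\<psi> m *\<^sub>R V m = integral cube (\<lambda>\<eta>. \<psi>0 (flow \<eta> m) *\<^sub>R V m)"
      unfolding \<psi> by (subst integral_linear[OF _ bounded_linear_scaleR_left, unfolded o_def])
        (auto intro: integrable_continuous cont L)
    also have "\<dots> = integral cube (\<lambda>\<eta>. \<Sum>p\<in>K. Re (w0 p (flow \<eta> m) * fst p (flow \<eta> m)) *\<^sub>R snd p)"
      by (simp only: L(7)[symmetric] Vinv)
    also have "\<dots> = (\<Sum>p\<in>K. integral cube (\<lambda>\<eta>. Re (w0 p (flow \<eta> m) * fst p (flow \<eta> m)) *\<^sub>R snd p))"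
      by (intro integral_sum L(4) integrable_continuous continuous_on_scaleR continuous_on_Re continuous_on_mult continuous_on_const cont sm)
    also have "\<dots> = (\<Sum>p\<in>K. Re (w p m * fst p m) *\<^sub>R snd p)"
    proof (rule sum.cong)
      fix p assume p: "p \<in> K"
      have "integral cube (\<lambda>\<eta>. Re (w0 p (flow \<eta> m) * fst p (flow \<eta> m)) *\<^sub>R snd p) =
          integral cube (\<lambda>\<eta>. Re (w0 p (flow \<eta> m) * fst p (flow \<eta> m))) *\<^sub>R snd p"
        by (rule integral_linear[OF _ bounded_linear_scaleR_left, unfolded o_def])
          (intro integrable_continuous continuous_on_Re continuous_on_mult continuous_on_const cont sm p)
      then show "integral cube (\<lambda>\<eta>. Re (w0 p (flow \<eta> m) * fst p (flow \<eta> m)) *\<^sub>R snd p) =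
          Re (w p m * fst p m) *\<^sub>R snd p" by (simp only: wz[OF p])
    qed simp
    finally show "\<psi> m *\<^sub>R V m = (\<Sum>p\<in>K. Re (w p m * fst p m) *\<^sub>R snd p)" .
  qed (rule L(4))
qed

section \<open>Gluing\<close>

text \<open>
  The extension of a derivation to complex functions.
\<close>

definition complexify :: "(('m \<Rightarrow> real) \<Rightarrow> real) \<Rightarrow> ('m \<Rightarrow> complex) \<Rightarrow> complex" where
  "complexify v z = Complex (v (\<lambda>x. Re (z x))) (v (\<lambda>x. Im (z x)))"

lemma complexify_generating_field:
  assumes z: "equivariant z \<alpha>"
  shows "complexify (generating_field M \<rho> \<xi> m) z = of_real (\<alpha> \<bullet> \<xi>) * (2 * pi * \<i> * z m)"
proof -
  have flow: "z (flow (t *\<^sub>R \<xi>) m) = cis (2 * pi * (t * (\<alpha> \<bullet> \<xi>))) * z m" for t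
    using z by (simp add: equivariant_def character_def)
  have sm: "smooth_function M (\<lambda>x. Re (z x))" "smooth_function M (\<lambda>x. Im (z x))"
    using z by (auto simp: equivariant_def smooth_function_iff intro: smooth_map_Re smooth_map_Im)
  have "((\<lambda>t. Re (z (flow (t *\<^sub>R \<xi>) m))) has_real_derivative - (2 * pi * (\<alpha> \<bullet> \<xi>) * Im (z m))) (at 0)"
    unfolding flow by (auto intro!: derivative_eq_intros)
  moreover have "((\<lambda>t. Im (z (flow (t *\<^sub>R \<xi>) m))) has_real_derivative 2 * pi * (\<alpha> \<bullet> \<xi>) * Re (z m)) (at 0)"
    unfolding flow by (auto intro!: derivative_eq_intros)
  ultimately show ?thesis
    using sm by (simp add: complexify_def generating_field_def DERIV_imp_deriv complex_eq_iff algebra_simps)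
qed

lemma complexify_pushforward:
  assumes z: "equivariant z \<alpha>" and v: "v \<in> tangent_space M m"
  shows "complexify (pushforward M (flow \<xi>) v) z = character \<alpha> \<xi> * complexify v z"
proof -
  define \<theta> where "\<theta> = 2 * pi * (\<alpha> \<bullet> \<xi>)"
  have sm: "smooth_function M (\<lambda>x. Re (z x))" "smooth_function M (\<lambda>x. Im (z x))"
    using z by (auto simp: equivariant_def smooth_function_iff intro: smooth_map_Re smooth_map_Im)
  have lin: "v (\<lambda>x. a * f x + b * g x) = a * v f + b * v g"
    if "smooth_function M f" "smooth_function M g" for f g a b
    using v that by (simp add: tangent_space_def)
  have "z (flow \<xi> x) = cis \<theta> * z x" for x
    using z by (simp add: equivariant_def character_def \<theta>_def)
  then have "(\<lambda>x. Re (z x)) \<circ> flow \<xi> = (\<lambda>x. cos \<theta> * Re (z x) + (- sin \<theta>) * Im (z x))"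
    "(\<lambda>x. Im (z x)) \<circ> flow \<xi> = (\<lambda>x. sin \<theta> * Re (z x) + cos \<theta> * Im (z x))"
    by (auto simp: fun_eq_iff)
  then show ?thesis
    using sm lin[OF sm, of "cos \<theta>" "- sin \<theta>"] lin[OF sm, of "sin \<theta>" "cos \<theta>"]
    by (simp add: complexify_def pushforward_def character_def \<theta>_def[symmetric] complex_eq_iff)
qed

text \<open>
  The one-form \<open>\<Sum> Re (w dz / 2\<pi>i)\<close>, summed over the eigenfunctions \<open>z\<close> of the datum.
\<close>

definition datum_form ::
  "('m, 'k) eigenpair set \<Rightarrow> (('m, 'k) eigenpair \<Rightarrow> 'm \<Rightarrow> complex) \<Rightarrow> 'm \<Rightarrow> (('m \<Rightarrow> real) \<Rightarrow> real) \<Rightarrow> real"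
  where "datum_form K w m v = (\<Sum>p\<in>K. Re (w p m * complexify v (fst p) / (2 * pi * \<i>)))"

lemma datum_form_linear:
  "datum_form K w m (\<lambda>f. a * v f + b * u f) = a * datum_form K w m v + b * datum_form K w m u"
proof -
  have "complexify (\<lambda>f. a * v f + b * u f) z = of_real a * complexify v z + of_real b * complexify u z" for z
    by (simp add: complexify_def complex_eq_iff)
  moreover have "Re (y * (of_real a * c + of_real b * d) / k) = a * Re (y * c / k) + b * Re (y * d / k)"
    for y c d k :: complex
  proof -
    have "y * (of_real a * c + of_real b * d) / k = a *\<^sub>R (y * c / k) + b *\<^sub>R (y * d / k)"
      by (simp add: scaleR_conv_of_real add_divide_distrib algebra_simps)
    then show ?thesis by simp
  qed
  ultimately show ?thesis
    by (simp add: datum_form_def sum_distrib_left sum.distrib[symmetric])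
qed

lemma datum_form_smooth:
  assumes D: "decomposition_datum V \<psi> K w" and X: "smooth_vector_field M X"
  shows "smooth_map (\<lambda>m. datum_form K w m (X m))"
proof -
  have Xf: "smooth_map (\<lambda>m. X m f)" if "smooth_map f" for f
    using X that by (simp add: smooth_vector_field_def smooth_function_iff)
  have "Re (y * Complex a b / (2 * pi * \<i>)) = (1 / (2 * pi)) * (Re y * b + Im y * a)" for y a b
    by (simp add: Re_divide power2_eq_square field_simps)
  moreover have "smooth_map (\<lambda>m. (1 / (2 * pi)) *
      (Re (w p m) * X m (\<lambda>x. Im (fst p x)) + Im (w p m) * X m (\<lambda>x. Re (fst p x))))" if p: "p \<in> K" for p
  proof -
    have "smooth_map (fst p)" "smooth_map (w p)"
      using D p by (auto simp: decomposition_datum_def equivariant_def)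
    then show ?thesis
      by (intro smooth_map_add smooth_map_mult smooth_map_const Xf smooth_map_Re smooth_map_Im)
  qed
  ultimately show ?thesis unfolding datum_form_def complexify_def by (intro smooth_map_sum) (simp only:)
qed

text \<open>
  The weights of \<open>w p\<close> and of the differential of the eigenfunction cancel.
\<close>

lemma datum_form_invariant:
  assumes D: "decomposition_datum V \<psi> K w" and v: "v \<in> tangent_space M m"
  shows "datum_form K w (flow \<xi> m) (pushforward M (flow \<xi>) v) = datum_form K w m v"
  unfolding datum_form_def
proof (rule sum.cong)
  fix p assume p: "p \<in> K"
  have e: "equivariant (fst p) (snd p)" "equivariant (w p) (- snd p)"
    using D p by (auto simp: decomposition_datum_def)
  have "w p (flow \<xi> m) = character (- snd p) \<xi> * w p m" using e(2) by (simp add: equivariant_def)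
  then have "w p (flow \<xi> m) * complexify (pushforward M (flow \<xi>) v) (fst p) =
      (character (- snd p) \<xi> * character (snd p) \<xi>) * (w p m * complexify v (fst p))"
    by (simp only: complexify_pushforward[OF e(1) v] mult_ac)
  then show "Re (w p (flow \<xi> m) * complexify (pushforward M (flow \<xi>) v) (fst p) / (2 * pi * \<i>)) =
      Re (w p m * complexify v (fst p) / (2 * pi * \<i>))"
    by (simp only: character_minus mult_1)
qed simp

lemma datum_form_generating_field:
  assumes D: "decomposition_datum V \<psi> K w"
  shows "datum_form K w m (generating_field M \<rho> \<xi> m) = \<psi> m * (V m \<bullet> \<xi>)"
proof -
  have "\<psi> m * (V m \<bullet> \<xi>) = (\<psi> m *\<^sub>R V m) \<bullet> \<xi>" by simp
  also have "\<dots> = (\<Sum>p\<in>K. Re (w p m * fst p m) * (snd p \<bullet> \<xi>))"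
    using D by (simp add: decomposition_datum_def inner_sum_left)
  also have "\<dots> = datum_form K w m (generating_field M \<rho> \<xi> m)"
    unfolding datum_form_def
  proof (rule sum.cong)
    fix p assume p: "p \<in> K"
    have e: "equivariant (fst p) (snd p)" using D p by (auto simp: decomposition_datum_def)
    have cancel: "u * (of_real a * (k * z)) / k = a *\<^sub>R (u * z)" if "k \<noteq> 0" for u z k :: complex and a
      using that by (simp add: scaleR_conv_of_real mult_ac)
    have "w p m * complexify (generating_field M \<rho> \<xi> m) (fst p) / (2 * pi * \<i>) =
        (snd p \<bullet> \<xi>) *\<^sub>R (w p m * fst p m)"
      unfolding complexify_generating_field[OF e] by (rule cancel) simp
    then show "Re (w p m * fst p m) * (snd p \<bullet> \<xi>) =
        Re (w p m * complexify (generating_field M \<rho> \<xi> m) (fst p) / (2 * pi * \<i>))"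
      by (simp only: scaleR_complex.simps mult.commute)
  qed simp
  finally show ?thesis by simp
qed

text \<open>
  Countably many decomposition data have functions \<open>X i\<close> whose sets of positivity cover the manifold.
  The factor \<open>\<kappa> i\<close>, a function of \<open>X 0, \<dots>, X (i - 1)\<close>, vanishes as soon as one of these is at least
  \<open>1 / (i + 1)\<close>. So if \<open>X j\<close> is positive at a point, then \<open>\<kappa> i\<close> vanishes near that point for all large \<open>i\<close>,
  and the sums are locally finite. On the other hand \<open>\<kappa> i X i\<close> is positive for the least \<open>i\<close> with \<open>X i\<close>
  positive. All factors are invariant since the \<open>X i\<close> are.
\<close>

lemma invariant_form_exists:
  fixes V :: "'m \<Rightarrow> real ^ 'k"
  assumes V: "smooth_map V" and Vinv: "\<And>\<xi> m. V (flow \<xi> m) = V m"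
    and Vst: "\<And>\<xi> m. generating_field M \<rho> \<xi> m = (\<lambda>f. 0) \<Longrightarrow> V m \<bullet> \<xi> = 0"
  shows "\<exists>\<mu>. one_form M \<mu> \<and> invariant_form M UNIV \<rho> \<mu> \<and>
    (\<forall>\<xi> m. V m \<bullet> \<xi> = \<mu> m (generating_field M \<rho> \<xi> m))"
proof -
  have ex: "\<exists>t. decomposition_datum V (fst t) (fst (snd t)) (snd (snd t)) \<and> fst t m0 > 0" for m0
    using invariant_local_decomposition[OF V Vinv Vst, of m0] unfolding split_paired_Ex by (simp only: fst_conv snd_conv)
  define t where "t m0 = (SOME t. decomposition_datum V (fst t) (fst (snd t)) (snd (snd t)) \<and> fst t m0 > 0)" for m0
  note t = someI_ex[OF ex, folded t_def, THEN conjunct1] someI_ex[OF ex, folded t_def, THEN conjunct2]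
  define U where "U m0 = {x. fst (t m0) x > 0}" for m0
  have "open (U m0)" for m0
    unfolding U_def
    by (intro open_Collect_less continuous_on_const smooth_map_continuous)
      (use t(1)[of m0] in \<open>simp add: decomposition_datum_def\<close>)
  then have oU: "open S" if "S \<in> range U" for S using that by auto
  obtain F where F: "F \<subseteq> range U" "countable F" "\<Union>F = \<Union>(range U)"
    by (rule Lindelof[OF oU])
  obtain S where S: "countable S" "F = U ` S" using F(1,2) countable_subset_image by metis
  have cov: "\<exists>s\<in>S. x \<in> U s" for x
    using F(3) S(2) t(2)[of x] by (auto simp: U_def)
  then have "S \<noteq> {}" by blast
  define s where "s = from_nat_into S"
  have rs: "range s = S" unfolding s_def by (rule range_from_nat_into[OF \<open>S \<noteq> {}\<close> S(1)])
  define X where "X i = fst (t (s i))" for i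
  define K where "K i = fst (snd (t (s i)))" for i
  define w where "w i = snd (snd (t (s i)))" for i
  have D: "decomposition_datum V (X i) (K i) (w i)" for i using t(1) by (simp add: X_def K_def w_def)
  have Xs: "smooth_map (X i)" and X0: "X i m \<ge> 0" and Xinv: "X i (flow \<xi> m) = X i m" for i m \<xi>
    using D[of i] by (auto simp: decomposition_datum_def)
  have Xcov: "\<exists>i. X i m > 0" for m
  proof -
    obtain a where a: "a \<in> S" "m \<in> U a" using cov by blast
    then obtain i where "a = s i" using rs by blast
    then show ?thesis using a by (auto simp: U_def X_def)
  qed
  define \<kappa> where "\<kappa> i m = (\<Prod>j<i. flat 0 (1 / real (Suc i) - X j m))" for i m
  have \<kappa>s: "smooth_map (\<kappa> i)" for i unfolding \<kappa>_def
    by (intro smooth_map_prod smooth_map_real_compose[OF smooth_flat] smooth_map_diff smooth_map_const Xs)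
  have \<kappa>0: "\<kappa> i m \<ge> 0" for i m unfolding \<kappa>_def by (intro prod_nonneg) (simp add: flat_def)
  have \<kappa>inv: "\<kappa> i (flow \<xi> m) = \<kappa> i m" for i \<xi> m by (simp add: \<kappa>_def Xinv)
  have fin: "\<exists>N n. open N \<and> m \<in> N \<and> (\<forall>x\<in>N. \<forall>i\<ge>n. \<kappa> i x = 0)" for m
  proof -
    obtain j where j: "X j m > 0" using Xcov by blast
    define N where "N = {x. X j m / 2 < X j x}"
    have oN: "open N" unfolding N_def
      by (intro open_Collect_less continuous_on_const smooth_map_continuous Xs)
    obtain n0 where n0: "1 / real (Suc n0) < X j m / 2" using j nat_approx_posE[of "X j m / 2"] by auto
    have "\<kappa> i x = 0" if "x \<in> N" "i \<ge> max (Suc j) n0" for i x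
    proof -
      have "1 / real (Suc i) \<le> 1 / real (Suc n0)" using that(2) by (simp add: frac_le)
      then have "flat 0 (1 / real (Suc i) - X j x) = 0"
        using n0 that(1) by (simp add: flat_def N_def)
      moreover have "j \<in> {..<i}" using that(2) by simp
      ultimately show ?thesis unfolding \<kappa>_def by (intro prod_zero finite_lessThan bexI)
    qed
    moreover have "m \<in> N" using j by (simp add: N_def)
    ultimately show ?thesis using oN by blast
  qed
  have pos: "\<exists>i. \<kappa> i m * X i m > 0" for m
  proof -
    define i where "i = (LEAST i. X i m > 0)"
    have i: "X i m > 0" unfolding i_def using Xcov[of m] by (rule LeastI_ex)
    have "X j m = 0" if "j < i" for j
      using not_less_Least[OF that[unfolded i_def]] X0[of j m] by linarith
    then have "\<kappa> i m > 0" unfolding \<kappa>_def by (intro prod_pos) (simp add: flat_def)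
    with i show ?thesis by (intro exI[of _ i]) simp
  qed
  define I where "I m = {i. \<kappa> i m \<noteq> 0}" for m
  have sumI: "(\<Sum>i\<in>I x. \<kappa> i x * g i) = (\<Sum>i<n. \<kappa> i x * g i)" if "\<forall>i\<ge>n. \<kappa> i x = 0" for x n and g :: "nat \<Rightarrow> real"
    by (rule sum.mono_neutral_left) (use that in \<open>auto simp: I_def not_le[symmetric]\<close>)
  define T where "T m = (\<Sum>i\<in>I m. \<kappa> i m * X i m)" for m
  define \<mu> where "\<mu> m v = inverse (T m) * (\<Sum>i\<in>I m. \<kappa> i m * datum_form (K i) (w i) m v)" for m v
  have Tpos: "T m > 0" for m
  proof -
    obtain i where i: "\<kappa> i m * X i m > 0" using pos by blast
    obtain n where "\<forall>i\<ge>n. \<kappa> i m = 0" using fin[of m] by blast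
    then have "finite (I m)" by (intro finite_subset[of "I m" "{..<n}"]) (auto simp: I_def not_le[symmetric])
    moreover have "i \<in> I m" using i by (auto simp: I_def)
    ultimately show ?thesis unfolding T_def
      by (rule sum_pos2) (use i \<kappa>0 X0 in auto)
  qed
  have loc: "smooth_map (\<lambda>m. \<Sum>i\<in>I m. \<kappa> i m * g i m)" if g: "\<And>i. smooth_map (g i)" for g :: "nat \<Rightarrow> 'm \<Rightarrow> real"
  proof (rule smooth_map_local)
    fix m
    obtain N n where N: "open N" "m \<in> N" "\<forall>x\<in>N. \<forall>i\<ge>n. \<kappa> i x = 0" using fin by blast
    show "\<exists>h N. open N \<and> m \<in> N \<and> smooth_map h \<and> (\<forall>x\<in>N. (\<Sum>i\<in>I x. \<kappa> i x * g i x) = h x)"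
    proof (intro exI[of _ "\<lambda>x. \<Sum>i<n. \<kappa> i x * g i x"] exI[of _ N] conjI N ballI)
      show "smooth_map (\<lambda>x. \<Sum>i<n. \<kappa> i x * g i x)"
        by (intro smooth_map_sum smooth_map_mult \<kappa>s g)
      show "(\<Sum>i\<in>I x. \<kappa> i x * g i x) = (\<Sum>i<n. \<kappa> i x * g i x)" if "x \<in> N" for x
        by (rule sumI) (use N(3) that in blast)
    qed
  qed
  show ?thesis
  proof (intro exI[of _ \<mu>] conjI allI)
    show "one_form M \<mu>"
      unfolding one_form_def
    proof (intro conjI allI ballI impI)
      show "\<mu> m (\<lambda>f. a * v f + b * u f) = a * \<mu> m v + b * \<mu> m u" for m v u a b
      proof -
        have "(\<Sum>i\<in>I m. \<kappa> i m * datum_form (K i) (w i) m (\<lambda>f. a * v f + b * u f)) =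
          a * (\<Sum>i\<in>I m. \<kappa> i m * datum_form (K i) (w i) m v) + b * (\<Sum>i\<in>I m. \<kappa> i m * datum_form (K i) (w i) m u)"
          unfolding sum_distrib_left sum.distrib[symmetric]
          by (rule sum.cong) (simp_all add: datum_form_linear algebra_simps)
        then show ?thesis by (simp add: \<mu>_def algebra_simps)
      qed
      fix Y assume Y: "smooth_vector_field M Y"
      have "smooth_map (\<lambda>m. \<mu> m (Y m))" unfolding \<mu>_def
      proof (rule smooth_map_mult)
        show "smooth_map (\<lambda>m. inverse (T m))"
          unfolding T_def using Tpos unfolding T_def
          by (intro smooth_map_inverse loc Xs) (metis less_irrefl)
        show "smooth_map (\<lambda>m. \<Sum>i\<in>I m. \<kappa> i m * datum_form (K i) (w i) m (Y m))"
          by (intro loc datum_form_smooth[OF D Y])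
      qed
      then show "smooth_function M (\<lambda>m. \<mu> m (Y m))" by (simp add: smooth_function_iff)
    qed
    show "invariant_form M UNIV \<rho> \<mu>"
      unfolding invariant_form_def
    proof (intro ballI allI)
      fix g m v assume g: "g \<in> carrier (torus (UNIV :: (real ^ 'k) set))" and v: "v \<in> tangent_space M m"
      then obtain \<xi> where \<xi>: "g = torus_exp \<xi>" by (auto simp: torus_def)
      have "I (flow \<xi> m) = I m" by (simp add: I_def \<kappa>inv)
      moreover have "T (flow \<xi> m) = T m" by (simp add: T_def I_def \<kappa>inv Xinv)
      ultimately show "\<mu> (\<rho> g m) (pushforward M (\<rho> g) v) = \<mu> m v"
        by (simp add: \<xi> \<mu>_def \<kappa>inv datum_form_invariant[OF D v])
    qed
    fix \<xi> m
    have "(\<Sum>i\<in>I m. \<kappa> i m * datum_form (K i) (w i) m (generating_field M \<rho> \<xi> m)) = T m * (V m \<bullet> \<xi>)"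
      unfolding T_def sum_distrib_right
      by (rule sum.cong) (simp_all add: datum_form_generating_field[OF D])
    then show "V m \<bullet> \<xi> = \<mu> m (generating_field M \<rho> \<xi> m)"
      using Tpos[of m] by (simp add: \<mu>_def)
  qed
qed

end

section \<open>Vanishing on infinitesimal stabilizers\<close>

lemma constant_on_connected_subset:
  assumes loc: "locally (\<lambda>U. f constant_on U) S" and X: "connected X" "X \<subseteq> S"
  shows "f constant_on X"
proof (rule locally_constant_imp_constant[OF X(1)])
  fix a assume a: "a \<in> X"
  then have "openin (top_of_set S) S \<and> a \<in> S" using X(2) by auto
  then obtain U V where UV: "openin (top_of_set S) U" "f constant_on V" "a \<in> U" "U \<subseteq> V"
    using loc unfolding locally_def by meson
  then obtain O1 where O1: "open O1" "U = S \<inter> O1" by (auto simp: openin_open)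
  have "openin (top_of_set X) (X \<inter> O1)" using O1(1) by (simp add: openin_open_Int)
  moreover have "f x = f a" if "x \<in> X \<inter> O1" for x
    using UV O1(2) X(2) that a unfolding constant_on_def by (metis IntD1 IntD2 IntI subsetD)
  moreover have "a \<in> X \<inter> O1" using a UV(3) O1(2) by blast
  ultimately show "\<exists>T. openin (top_of_set X) T \<and> a \<in> T \<and> (\<forall>x\<in>T. f x = f a)" by blast
qed

text \<open>
  For a stratum \<open>X\<close> this is a closed subgroup whose Lie algebra contains the infinitesimal stabilizer
  of the stratum.
\<close>

lemma lie_subgroup_common_stabilizer:
  fixes \<rho> :: "complex ^ 'k::finite \<Rightarrow> 'm::t2_space \<Rightarrow> 'm"
  assumes act: "group_action (torus (UNIV :: (real ^ 'k) set)) UNIV \<rho>"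
    and cont: "\<And>m. continuous_on UNIV (\<lambda>\<xi>. \<rho> (torus_exp \<xi>) m)" and X: "X \<noteq> {}"
  shows "lie_subgroup (UNIV :: (real ^ 'k) set) (\<Inter>x\<in>X. stabilizer (torus (UNIV :: (real ^ 'k) set)) \<rho> x)"
  unfolding lie_subgroup_def
proof
  let ?T = "torus (UNIV :: (real ^ 'k) set)"
  interpret A: group_action ?T UNIV \<rho> by (rule act)
  interpret group ?T by (rule group_torus) (simp add: model_space_def)
  show "subgroup (\<Inter>x\<in>X. stabilizer ?T \<rho> x) ?T"
    by (rule subgroups_Inter) (use X A.stabilizer_subgroup in auto)
  show "closed (\<Inter>x\<in>X. stabilizer ?T \<rho> x)"
  proof (rule closed_INT, rule ballI)
    fix x
    have "continuous_on (range (torus_exp :: real ^ 'k \<Rightarrow> _)) (\<lambda>g. \<rho> g x)"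
      by (rule continuous_on_torus[OF cont])
    then have "closed (range (torus_exp :: real ^ 'k \<Rightarrow> _) \<inter> (\<lambda>g. \<rho> g x) -` {x})"
      by (rule continuous_closed_preimage[OF _ compact_imp_closed[OF compact_torus] closed_singleton])
    moreover have "stabilizer ?T \<rho> x = range (torus_exp :: real ^ 'k \<Rightarrow> _) \<inter> (\<lambda>g. \<rho> g x) -` {x}"
      by (auto simp: stabilizer_def torus_def)
    ultimately show "closed (stabilizer ?T \<rho> x)" by simp
  qed
qed

lemma common_stabilizer_lie_algebra:
  fixes \<rho> :: "complex ^ 'k::finite \<Rightarrow> 'm \<Rightarrow> 'm"
  assumes "\<And>x t. x \<in> X \<Longrightarrow> \<rho> (torus_exp (t *\<^sub>R \<xi>)) x = x"
  shows "\<xi> \<in> lie_algebra UNIV (\<Inter>x\<in>X. stabilizer (torus (UNIV :: (real ^ 'k) set)) \<rho> x)"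
  using assms by (auto simp: lie_algebra_def stabilizer_def torus_def)

lemma common_stabilizer_fixed_points:
  "X \<subseteq> fixed_points \<rho> (\<Inter>x\<in>X. stabilizer G \<rho> x)"
  by (auto simp: fixed_points_def stabilizer_def)

lemma vanishes_if_restrictions_vanish:
  fixes \<rho> :: "complex ^ 'k::finite \<Rightarrow> 'm::t2_space \<Rightarrow> 'm"
  assumes act: "group_action (torus (UNIV :: (real ^ 'k) set)) UNIV \<rho>"
    and cont: "\<And>m. continuous_on UNIV (\<lambda>\<xi>. \<rho> (torus_exp \<xi>) m)"
    and van: "\<forall>H. lie_subgroup UNIV H \<longrightarrow> (\<forall>m\<in>fixed_points \<rho> H.
                restrict (\<Psi> m) (lie_algebra UNIV H) = restrict (\<lambda>\<xi>. 0) (lie_algebra UNIV H))"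
    and fixed: "\<And>t. \<rho> (torus_exp (t *\<^sub>R \<xi>)) m = m"
  shows "\<Psi> m \<xi> = (0::real)"
proof -
  let ?H = "\<Inter>x\<in>{m}. stabilizer (torus (UNIV :: (real ^ 'k) set)) \<rho> x"
  have H: "lie_subgroup UNIV ?H" by (rule lie_subgroup_common_stabilizer[OF act cont]) simp
  have m: "m \<in> fixed_points \<rho> ?H" using common_stabilizer_fixed_points[of "{m}" \<rho>] by simp
  have "restrict (\<Psi> m) (lie_algebra UNIV ?H) = restrict (\<lambda>\<xi>. 0) (lie_algebra UNIV ?H)"
    using van H m by blast
  moreover have "\<xi> \<in> lie_algebra UNIV ?H" by (rule common_stabilizer_lie_algebra) (simp add: fixed)
  ultimately show ?thesis by (metis restrict_apply')
qed

text \<open>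
  The restriction of \<open>\<Psi>\<close> to the infinitesimal stabilizer of the stratum of \<open>m\<close> is constant on the stratum,
  which is a connected set of fixed points of the common stabilizer. So the assignment has an actual
  value there, the restriction of \<open>\<Psi> m\<close>.
\<close>

lemma vanishes_if_assignment_vanishes:
  fixes M :: "('m::t2_space, 'e::euclidean_space) manifold"
    and \<rho> :: "complex ^ 'k::finite \<Rightarrow> 'm \<Rightarrow> 'm"
  assumes act: "group_action (torus (UNIV :: (real ^ 'k) set)) UNIV \<rho>"
    and cont: "\<And>m. continuous_on UNIV (\<lambda>\<xi>. \<rho> (torus_exp \<xi>) m)"
    and sub: "\<And>m. subspace (inf_stabilizer M UNIV \<rho> m)"
    and fixed: "\<And>\<xi> m t. generating_field M \<rho> \<xi> m = (\<lambda>f. 0) \<Longrightarrow> \<rho> (torus_exp (t *\<^sub>R \<xi>)) m = m"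
    and mom: "abstract_moment_map M UNIV \<rho> \<Psi>"
    and van: "\<forall>X\<in>inf_orbit_type_strata M UNIV \<rho>.
             assignment M UNIV \<rho> \<Psi> X = restrict (\<lambda>\<xi>. 0) (stratum_stabilizer M UNIV \<rho> X)"
    and \<xi>: "generating_field M \<rho> \<xi> m = (\<lambda>f. 0)"
  shows "\<Psi> m \<xi> = 0"
proof -
  define \<hh> where "\<hh> = inf_stabilizer M UNIV \<rho> m"
  define S where "S = {m. inf_stabilizer M UNIV \<rho> m = \<hh>}"
  define X where "X = connected_component_set S m"
  have mS: "m \<in> S" by (simp add: S_def \<hh>_def)
  have X: "X \<in> components S" "m \<in> X" "connected X" "X \<subseteq> S"
    using mS by (auto simp: X_def components_def connected_component_subset)
  have Xst: "X \<in> inf_orbit_type_strata M UNIV \<rho>"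
    unfolding inf_orbit_type_strata_def
    by (rule UN_I[of \<hh>]) (use X(1) sub[of m] in \<open>auto simp: S_def \<hh>_def\<close>)
  have st: "inf_stabilizer M UNIV \<rho> x = \<hh>" if "x \<in> X" for x
    using that X(4) by (auto simp: S_def)
  have stX: "stratum_stabilizer M UNIV \<rho> X = \<hh>"
    unfolding stratum_stabilizer_def by (rule the_equality) (use st X(2) in auto)
  let ?H = "\<Inter>x\<in>X. stabilizer (torus (UNIV :: (real ^ 'k) set)) \<rho> x"
  have H: "lie_subgroup UNIV ?H" by (rule lie_subgroup_common_stabilizer[OF act cont]) (use X(2) in blast)
  have "locally (\<lambda>U. (\<lambda>m. restrict (\<Psi> m) (lie_algebra UNIV ?H)) constant_on U) (fixed_points \<rho> ?H)"
    using mom H by (simp add: abstract_moment_map_def)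
  then have con: "(\<lambda>m. restrict (\<Psi> m) (lie_algebra UNIV ?H)) constant_on X"
    by (rule constant_on_connected_subset[OF _ X(3) common_stabilizer_fixed_points])
  have inH: "\<eta> \<in> lie_algebra UNIV ?H" if "\<eta> \<in> \<hh>" for \<eta>
    by (rule common_stabilizer_lie_algebra, rule fixed)
      (use st that in \<open>auto simp: inf_stabilizer_def\<close>)
  have same: "restrict (\<Psi> x) \<hh> = restrict (\<Psi> m) \<hh>" if x: "x \<in> X" for x
  proof
    fix \<eta>
    have "restrict (\<Psi> x) (lie_algebra UNIV ?H) = restrict (\<Psi> m) (lie_algebra UNIV ?H)"
      using con x X(2) unfolding constant_on_def by metis
    then show "restrict (\<Psi> x) \<hh> \<eta> = restrict (\<Psi> m) \<hh> \<eta>"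
      using inH[of \<eta>] by (cases "\<eta> \<in> \<hh>") (metis restrict_apply, simp)
  qed
  have "assignment M UNIV \<rho> \<Psi> X = restrict (\<Psi> m) \<hh>"
    unfolding assignment_def stX
  proof (rule the_equality)
    show "\<forall>x\<in>X. restrict (\<Psi> x) \<hh> = restrict (\<Psi> m) \<hh>" using same by blast
    show "\<alpha> = restrict (\<Psi> m) \<hh>" if "\<forall>x\<in>X. restrict (\<Psi> x) \<hh> = \<alpha>" for \<alpha>
      using bspec[OF that X(2)] by (rule sym)
  qed
  then have "restrict (\<Psi> m) \<hh> = restrict (\<lambda>\<xi>. 0) \<hh>" using bspec[OF van Xst] stX by simp
  moreover have "\<xi> \<in> \<hh>" using \<xi> by (simp add: \<hh>_def inf_stabilizer_def)
  ultimately show ?thesis by (metis restrict_apply')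
qed

section \<open>Zero-dimensional manifolds and the trivial torus\<close>

text \<open>
  In both cases the zero form does, because \<open>\<Psi>\<close> is zero. For the trivial torus this is its linearity. A
  manifold of dimension zero is discrete, so the connected torus acts trivially on it and all generating
  fields vanish.
\<close>

lemma Ck_on_0:
  fixes W :: "'a::real_normed_vector set"
  assumes "(E = UNIV \<and> open W) \<or> E = {0}"
  shows "Ck_on k E W (\<lambda>x. 0 :: 'b::real_normed_vector)"
proof (induction k)
  case (Suc k)
  show ?case
  proof (cases "E = {0}")
    case True
    have "((\<lambda>x. 0 :: 'b) has_derivative frechet_derivative (\<lambda>x. 0) (at x within W)) (at x within W)" for x
      using frechet_derivative_works differentiable_const by blast
    then have "frechet_derivative (\<lambda>x. 0 :: 'b) (at x within W) 0 = 0" for x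
      using has_derivative_linear linear_0 by blast
    then show ?thesis using True Suc by simp
  next
    case False
    then show ?thesis using assms Ck_const[of W "Suc k" 0] by blast
  qed
qed simp

lemma zero_form:
  fixes M :: "('m::{t2_space, second_countable_topology}, 'e::euclidean_space) manifold"
  assumes "smooth_manifold M"
  shows "one_form M (\<lambda>m v. 0)" "invariant_form M \<gg> \<rho> (\<lambda>m v. 0)"
proof -
  have "smooth_function M (\<lambda>m. 0)"
    unfolding smooth_function_def
  proof (rule ballI, clarify)
    fix U \<phi> assume "(U, \<phi>) \<in> atlas M"
    then have "chart (model M) (U, \<phi>)" "model_space (model M)"
      using assms by (auto simp: smooth_manifold_def)
    then have "(model M = UNIV \<and> open (\<phi> ` U)) \<or> model M = {0}"
      by (auto simp: chart_def model_space_def)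
    then show "smooth_on (model M) (\<phi> ` U) ((\<lambda>m. 0) \<circ> inv_into U \<phi>)"
      unfolding smooth_on_def o_def using Ck_on_0 by blast
  qed
  then show "one_form M (\<lambda>m v. 0)" by (simp add: one_form_def)
  show "invariant_form M \<gg> \<rho> (\<lambda>m v. 0)" by (simp add: invariant_form_def)
qed

lemma open_singleton_if_model_0:
  fixes M :: "('m::{t2_space, second_countable_topology}, 'e::euclidean_space) manifold"
  assumes M: "smooth_manifold M" "model M = {0}"
  shows "open {m :: 'm}"
proof -
  have "(\<Union>c\<in>atlas M. fst c) = UNIV" using M by (simp add: smooth_manifold_def)
  then obtain c where c: "c \<in> atlas M" "m \<in> fst c" by blast
  then have "chart {0} c" using M by (auto simp: smooth_manifold_def)
  then have U: "open (fst c)" "snd c ` fst c \<subseteq> {0}" "homeomorphism (fst c) (snd c ` fst c) (snd c) (inv_into (fst c) (snd c))"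
    by (auto simp: chart_def split_beta dest: openin_imp_subset)
  have "x = m" if "x \<in> fst c" for x
  proof -
    have "snd c x \<in> {0}" "snd c m \<in> {0}"
      using U(2) that c(2) by (blast intro: imageI)+
    then have "snd c x = snd c m" by simp
    then show ?thesis using U(3) that c(2) unfolding homeomorphism_def by metis
  qed
  then have "fst c = {m}" using c(2) by blast
  with U(1) show ?thesis by simp
qed

lemma trivial_action_if_discrete:
  fixes \<rho> :: "complex ^ 'k::finite \<Rightarrow> 'm::t2_space \<Rightarrow> 'm"
  assumes op: "open {m}" and cont: "continuous_on UNIV (\<lambda>\<xi> :: real ^ 'k. \<rho> (torus_exp \<xi>) m)"
    and id: "\<rho> (torus_exp (0 :: real ^ 'k)) m = m"
  shows "\<rho> (torus_exp (\<xi> :: real ^ 'k)) m = m"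
proof -
  define S where "S = (\<lambda>\<xi> :: real ^ 'k. \<rho> (torus_exp \<xi>) m) -` {m}"
  have "open S" unfolding S_def by (rule open_vimage[OF op cont])
  moreover have "closed S" unfolding S_def by (rule closed_vimage[OF closed_singleton cont])
  moreover have "0 \<in> S" using id by (simp add: S_def)
  ultimately have "S = UNIV" using clopen[of S] by blast
  then show ?thesis by (auto simp: S_def)
qed

section \<open>Exactness\<close>

theorem theorem4p1:
  fixes M :: "('m::{t2_space, second_countable_topology}, 'e::euclidean_space) manifold"
    and \<gg> :: "(real ^ 'k::finite) set"
    and \<rho> :: "complex ^ 'k \<Rightarrow> 'm \<Rightarrow> 'm"
    and \<Psi> :: "'m \<Rightarrow> real ^ 'k \<Rightarrow> real"
  assumes "smooth_manifold M"
    and "model_space \<gg>"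
    and "smooth_torus_action M \<gg> \<rho>"
    and "abstract_moment_map M \<gg> \<rho> \<Psi>"
  shows "((\<forall>X\<in>inf_orbit_type_strata M \<gg> \<rho>.
             assignment M \<gg> \<rho> \<Psi> X = restrict (\<lambda>\<xi>. 0) (stratum_stabilizer M \<gg> \<rho> X))
          \<longrightarrow> exact_moment_map M \<gg> \<rho> \<Psi>) \<and>
         ((\<forall>H. lie_subgroup \<gg> H \<longrightarrow>
             (\<forall>m\<in>fixed_points \<rho> H.
                restrict (\<Psi> m) (lie_algebra \<gg> H) = restrict (\<lambda>\<xi>. 0) (lie_algebra \<gg> H)))
          \<longrightarrow> (\<exists>\<mu>. one_form M \<mu> \<and> invariant_form M \<gg> \<rho> \<mu> \<and>
                (\<forall>\<xi>\<in>\<gg>. \<forall>m. \<Psi> m \<xi> = \<mu> m (generating_field M \<rho> \<xi> m))))"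
    (is "(?A \<longrightarrow> _) \<and> (?B \<longrightarrow> ?E)")
proof -
  have lin: "\<exists>f. linear f \<and> \<Psi> m = restrict f \<gg>" for m
    using assms(4) by (auto simp: abstract_moment_map_def dual_space_def)
  have trivial: ?E if "\<And>\<xi> m. \<xi> \<in> \<gg> \<Longrightarrow> \<Psi> m \<xi> = 0"
    using zero_form[OF assms(1)] that by (intro exI[of _ "\<lambda>m v. 0"]) simp
  \<comment> \<open>The two hypotheses are used only through the vanishing on infinitesimal stabilizers.\<close>
  have "?A \<or> ?B \<longrightarrow> ?E"
  proof (cases "\<gg> = UNIV")
    case False
    then have "\<gg> = {0}" using assms(2) by (auto simp: model_space_def)
    then have "\<Psi> m \<xi> = 0" if "\<xi> \<in> \<gg>" for m \<xi>
      using lin[of m] that linear_0 by auto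
    then show ?thesis using trivial by blast
  next
    case g: True
    have act: "group_action (torus (UNIV :: (real ^ 'k) set)) UNIV \<rho>"
      and cont2: "continuous_on (UNIV \<times> UNIV) (\<lambda>(\<xi> :: real ^ 'k, m). \<rho> (torus_exp \<xi>) m)"
      using assms(3) by (auto simp: g smooth_torus_action_def)
    have cont: "continuous_on UNIV (\<lambda>\<xi> :: real ^ 'k. \<rho> (torus_exp \<xi>) m)" for m
      by (rule continuous_on_compose2[OF cont2, of _ "\<lambda>\<xi>. (\<xi>, m)", simplified]) (intro continuous_intros)
    have mom: "abstract_moment_map M UNIV \<rho> \<Psi>" using assms(4) g by simp
    have van: "\<Psi> m \<xi> = 0"
      if AB: "?A \<or> ?B" and sub: "\<And>m. subspace (inf_stabilizer M UNIV \<rho> m)"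
        and fixed: "\<And>\<xi> m t. generating_field M \<rho> \<xi> m = (\<lambda>f. 0) \<Longrightarrow> \<rho> (torus_exp (t *\<^sub>R \<xi>)) m = m"
        and \<xi>: "generating_field M \<rho> \<xi> m = (\<lambda>f. 0)" for \<xi> m
      using AB
    proof
      assume ?A
      then show ?thesis
        by (intro vanishes_if_assignment_vanishes[OF act cont sub fixed mom _ \<xi>]) (simp_all add: g)
    next
      assume ?B
      then show ?thesis
        by (intro vanishes_if_restrictions_vanish[OF act cont _ fixed[OF \<xi>]]) (simp add: g)
    qed
    show ?thesis
    proof (cases "model M = UNIV")
      case False
      then have "model M = {0}" using assms(1) by (auto simp: smooth_manifold_def model_space_def)
      interpret A: group_action "torus (UNIV :: (real ^ 'k) set)" UNIV \<rho> by (rule act)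
      have "\<one>\<^bsub>torus UNIV\<^esub> = torus_exp (0 :: real ^ 'k)"
        by (simp add: torus_def torus_exp_def vec_eq_iff)
      then have id: "\<rho> (torus_exp (0 :: real ^ 'k)) m = m" for m
        using A.id_eq_one by (metis UNIV_I restrict_apply')
      have triv: "\<rho> (torus_exp \<xi>) m = m" for \<xi> :: "real ^ 'k" and m
        by (rule trivial_action_if_discrete[OF open_singleton_if_model_0[OF assms(1) \<open>model M = {0}\<close>] cont id])
      have gf: "generating_field M \<rho> \<xi> m = (\<lambda>f. 0)" for \<xi> m
        by (simp add: generating_field_def triv fun_eq_iff)
      have sub: "subspace (inf_stabilizer M UNIV \<rho> m)" for m by (simp add: inf_stabilizer_def gf)
      show ?thesis
      proof
        assume AB: "?A \<or> ?B"
        have "\<Psi> m \<xi> = 0" for m \<xi> by (rule van[OF AB sub triv gf])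
        then show ?E using trivial by blast
      qed
    next
      case True
      interpret torus_manifold M \<rho>
        using assms(1,3) True g by unfold_locales auto
      define V where "V m = (\<Sum>b\<in>Basis. \<Psi> m b *\<^sub>R b)" for m
      have V: "V m \<bullet> \<xi> = \<Psi> m \<xi>" for m \<xi>
      proof -
        obtain f where f: "linear f" "\<Psi> m = restrict f UNIV" using lin[of m] g by blast
        show ?thesis using linear_eq_sum_Basis[OF f(1), of \<xi>]
          by (simp add: V_def f(2) inner_sum_right inner_commute[of _ \<xi>] mult.commute)
      qed
      have Vs: "smooth_map V" unfolding V_def
        using mom by (intro smooth_map_sum smooth_map_linear[OF bounded_linear_scaleR_left])
          (simp add: abstract_moment_map_def smooth_function_iff)
      have Vinv: "V (flow \<xi> m) = V m" for \<xi> m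
        using mom by (simp add: V_def abstract_moment_map_def torus_def)
      show ?thesis
      proof
        assume AB: "?A \<or> ?B"
        have "V m \<bullet> \<xi> = 0" if "generating_field M \<rho> \<xi> m = (\<lambda>f. 0)" for \<xi> m
          unfolding V by (rule van[OF AB subspace_inf_stabilizer generating_field_0_imp_fixed that])
        from invariant_form_exists[OF Vs Vinv this] show ?E by (auto simp: V g)
      qed
    qed
  qed
  then show ?thesis unfolding exact_moment_map_def by blast
qed

end
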